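(* Let $T=[x_0,\dots,x_n]\subset\mathbb R^n$ be an $n$-simplex, $f\in\Delta(T)$, $r\ge1$, $0\le k\le n$, let $E=E^{k,r,-}_{f,T}:\mathcal P^-_r\Lambda^k(f)\to\mathcal P^-_r\Lambda^k(T)$ be the barycentric extension operator, and let $$\mathcal P^-_r\Lambda^k(T,f)=\{\omega\in\mathcal P^-_r\Lambda^k(T)\mid\omega\text{ vanishes to order }r\text{ on }f^*\}.$$ Then $\mathcal P^-_r\Lambda^k(T,f)=E[\mathcal P^-_r\Lambda^k(f)]$, and for each $\mu\in\mathcal P^-_r\Lambda^k(f)$, $E\mu$ is the unique extension of $\mu$ to $\mathcal P^-_r\Lambda^k(T,f)$, i.e. the unique $\omega\in\mathcal P^-_r\Lambda^k(T,f)$ with $\operatorname{tr}_{T,f}\omega=\mu$.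
   Context: $\Delta(T)$ is the set of all nonempty faces of $T$ of all dimensions (including $T$). $\mathcal I(f)\subseteq\{0,\dots,n\}$ is the set of indices of the vertices of $f$, and $f^*$ is the face of $T$ opposite $f$, i.e. with index set $\{0,\dots,n\}\setminus\mathcal I(f)$ (empty if $f=T$). For $i\in\mathcal I(f)$, $\lambda_i^f$ is the affine function on $f$ with $\lambda_i^f(x_j)=\delta_{ij}$, $j\in\mathcal I(f)$. $\operatorname{tr}_{T,f}$ is the pullback of differential forms under the inclusion $f\hookrightarrow T$. For a simplex $f$, $\mathcal P_r\Lambda^k(f)$ is the space of differential $k$-forms on $f$ with coefficients polynomials of degree at most $r$ ($\{0\}$ if $r<0$ or $k>\dim f$). Choosing any origin $o$ in the affine hull of $f$, the Koszul operator is $(\kappa\omega)_x(v_1,\dots,v_{k-1})=\omega_x(x-o,v_1,\dots,v_{k-1})$, and $\mathcal P^-_r\Lambda^k(f)=\mathcal P_{r-1}\Lambda^k(f)+\kappa\mathcal P_{r-1}\Lambda^{k+1}(f)$ (independent of $o$). For an increasing map $\sigma:\{0,\dots,k\}\to\mathcal I(f)$ the Whitney form is $$\phi^f_\sigma=\sum_{i=0}^k(-1)^i\lambda^f_{\sigma(i)}\,d\lambda^f_{\sigma(0)}\wedge\cdots\wedge\widehat{d\lambda^f_{\sigma(i)}}\wedge\cdots\wedge d\lambda^f_{\sigma(k)}.$$ $E^{k,r,-}_{f,T}$ is the unique (well-defined) linear map with $E^{k,r,-}_{f,T}[(\lambda^f)^\alpha\phi^f_\sigma]=(\lambda^T)^\alpha\phi^T_\sigma$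 for all multi-indices $\alpha=(\alpha_i)_{i\in\mathcal I(f)}$ of nonnegative integers with $|\alpha|=r-1$ and all increasing $\sigma:\{0,\dots,k\}\to\mathcal I(f)$. A smooth function $u$ on $T$ vanishes to order $r$ at $x$ if $(\partial^\alpha u)(x)=0$ for all multi-indices $\alpha\in\mathbb N_0^n$ with $|\alpha|\le r-1$. A smooth $k$-form $\omega$ on $T$ vanishes to order $r$ at $x$ if for all $v_1,\dots,v_k\in\mathbb R^n$ the function $y\mapsto\omega_y(v_1,\dots,v_k)$ vanishes to order $r$ at $x$; it vanishes to order $r$ on a set if it does so at each point of the set. *)

theory Defs
  imports "HOL-Analysis.Analysis" "HOL-Combinatorics.Permutations"
begin

definition tangent :: "(real^'n) set \<Rightarrow> (real^'n) set" where
  "tangent S = {p - q | p q. p \<in> affine hull S \<and> q \<in> affine hull S}"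

text \<open>A form maps a point and a list of tangent vectors to a number.  A \<open>k\<close>-form on \<open>S\<close> is zero by
  convention when the point is not in \<open>S\<close>, the list does not have length \<open>k\<close>, or one of the vectors
  is not tangent to \<open>S\<close>, so that equality of forms on \<open>S\<close> is equality of functions.\<close>

type_synonym 'n form = "real^'n \<Rightarrow> (real^'n) list \<Rightarrow> real"

definition is_form :: "nat \<Rightarrow> (real^'n) set \<Rightarrow> 'n form \<Rightarrow> bool" where
  "is_form k S \<omega> \<longleftrightarrow>
     (\<forall>p vs. \<not> (p \<in> S \<and> length vs = k \<and> set vs \<subseteq> tangent S) \<longrightarrow> \<omega> p vs = 0) \<and>
     (\<forall>p\<in>S. \<forall>vs. length vs = k \<and> set vs \<subseteq> tangent S \<longrightarrow>
        (\<forall>i<k. \<forall>v\<in>tangent S. \<forall>w\<in>tangent S. \<forall>a b.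
           \<omega> p (vs[i := a *\<^sub>R v + b *\<^sub>R w]) = a * \<omega> p (vs[i := v]) + b * \<omega> p (vs[i := w])) \<and>
        (\<forall>i<k. \<forall>j<k. i \<noteq> j \<and> vs ! i = vs ! j \<longrightarrow> \<omega> p vs = 0))"

text \<open>Pullback under the inclusion of \<open>f\<close> in a larger set.\<close>

definition tr :: "(real^'n) set \<Rightarrow> 'n form \<Rightarrow> 'n form" where
  "tr f \<omega> = (\<lambda>p vs. if p \<in> f \<and> set vs \<subseteq> tangent f then \<omega> p vs else 0)"

definition diff_fun :: "(real^'n) set \<Rightarrow> (real^'n \<Rightarrow> real) \<Rightarrow> 'n form" where
  "diff_fun S u = (\<lambda>p vs. if p \<in> S \<and> length vs = 1 \<and> set vs \<subseteq> tangent S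
                          then frechet_derivative u (at p within S) (hd vs) else 0)"

text \<open>The wedge product of a list of \<open>1\<close>-forms on \<open>S\<close>, normalised so that
  \<open>(\<theta>\<^sub>1 \<and> \<dots> \<and> \<theta>\<^sub>k)(v\<^sub>1, \<dots>, v\<^sub>k) = det (\<theta>\<^sub>i(v\<^sub>j))\<close>; the empty product is the constant \<open>1\<close>.\<close>

definition wedge :: "(real^'n) set \<Rightarrow> 'n form list \<Rightarrow> 'n form" where
  "wedge S \<theta>s = (\<lambda>p vs. if p \<in> S \<and> length vs = length \<theta>s \<and> set vs \<subseteq> tangent S
      then \<Sum>\<pi> | \<pi> permutes {..<length \<theta>s}.
             of_int (sign \<pi>) * (\<Prod>i<length \<theta>s. (\<theta>s ! i) p [vs ! \<pi> i])
      else 0)"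

text \<open>The degree bound is an integer, so that only the zero function has degree at most \<open>r\<close>
  for negative \<open>r\<close>.\<close>

definition poly_fun_on :: "int \<Rightarrow> (real^'n) set \<Rightarrow> (real^'n \<Rightarrow> real) \<Rightarrow> bool" where
  "poly_fun_on r S u \<longleftrightarrow>
     (\<exists>c. \<forall>p\<in>S. u p = (\<Sum>\<alpha> | int (\<Sum>i\<in>UNIV. \<alpha> i) \<le> r. c \<alpha> * (\<Prod>i\<in>UNIV. (p $ i) ^ \<alpha> i)))"

definition poly_forms :: "int \<Rightarrow> nat \<Rightarrow> (real^'n) set \<Rightarrow> 'n form set" where
  "poly_forms r k S =
     {\<omega>. is_form k S \<omega> \<and>
         (\<forall>vs. length vs = k \<and> set vs \<subseteq> tangent S \<longrightarrow> poly_fun_on r S (\<lambda>p. \<omega> p vs))}"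

definition koszul :: "real^'n \<Rightarrow> 'n form \<Rightarrow> 'n form" where
  "koszul a \<omega> = (\<lambda>p vs. \<omega> p ((p - a) # vs))"

definition trimmed_forms :: "nat \<Rightarrow> nat \<Rightarrow> (real^'n) set \<Rightarrow> 'n form set" where
  "trimmed_forms r k S =
     (let a = (SOME a. a \<in> affine hull S) in
      {(\<lambda>p vs. \<omega> p vs + koszul a \<eta> p vs) | \<omega> \<eta>.
         \<omega> \<in> poly_forms (int r - 1) k S \<and> \<eta> \<in> poly_forms (int r - 1) (k + 1) S})"

text \<open>Derivatives are taken within \<open>S\<close>, which makes sense up to the boundary when \<open>S\<close> is an
  \<open>n\<close>-simplex in \<open>n\<close>-space.\<close>

definition partial :: "(real^'n) set \<Rightarrow> 'n \<Rightarrow> (real^'n \<Rightarrow> real) \<Rightarrow> (real^'n \<Rightarrow> real)" where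
  "partial S i u = (\<lambda>p. frechet_derivative u (at p within S) (axis i 1))"

text \<open>The index type has no order, so an enumeration of it is chosen; for smooth functions the
  order in which partial derivatives are taken is immaterial.\<close>

definition coords :: "'n::finite list" where
  "coords = (SOME is. distinct is \<and> set is = UNIV)"

definition multi_partial ::
    "(real^'n) set \<Rightarrow> ('n \<Rightarrow> nat) \<Rightarrow> (real^'n \<Rightarrow> real) \<Rightarrow> (real^'n \<Rightarrow> real)" where
  "multi_partial S \<alpha> u = foldr (\<lambda>i. partial S i ^^ \<alpha> i) coords u"

definition fun_vanishes :: "(real^'n) set \<Rightarrow> nat \<Rightarrow> (real^'n \<Rightarrow> real) \<Rightarrow> real^'n \<Rightarrow> bool" where
  "fun_vanishes S r u p \<longleftrightarrow> (\<forall>\<alpha>. (\<Sum>i\<in>UNIV. \<alpha> i) < r \<longrightarrow> multi_partial S \<alpha> u p = 0)"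

definition form_vanishes_on ::
    "(real^'n) set \<Rightarrow> nat \<Rightarrow> nat \<Rightarrow> 'n form \<Rightarrow> (real^'n) set \<Rightarrow> bool" where
  "form_vanishes_on S k r \<omega> X \<longleftrightarrow>
     (\<forall>p\<in>X. \<forall>vs. length vs = k \<longrightarrow> fun_vanishes S r (\<lambda>q. \<omega> q vs) p)"

text \<open>Throughout, \<open>x\<close> lists the vertices \<open>x 0, \<dots>, x n\<close> of an \<open>n\<close>-simplex in \<open>n\<close>-space; the values
  of \<open>x\<close> beyond \<open>n\<close> play no role.\<close>

definition faces :: "(real^'n) set \<Rightarrow> (real^'n) set set" where
  "faces T = {f. f face_of T \<and> f \<noteq> {}}"

definition vertex_indices :: "(nat \<Rightarrow> real^'n) \<Rightarrow> (real^'n) set \<Rightarrow> nat set" where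
  "vertex_indices x f = {i. i \<le> CARD('n) \<and> x i extreme_point_of f}"

definition opposite_face :: "(nat \<Rightarrow> real^'n) \<Rightarrow> (real^'n) set \<Rightarrow> (real^'n) set" where
  "opposite_face x f = convex hull (x ` ({0..CARD('n)} - vertex_indices x f))"

text \<open>Set to zero off \<open>f\<close>, to be determined by its values on \<open>f\<close>.\<close>

definition bary :: "(nat \<Rightarrow> real^'n) \<Rightarrow> (real^'n) set \<Rightarrow> nat \<Rightarrow> real^'n \<Rightarrow> real" where
  "bary x f i =
     (THE l. (\<exists>h c. linear h \<and> (\<forall>p. l p = (if p \<in> f then h p + c else 0))) \<and>
             (\<forall>j\<in>vertex_indices x f. l (x j) = (if i = j then 1 else 0)))"

definition bary_power ::
    "(nat \<Rightarrow> real^'n) \<Rightarrow> (real^'n) set \<Rightarrow> (nat \<Rightarrow> nat) \<Rightarrow> real^'n \<Rightarrow> real" where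
  "bary_power x f \<alpha> p = (\<Prod>i\<in>vertex_indices x f. bary x f i p ^ \<alpha> i)"

definition whitney ::
    "(nat \<Rightarrow> real^'n) \<Rightarrow> (real^'n) set \<Rightarrow> nat \<Rightarrow> (nat \<Rightarrow> nat) \<Rightarrow> 'n form" where
  "whitney x f k \<sigma> = (\<lambda>p vs. \<Sum>i=0..k. (- 1) ^ i * bary x f (\<sigma> i) p *
      wedge f (map (\<lambda>j. diff_fun f (bary x f (\<sigma> j))) (filter (\<lambda>j. j \<noteq> i) [0..<Suc k])) p vs)"

text \<open>Linearity is required on the space of trimmed forms on \<open>f\<close> only; off that space the operator
  is set to zero.  Multi-indices on the vertices of \<open>f\<close> are extended by zero to all indices.\<close>

definition is_bary_ext ::
    "(nat \<Rightarrow> real^'n) \<Rightarrow> (real^'n) set \<Rightarrow> (real^'n) set \<Rightarrow> nat \<Rightarrow> nat \<Rightarrow> ('n form \<Rightarrow> 'n form) \<Rightarrow> bool"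
  where
  "is_bary_ext x T f k r E \<longleftrightarrow>
     (\<forall>\<mu>\<in>trimmed_forms r k f. E \<mu> \<in> trimmed_forms r k T) \<and>
     (\<forall>\<mu>. \<mu> \<notin> trimmed_forms r k f \<longrightarrow> E \<mu> = (\<lambda>p vs. 0)) \<and>
     (\<forall>\<mu>\<in>trimmed_forms r k f. \<forall>\<nu>\<in>trimmed_forms r k f. \<forall>a b.
        E (\<lambda>p vs. a * \<mu> p vs + b * \<nu> p vs) = (\<lambda>p vs. a * E \<mu> p vs + b * E \<nu> p vs)) \<and>
     (\<forall>\<alpha> \<sigma>. (\<forall>i. i \<notin> vertex_indices x f \<longrightarrow> \<alpha> i = 0) \<and>
            (\<Sum>i\<in>vertex_indices x f. \<alpha> i) + 1 = r \<and>
            strict_mono_on {0..k} \<sigma> \<and> \<sigma> ` {0..k} \<subseteq> vertex_indices x f \<longrightarrow>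
        E (\<lambda>p vs. bary_power x f \<alpha> p * whitney x f k \<sigma> p vs) =
          (\<lambda>p vs. bary_power x T \<alpha> p * whitney x T k \<sigma> p vs))"

definition bary_ext ::
    "(nat \<Rightarrow> real^'n) \<Rightarrow> (real^'n) set \<Rightarrow> (real^'n) set \<Rightarrow> nat \<Rightarrow> nat \<Rightarrow> 'n form \<Rightarrow> 'n form" where
  "bary_ext x T f k r = (THE E. is_bary_ext x T f k r E)"

definition vanishing_forms ::
    "(nat \<Rightarrow> real^'n) \<Rightarrow> (real^'n) set \<Rightarrow> (real^'n) set \<Rightarrow> nat \<Rightarrow> nat \<Rightarrow> 'n form set" where
  "vanishing_forms x T f k r =
     {\<omega> \<in> trimmed_forms r k T. form_vanishes_on T k r \<omega> (opposite_face x f)}"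

end

theory Submission
  imports Defs "Jordan_Normal_Form.Determinant"
begin

text \<open>
  In barycentric coordinates a Whitney form is the determinant obtained by bordering the matrix of the
  differentials with a top row of coordinate values.  Expanding polynomial alternating forms over the
  vertices and homogenising their coefficients shows that the forms \<open>\<lambda>\<^sup>\<alpha> \<phi>\<^sub>\<sigma>\<close> span the
  trimmed forms.  The projection of \<open>T\<close> onto \<open>f\<close> from the opposite face, in coordinates
  \<open>(\<lambda>\<^sub>i)\<close> mapped to \<open>(\<lambda>\<^sub>i / s)\<close> where \<open>s\<close> is the sum of the coordinates of \<open>f\<close>,
  pulls a trimmed form \<open>\<mu>\<close> back to a rational form, and \<open>s\<close> to the power \<open>r + k\<close> times this
  pullback is \<open>E \<mu>\<close> by column operations on the determinant.  This closed formula makes \<open>E\<close> well defined.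

  Conversely, let \<open>\<omega>\<close> be a trimmed form vanishing to order \<open>r\<close> on the opposite face.
  Its coefficients have degree at most \<open>r\<close>, so they are homogeneous of degree \<open>r\<close> about every point
  \<open>p\<close> of that face.  As the Koszul operator squares to zero, the contraction of \<open>\<omega>\<close> with the
  radial field at \<open>p\<close> also has degree at most \<open>r\<close>, whereas homogeneity gives it degree \<open>r + 1\<close>;
  hence it is zero.  Both facts together say that \<open>\<omega>\<close> is the rescaled pullback of its own trace.
\<close>

no_notation vec_index (infixl "$" 100)

section \<open>Determinants\<close>

text \<open>The forms \<lambda>^\<alpha> \<phi>_\<sigma> are in general linearly dependent, so a
  linear map cannot be prescribed on them freely. A formula linear in the whole form \<mu> removes
  this obstacle, since it respects every relation between them. The exponent r + k counts powers of
  1/s in the pullback of such a form: r - 1 from the monomial, one from the top row of the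
  determinant, and k from its rows of differentials. On T the formula is singular exactly on the
  opposite face; the value 0 put there agrees with the extension because every term of a Whitney
  form has a coordinate of f as a factor.

  For the converse, a point q with 0 < s < 1 is p + s (m - p), where m is its projection to f and p
  lies in the opposite face, so homogeneity about p supplies s^r. Every vector is s times its image
  under the derivative of the projection plus a combination of the vectors m - x_j with x_j not in
  f. These are radial directions, so the contractions vanish and the k arguments supply s^k. If f =
  T, the opposite face is empty and s = 1 throughout T.\<close>

definition detf :: "nat \<Rightarrow> (nat \<Rightarrow> nat \<Rightarrow> real) \<Rightarrow> real" where
  "detf m A = Determinant.det (Matrix.mat m m (\<lambda>(i, j). A i j))"

text \<open>The bridge to \<open>wedge\<close>, whose normalisation is exactly this Leibniz
  sum.\<close>

lemma detf_perm_sum: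
  "detf m A = (\<Sum>p | p permutes {..<m}. of_int (sign p) * (\<Prod>i<m. A i (p i)))"
proof -
  have "Determinant.det (Matrix.mat m m (\<lambda>(i, j). A i j)) =
      (\<Sum>p\<in>{p. p permutes {0..<m}}. of_int (sign p) *
         (\<Prod>i = 0..<m. Matrix.mat m m (\<lambda>(i, j). A i j) $$ (i, p i)))"
    by (subst det_def'[of _ m]) auto
  also have "\<dots> = (\<Sum>p\<in>{p. p permutes {0..<m}}. of_int (sign p) * (\<Prod>i = 0..<m. A i (p i)))"
  proof (intro sum.cong refl arg_cong2[where f = "(*)"] prod.cong)
    fix p i assume "p \<in> {p. p permutes {0..<m}}" "i \<in> {0..<m}"
    then show "Matrix.mat m m (\<lambda>(i, j). A i j) $$ (i, p i) = A i (p i)"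
      using permutes_in_image[of p "{0..<m}" i] by auto
  qed
  finally show ?thesis
    by (simp add: detf_def lessThan_atLeast0)
qed

lemma detf_transpose: "detf m (\<lambda>i j. A j i) = detf m A"
proof -
  have "Matrix.mat m m (\<lambda>(i, j). A j i) = transpose_mat (Matrix.mat m m (\<lambda>(i, j). A i j))"
    by (rule eq_matI) auto
  then show ?thesis
    unfolding detf_def by (simp add: det_transpose[of _ m])
qed

lemma detf_cong:
  assumes "\<And>i j. i < m \<Longrightarrow> j < m \<Longrightarrow> A i j = B i j"
  shows "detf m A = detf m B"
  unfolding detf_def by (rule arg_cong[where f = Determinant.det], rule eq_matI) (auto simp: assms)

lemma mat_delete_mat_of_fun:
  "mat_delete (Matrix.mat (Suc m) (Suc m) (\<lambda>(i, j). A i j)) i j =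
     Matrix.mat m m (\<lambda>(i', j'). A (if i' < i then i' else Suc i') (if j' < j then j' else Suc j'))"
  unfolding mat_delete_def by (rule eq_matI) auto

text \<open>Cofactors along row \<open>i\<close> do not see that row, so they may be taken from any
  \<open>B\<close> that agrees with \<open>A\<close> elsewhere. Matrices differing only in row
  \<open>i\<close> thus share their cofactors, which makes linearity in a row immediate.\<close>

lemma detf_row_expansion:
  assumes "i < m" "\<And>i'. i' \<noteq> i \<Longrightarrow> A i' = B i'"
  shows "detf m A = (\<Sum>j<m. A i j * cofactor (Matrix.mat m m (\<lambda>(i, j). B i j)) i j)"
proof -
  obtain n where m: "m = Suc n"
    using assms(1) by (cases m) auto
  have "cofactor (Matrix.mat m m (\<lambda>(i, j). A i j)) i j = cofactor (Matrix.mat m m (\<lambda>(i, j). B i j)) i j" for j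
    unfolding cofactor_def m mat_delete_mat_of_fun
    by (rule arg_cong[where f = "\<lambda>M. _ * Determinant.det M"], rule eq_matI) (auto simp: assms(2))
  then show ?thesis
    unfolding detf_def using assms(1)
    by (subst laplace_expansion_row[of _ m i]) auto
qed

lemma detf_row_linear:
  assumes "i < m"
  shows "detf m (A(i := \<lambda>j. a * u j + b * v j)) = a * detf m (A(i := u)) + b * detf m (A(i := v))"
  using assms
  by (simp add: detf_row_expansion[where B = A] sum_distrib_left sum.distrib algebra_simps)

lemma detf_first_row_expansion:
  "detf (Suc m) A =
     (\<Sum>j<Suc m. (-1) ^ j * A 0 j * detf m (\<lambda>i' j'. A (Suc i') (if j' < j then j' else Suc j')))"
  by (subst detf_row_expansion[of 0 _ A A])
     (auto simp: cofactor_def mat_delete_mat_of_fun detf_def algebra_simps intro!: sum.cong)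

lemma detf_first_column_expansion:
  "detf (Suc m) A =
     (\<Sum>i<Suc m. (-1) ^ i * A i 0 * detf m (\<lambda>i' j'. A (if i' < i then i' else Suc i') (Suc j')))"
  unfolding detf_def
  by (subst laplace_expansion_column[of _ "Suc m" 0])
     (auto simp: cofactor_def mat_delete_mat_of_fun algebra_simps intro!: sum.cong)

lemma detf_identical_rows:
  assumes "i < m" "i' < m" "i \<noteq> i'" "\<And>j. j < m \<Longrightarrow> A i j = A i' j"
  shows "detf m A = 0"
  unfolding detf_def
  by (rule det_identical_rows[of _ m i i']) (use assms in \<open>auto intro!: eq_vecI\<close>)

lemma detf_identical_columns:
  assumes "j < m" "j' < m" "j \<noteq> j'" "\<And>i. i < m \<Longrightarrow> A i j = A i j'"
  shows "detf m A = 0"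
  unfolding detf_def
  by (rule det_identical_columns[of _ m j j']) (use assms in \<open>auto intro!: eq_vecI\<close>)

lemma detf_permute_columns:
  assumes p: "p permutes {..<m}"
  shows "detf m (\<lambda>i j. A i (p j)) = of_int (sign p) * detf m A"
proof -
  have "detf m (\<lambda>i j. A i (p j)) = (\<Sum>q | q permutes {..<m}. of_int (sign q) * (\<Prod>i<m. A i ((p \<circ> q) i)))"
    by (simp add: detf_perm_sum)
  also have "\<dots> = (\<Sum>q | q permutes {..<m}. of_int (sign p) * (of_int (sign (p \<circ> q)) * (\<Prod>i<m. A i ((p \<circ> q) i))))"
  proof (intro sum.cong refl)
    fix q assume "q \<in> {q. q permutes {..<m}}"
    then have "sign (p \<circ> q) = sign p * sign q"
      by (intro sign_compose) (use p permutation_permutes in auto)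
    then show "of_int (sign q) * (\<Prod>i<m. A i ((p \<circ> q) i)) =
        of_int (sign p) * (of_int (sign (p \<circ> q)) * (\<Prod>i<m. A i ((p \<circ> q) i)))"
      by (simp add: sign_def)
  qed
  also have "\<dots> = of_int (sign p) * (\<Sum>q | q permutes {..<m}. of_int (sign (p \<circ> q)) * (\<Prod>i<m. A i ((p \<circ> q) i)))"
    by (simp add: sum_distrib_left)
  also have "\<dots> = of_int (sign p) * detf m A"
    unfolding detf_perm_sum
    by (rule arg_cong[where f = "\<lambda>s. of_int (sign p) * s"], subst setum_permutations_compose_left[OF p]) (rule refl)
  finally show ?thesis .
qed

section \<open>Alternating multilinear functions of a list of vectors\<close>

text \<open>The pointwise part of \<open>is_form\<close>, freed from the base point so that it
  applies to determinants and to single values of a form alike.\<close>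

definition alternating_on :: "nat \<Rightarrow> 'a::real_vector set \<Rightarrow> ('a list \<Rightarrow> real) \<Rightarrow> bool" where
  "alternating_on m V g \<longleftrightarrow>
     (\<forall>vs. length vs = m \<and> set vs \<subseteq> V \<longrightarrow>
        (\<forall>i<m. \<forall>v\<in>V. \<forall>w\<in>V. \<forall>a b.
           g (vs[i := a *\<^sub>R v + b *\<^sub>R w]) = a * g (vs[i := v]) + b * g (vs[i := w])) \<and>
        (\<forall>i<m. \<forall>j<m. i \<noteq> j \<and> vs ! i = vs ! j \<longrightarrow> g vs = 0))"

lemma is_form_alternating_on:
  "is_form k S \<omega> \<longleftrightarrow>
     (\<forall>p vs. \<not> (p \<in> S \<and> length vs = k \<and> set vs \<subseteq> tangent S) \<longrightarrow> \<omega> p vs = 0) \<and>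
     (\<forall>p\<in>S. alternating_on k (tangent S) (\<omega> p))"
  by (simp add: is_form_def alternating_on_def)

lemma alternating_onI:
  assumes "\<And>vs i v w a b. \<lbrakk>length vs = m; set vs \<subseteq> V; i < m; v \<in> V; w \<in> V\<rbrakk> \<Longrightarrow>
      g (vs[i := a *\<^sub>R v + b *\<^sub>R w]) = a * g (vs[i := v]) + b * g (vs[i := w])"
    and "\<And>vs i j. \<lbrakk>length vs = m; set vs \<subseteq> V; i < m; j < m; i \<noteq> j; vs ! i = vs ! j\<rbrakk> \<Longrightarrow> g vs = 0"
  shows "alternating_on m V g"
  using assms unfolding alternating_on_def by blast

lemma alternating_on_linear:
  assumes "alternating_on m V g" "length vs = m" "set vs \<subseteq> V" "i < m" "v \<in> V" "w \<in> V"
  shows "g (vs[i := a *\<^sub>R v + b *\<^sub>R w]) = a * g (vs[i := v]) + b * g (vs[i := w])"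
  using assms unfolding alternating_on_def by blast

lemma alternating_on_eq_0:
  assumes "alternating_on m V g" "length vs = m" "set vs \<subseteq> V" "i < m" "j < m" "i \<noteq> j" "vs ! i = vs ! j"
  shows "g vs = 0"
  using assms unfolding alternating_on_def by blast

lemma alternating_on_mono:
  assumes "alternating_on m V g" "W \<subseteq> V"
  shows "alternating_on m W g"
  unfolding alternating_on_def
proof (intro allI impI)
  fix vs assume vs: "length vs = m \<and> set vs \<subseteq> W"
  then have "length vs = m \<and> set vs \<subseteq> V"
    using assms(2) by blast
  then have "(\<forall>i<m. \<forall>v\<in>V. \<forall>w\<in>V. \<forall>a b.
       g (vs[i := a *\<^sub>R v + b *\<^sub>R w]) = a * g (vs[i := v]) + b * g (vs[i := w])) \<and>
     (\<forall>i<m. \<forall>j<m. i \<noteq> j \<and> vs ! i = vs ! j \<longrightarrow> g vs = 0)"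
    using assms(1) unfolding alternating_on_def by blast
  then show "(\<forall>i<m. \<forall>v\<in>W. \<forall>w\<in>W. \<forall>a b.
       g (vs[i := a *\<^sub>R v + b *\<^sub>R w]) = a * g (vs[i := v]) + b * g (vs[i := w])) \<and>
     (\<forall>i<m. \<forall>j<m. i \<noteq> j \<and> vs ! i = vs ! j \<longrightarrow> g vs = 0)"
    using assms(2) by (meson subsetD)
qed

lemma alternating_on_cong:
  assumes "alternating_on m V g" "\<And>vs. length vs = m \<Longrightarrow> set vs \<subseteq> V \<Longrightarrow> g' vs = g vs" "subspace V"
  shows "alternating_on m V g'"
proof (rule alternating_onI)
  fix vs i v w and a b :: real
  assume *: "length vs = m" "set vs \<subseteq> V" "i < m" "v \<in> V" "w \<in> V"
  have "set (vs[i := z]) \<subseteq> V" if "z \<in> V" for z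
    using set_update_subset_insert[of vs i z] that * by blast
  moreover have "a *\<^sub>R v + b *\<^sub>R w \<in> V"
    using * assms(3) by (simp add: subspace_add subspace_scale)
  ultimately show "g' (vs[i := a *\<^sub>R v + b *\<^sub>R w]) = a * g' (vs[i := v]) + b * g' (vs[i := w])"
    using * by (simp add: assms(2) alternating_on_linear[OF assms(1)])
next
  fix vs i j
  assume "length vs = m" "set vs \<subseteq> V" "i < m" "j < m" "i \<noteq> j" "vs ! i = vs ! j"
  then show "g' vs = 0"
    by (metis alternating_on_eq_0 assms(1,2))
qed

lemma alternating_on_lincomb:
  assumes "alternating_on m V g" "alternating_on m V g'"
  shows "alternating_on m V (\<lambda>vs. a * g vs + b * g' vs)"
proof (rule alternating_onI)
  fix vs i v w and a' b' :: real
  assume *: "length vs = m" "set vs \<subseteq> V" "i < m" "v \<in> V" "w \<in> V"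
  show "a * g (vs[i := a' *\<^sub>R v + b' *\<^sub>R w]) + b * g' (vs[i := a' *\<^sub>R v + b' *\<^sub>R w]) =
     a' * (a * g (vs[i := v]) + b * g' (vs[i := v])) + b' * (a * g (vs[i := w]) + b * g' (vs[i := w]))"
    by (simp add: alternating_on_linear[OF assms(1) *] alternating_on_linear[OF assms(2) *] algebra_simps)
next
  fix vs i j
  assume *: "length vs = m" "set vs \<subseteq> V" "i < m" "j < m" "i \<noteq> j" "vs ! i = vs ! j"
  show "a * g vs + b * g' vs = 0"
    by (simp add: alternating_on_eq_0[OF assms(1) *] alternating_on_eq_0[OF assms(2) *])
qed

lemma alternating_on_Cons:
  assumes "alternating_on (Suc m) V g" "w \<in> V"
  shows "alternating_on m V (\<lambda>vs. g (w # vs))"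
proof (rule alternating_onI)
  fix vs i v v' and a b :: real
  assume "length vs = m" "set vs \<subseteq> V" "i < m" "v \<in> V" "v' \<in> V"
  then show "g (w # vs[i := a *\<^sub>R v + b *\<^sub>R v']) = a * g (w # vs[i := v]) + b * g (w # vs[i := v'])"
    using alternating_on_linear[OF assms(1), of "w # vs" "Suc i" v v' a b] assms(2) by simp
next
  fix vs i j
  assume "length vs = m" "set vs \<subseteq> V" "i < m" "j < m" "i \<noteq> j" "vs ! i = vs ! j"
  then show "g (w # vs) = 0"
    using alternating_on_eq_0[OF assms(1), of "w # vs" "Suc i" "Suc j"] assms(2) by simp
qed

lemma alternating_on_sum:
  assumes g: "alternating_on m V g" and V: "subspace V"
    and vs: "length vs = m" "set vs \<subseteq> V" "i < m"
    and I: "finite I" "\<And>l. l \<in> I \<Longrightarrow> y l \<in> V"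
  shows "g (vs[i := \<Sum>l\<in>I. u l *\<^sub>R y l]) = (\<Sum>l\<in>I. u l * g (vs[i := y l]))"
  using I
proof (induction I)
  case empty
  have "0 \<in> V"
    using V subspace_0 by blast
  from alternating_on_linear[OF g vs this this, of 0 0] show ?case
    by simp
next
  case (insert l I)
  have "(\<Sum>l\<in>I. u l *\<^sub>R y l) \<in> V"
    using insert.prems by (intro subspace_sum V subspace_scale) auto
  then show ?case
    using alternating_on_linear[OF g vs, of "y l" "\<Sum>l\<in>I. u l *\<^sub>R y l" "u l" 1] insert by simp
qed

lemma sum_lists_Suc:
  assumes "finite I"
  shows "(\<Sum>is | set is \<subseteq> I \<and> length is = Suc m. F is) =
     (\<Sum>i\<in>I. \<Sum>is | set is \<subseteq> I \<and> length is = m. F (i # is))"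
proof -
  let ?L = "\<lambda>m. {is. set is \<subseteq> I \<and> length is = m}"
  have "?L (Suc m) = (\<lambda>(i, is). i # is) ` (I \<times> ?L m)"
    by (auto simp: length_Suc_conv image_def)
  moreover have "inj_on (\<lambda>(i, is). i # is) (I \<times> ?L m)"
    by (auto simp: inj_on_def)
  ultimately show ?thesis
    by (simp add: sum.reindex sum.cartesian_product case_prod_unfold)
qed

text \<open>Multilinearity in the first argument, then induction on the remaining ones with the
  first frozen at a vector \<open>y i\<close>. Index lists may contain repetitions.\<close>

lemma alternating_on_expand:
  assumes "alternating_on m V g" and V: "subspace V" and I: "finite I" "\<And>i. i \<in> I \<Longrightarrow> y i \<in> V"
    and "length vs = m" "\<And>j. j < m \<Longrightarrow> vs ! j = (\<Sum>i\<in>I. u j i *\<^sub>R y i)"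
  shows "g vs = (\<Sum>is | set is \<subseteq> I \<and> length is = m. (\<Prod>j<m. u j (is ! j)) * g (map y is))"
  using assms(1,5,6)
proof (induction m arbitrary: g vs u)
  case 0
  then have "{is. set is \<subseteq> I \<and> length is = 0} = {[]}"
    by auto
  with 0 show ?case
    by simp
next
  case (Suc m)
  then obtain w ws where vs: "vs = w # ws"
    by (cases vs) auto
  have ws: "length ws = m" "\<And>j. j < m \<Longrightarrow> ws ! j = (\<Sum>i\<in>I. u (Suc j) i *\<^sub>R y i)"
    using Suc.prems(2) Suc.prems(3)[of "Suc j" for j] by (auto simp: vs)
  have sumV: "(\<Sum>i\<in>I. c i *\<^sub>R y i) \<in> V" for c
    by (intro subspace_sum V subspace_scale I)
  have w: "w = (\<Sum>i\<in>I. u 0 i *\<^sub>R y i)"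
    using Suc.prems(3)[of 0] by (simp add: vs)
  have "w \<in> V"
    unfolding w by (rule sumV)
  moreover have "set ws \<subseteq> V"
    using ws sumV by (auto simp: in_set_conv_nth)
  ultimately have "set vs \<subseteq> V"
    by (simp add: vs)
  have "g vs = g (vs[0 := \<Sum>i\<in>I. u 0 i *\<^sub>R y i])"
    by (simp add: vs w)
  also have "\<dots> = (\<Sum>i\<in>I. u 0 i * g (y i # ws))"
    by (subst alternating_on_sum[OF Suc.prems(1) V Suc.prems(2) \<open>set vs \<subseteq> V\<close> _ I]) (auto simp: vs)
  also have "\<dots> = (\<Sum>i\<in>I. u 0 i * (\<Sum>is | set is \<subseteq> I \<and> length is = m.
      (\<Prod>j<m. u (Suc j) (is ! j)) * g (y i # map y is)))"
    by (intro sum.cong refl arg_cong2[where f = "(*)"]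
        Suc.IH[OF alternating_on_Cons[OF Suc.prems(1) I(2)]] ws)
  also have "\<dots> = (\<Sum>is | set is \<subseteq> I \<and> length is = Suc m. (\<Prod>j<Suc m. u j (is ! j)) * g (map y is))"
    by (simp add: sum_lists_Suc[OF I(1)] prod.lessThan_Suc_shift sum_distrib_left mult.assoc del: prod.lessThan_Suc)
  finally show ?case .
qed

text \<open>Polarisation: with all other arguments fixed, expanding the value at
  \<open>(a + b, a + b)\<close>, which is 0, leaves only the two mixed terms.\<close>

lemma alternating_on_swap:
  assumes g: "alternating_on m V g" and V: "subspace V"
    and vs: "length vs = m" "set vs \<subseteq> V" and ij: "i < m" "j < m" "i \<noteq> j"
  shows "g (vs[i := vs ! j, j := vs ! i]) = - g vs"
proof -
  define F where "F a b = g (vs[i := a, j := b])" for a b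
  have upd: "set (vs[i := a, j := b]) \<subseteq> V" "set (vs[i := a]) \<subseteq> V" if "a \<in> V" "b \<in> V" for a b
    using that vs(2) by (meson insert_subset order_trans set_update_subset_insert set_update_subsetI)+
  have eq0: "F a a = 0" if "a \<in> V" for a
    unfolding F_def by (rule alternating_on_eq_0[OF g _ upd(1) ij]) (use that vs ij in auto)
  have add2: "F a (b + c) = F a b + F a c" if "a \<in> V" "b \<in> V" "c \<in> V" for a b c
    using alternating_on_linear[OF g, of "vs[i := a]" j b c 1 1] that upd vs ij by (simp add: F_def)
  have add1: "F (b + c) a = F b a + F c a" if "a \<in> V" "b \<in> V" "c \<in> V" for a b c
    using alternating_on_linear[OF g, of "vs[j := a]" i b c 1 1] that upd vs ij
    by (simp add: F_def list_update_swap set_update_subsetI)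
  define a b where "a = vs ! i" and "b = vs ! j"
  have ab: "a \<in> V" "b \<in> V"
    using vs ij by (auto simp: a_def b_def)
  then have "a + b \<in> V"
    by (simp add: V subspace_add)
  then have "0 = F a a + F a b + (F b a + F b b)"
    using eq0[of "a + b"] by (simp add: add1 add2 ab)
  then have "F b a = - F a b"
    using eq0 ab by simp
  then show ?thesis
    by (simp add: F_def a_def b_def)
qed

lemma alternating_on_permute:
  assumes g: "alternating_on m V g" and V: "subspace V"
    and vs: "length vs = m" "set vs \<subseteq> V" and p: "p permutes {..<m}"
  shows "g (permute_list p vs) = of_int (sign p) * g vs"
proof -
  have "\<forall>vs. length vs = m \<and> set vs \<subseteq> V \<longrightarrow> g (permute_list p vs) = of_int (sign p) * g vs"
    using p finite_lessThan
  proof (induction p rule: permutes_induct)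
    case id
    show ?case
      by simp
  next
    case (swap a b p)
    show ?case
    proof (intro allI impI)
      fix vs assume vs: "length vs = m \<and> set vs \<subseteq> V"
      have t: "permute_list (Transposition.transpose a b) vs = vs[a := vs ! b, b := vs ! a]"
        using swap.hyps vs
        by (intro nth_equalityI) (auto simp: permute_list_def nth_list_update Transposition.transpose_def)
      have tp: "Transposition.transpose a b permutes {..<m}"
        by (rule permutes_swap_id) (use swap.hyps in auto)
      have "permute_list (Transposition.transpose a b \<circ> p) vs = permute_list p (permute_list (Transposition.transpose a b) vs)"
        by (rule permute_list_compose) (use swap.hyps vs in auto)
      moreover have "set (permute_list (Transposition.transpose a b) vs) \<subseteq> V"
        using tp vs by simp
      moreover have "sign (Transposition.transpose a b \<circ> p) = - sign p"
        using swap.hyps tp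
        by (subst sign_compose) (auto simp: sign_swap_id permutation_permutes)
      ultimately show "g (permute_list (Transposition.transpose a b \<circ> p) vs) = of_int (sign (Transposition.transpose a b \<circ> p)) * g vs"
        using swap.IH vs swap.hyps alternating_on_swap[OF g V, of vs a b] t by simp
    qed
  qed
  then show ?thesis
    using vs by blast
qed

text \<open>Averaging the plain expansion over all permutations turns the products of coefficients
  into determinants. Summing over all index lists instead of increasing ones costs the factor
  \<open>fact m\<close> but requires no choice of representatives.\<close>

lemma alternating_on_expand_detf:
  assumes g: "alternating_on m V g" and V: "subspace V" and I: "finite I" "\<And>i. i \<in> I \<Longrightarrow> y i \<in> V"
    and vs: "length vs = m" "\<And>j. j < m \<Longrightarrow> vs ! j = (\<Sum>i\<in>I. u j i *\<^sub>R y i)"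
  shows "fact m * g vs =
    (\<Sum>is | set is \<subseteq> I \<and> length is = m. g (map y is) * detf m (\<lambda>j l. u j (is ! l)))"
proof -
  let ?L = "{is. set is \<subseteq> I \<and> length is = m}"
  have bij: "bij_betw (permute_list p) ?L ?L" if p: "p permutes {..<m}" for p
  proof (rule bij_betw_byWitness[where f' = "permute_list (inv_into UNIV p)"])
    have ip: "inv_into UNIV p permutes {..<m}"
      using p by (rule permutes_inv)
    show "\<forall>is\<in>?L. permute_list (inv_into UNIV p) (permute_list p is) = is"
      using p ip by (auto simp: permutes_inv_o simp flip: permute_list_compose)
    show "\<forall>is\<in>?L. permute_list p (permute_list (inv_into UNIV p) is) = is"
      using p ip by (auto simp: permutes_inv_o simp flip: permute_list_compose)
  qed (use p permutes_inv[OF p] in auto)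
  \<comment> \<open>For a fixed \<open>p\<close> the index lists are reindexed by
    \<open>permute_list p\<close>; moving \<open>p\<close> out of the argument of \<open>g\<close>
    produces the sign.\<close>
  have *: "g vs = (\<Sum>is\<in>?L. of_int (sign p) * (\<Prod>j<m. u j (is ! p j)) * g (map y is))"
    if p: "p permutes {..<m}" for p
  proof -
    have "g vs = (\<Sum>is\<in>?L. (\<Prod>j<m. u j (is ! j)) * g (map y is))"
      by (rule alternating_on_expand[OF g V I vs])
    also have "\<dots> = (\<Sum>is\<in>?L. (\<Prod>j<m. u j (permute_list p is ! j)) * g (map y (permute_list p is)))"
      by (rule sum.reindex_bij_betw[OF bij[OF p], symmetric])
    also have "\<dots> = (\<Sum>is\<in>?L. of_int (sign p) * (\<Prod>j<m. u j (is ! p j)) * g (map y is))"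
    proof (intro sum.cong refl)
      fix "is" assume "is": "is \<in> ?L"
      have "map y (permute_list p is) = permute_list p (map y is)"
        using p "is" by (simp add: permute_list_map)
      moreover have "g (permute_list p (map y is)) = of_int (sign p) * g (map y is)"
        by (rule alternating_on_permute[OF g V _ _ p]) (use "is" I in auto)
      ultimately show "(\<Prod>j<m. u j (permute_list p is ! j)) * g (map y (permute_list p is)) =
          of_int (sign p) * (\<Prod>j<m. u j (is ! p j)) * g (map y is)"
        using "is" p by (simp add: permute_list_nth)
    qed
    finally show ?thesis .
  qed
  have "fact m * g vs = (\<Sum>p | p permutes {..<m}. g vs)"
    by (simp add: card_permutations)
  also have "\<dots> = (\<Sum>p | p permutes {..<m}. \<Sum>is\<in>?L. of_int (sign p) * (\<Prod>j<m. u j (is ! p j)) * g (map y is))"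
    by (intro sum.cong refl *) auto
  also have "\<dots> = (\<Sum>is\<in>?L. \<Sum>p | p permutes {..<m}. of_int (sign p) * (\<Prod>j<m. u j (is ! p j)) * g (map y is))"
    by (rule sum.swap)
  also have "\<dots> = (\<Sum>is\<in>?L. g (map y is) * detf m (\<lambda>j l. u j (is ! l)))"
    by (simp add: detf_perm_sum sum_distrib_left mult_ac)
  finally show ?thesis .
qed

lemma alternating_on_detf:
  assumes "\<And>j. j < m \<Longrightarrow> linear (H j)"
  shows "alternating_on m V (\<lambda>vs. detf m (\<lambda>i j. H j (vs ! i)))"
proof (rule alternating_onI)
  fix vs :: "'a list" and i v w and a b :: real
  assume *: "length vs = m" "i < m"
  define A where "A = (\<lambda>i j. H j (vs ! i))"
  have upd: "detf m (\<lambda>i' j. H j (vs[i := z] ! i')) = detf m (A(i := \<lambda>j. H j z))" for z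
    by (rule detf_cong) (use * in \<open>auto simp: A_def nth_list_update\<close>)
  have "detf m (A(i := \<lambda>j. H j (a *\<^sub>R v + b *\<^sub>R w))) = detf m (A(i := \<lambda>j. a * H j v + b * H j w))"
    by (rule detf_cong) (auto simp: linear_add linear_scale assms)
  then show "detf m (\<lambda>i' j. H j (vs[i := a *\<^sub>R v + b *\<^sub>R w] ! i')) =
      a * detf m (\<lambda>i' j. H j (vs[i := v] ! i')) + b * detf m (\<lambda>i' j. H j (vs[i := w] ! i'))"
    by (simp add: upd detf_row_linear[OF *(2)])
next
  fix vs :: "'a list" and i j
  assume "length vs = m" "i < m" "j < m" "i \<noteq> j" "vs ! i = vs ! j"
  then show "detf m (\<lambda>i j. H j (vs ! i)) = 0"
    by (intro detf_identical_rows[of i m j]) auto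
qed

section \<open>Determinants bordered by a top row\<close>

text \<open>Row 0 is \<open>c\<close> and row \<open>Suc i\<close> is \<open>R i\<close>. With the
  coordinates of a point in \<open>c\<close> and the differentials of the \<open>i\<close>-th vector
  in \<open>R i\<close>, this is the value of a Whitney form.\<close>

definition bdet :: "nat \<Rightarrow> (nat \<Rightarrow> real) \<Rightarrow> (nat \<Rightarrow> nat \<Rightarrow> real) \<Rightarrow> real" where
  "bdet k c R = detf (Suc k) (case_nat c R)"

lemma bdet_cong:
  assumes "\<And>j. j \<le> k \<Longrightarrow> c j = c' j" "\<And>i j. i < k \<Longrightarrow> j \<le> k \<Longrightarrow> R i j = R' i j"
  shows "bdet k c R = bdet k c' R'"
  unfolding bdet_def by (rule detf_cong) (auto split: nat.split simp: assms)

lemma bdet_expansion: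
  "bdet k c R = (\<Sum>j\<le>k. (-1) ^ j * c j * detf k (\<lambda>i' j'. R i' (if j' < j then j' else Suc j')))"
  by (simp add: bdet_def detf_first_row_expansion lessThan_Suc_atMost)

lemma bdet_top_linear:
  "bdet k (\<lambda>j. a * c j + b * d j) R = a * bdet k c R + b * bdet k d R"
  by (simp add: bdet_expansion sum.distrib sum_distrib_left algebra_simps)

text \<open>Adding a multiple of the top row does not change the determinant, and each of the
  \<open>k\<close> lower rows contributes a factor \<open>t\<close>. This is the change that the
  quotient rule makes to the differentials under the projection onto a face.\<close>

lemma bdet_row_operations:
  "bdet k c (\<lambda>i j. t * R i j + b i * c j) = t ^ k * bdet k c R"
proof -
  \<comment> \<open>One row at a time: \<open>n\<close> counts the rows already changed, and the
    correction term has two rows equal to \<open>c\<close>.\<close>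
  have "bdet k c (\<lambda>i j. if i < n then t * R i j + b i * c j else R i j) = t ^ n * bdet k c R"
    if "n \<le> k" for n
    using that
  proof (induction n)
    case 0
    show ?case
      by simp
  next
    case (Suc n)
    define A where "A = case_nat c (\<lambda>i j. if i < n then t * R i j + b i * c j else R i j)"
    have "bdet k c (\<lambda>i j. if i < Suc n then t * R i j + b i * c j else R i j) =
        detf (Suc k) (A(Suc n := \<lambda>j. t * R n j + b n * c j))"
      unfolding bdet_def A_def by (rule detf_cong) (auto split: nat.split)
    also have "\<dots> = t * detf (Suc k) (A(Suc n := R n)) + b n * detf (Suc k) (A(Suc n := c))"
      using Suc.prems by (intro detf_row_linear) simp
    also have "A(Suc n := R n) = A"
      by (auto simp: A_def fun_eq_iff)
    also have "detf (Suc k) (A(Suc n := c)) = 0"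
      using Suc.prems by (intro detf_identical_rows[of 0 _ "Suc n"]) (auto simp: A_def)
    finally show ?case
      using Suc by (simp add: bdet_def A_def)
  qed
  from this[of k] show ?thesis
    using bdet_cong[of k c c "\<lambda>i j. if i < k then t * R i j + b i * c j else R i j"
        "\<lambda>i j. t * R i j + b i * c j"] by simp
qed

lemma alternating_on_bdet:
  assumes "\<And>j. j \<le> k \<Longrightarrow> linear (H j)"
  shows "alternating_on k V (\<lambda>vs. bdet k c (\<lambda>i j. H j (vs ! i)))"
proof (rule alternating_onI)
  fix vs :: "'a list" and i v w and a b :: real
  assume *: "length vs = k" "i < k"
  define A where "A = case_nat c (\<lambda>i j. H j (vs ! i))"
  have upd: "bdet k c (\<lambda>i' j. H j (vs[i := z] ! i')) = detf (Suc k) (A(Suc i := \<lambda>j. H j z))" for z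
    unfolding bdet_def by (rule detf_cong) (use * in \<open>auto simp: A_def nth_list_update split: nat.split\<close>)
  have "detf (Suc k) (A(Suc i := \<lambda>j. H j (a *\<^sub>R v + b *\<^sub>R w))) = detf (Suc k) (A(Suc i := \<lambda>j. a * H j v + b * H j w))"
    by (rule detf_cong) (auto simp: linear_add linear_scale assms)
  then show "bdet k c (\<lambda>i' j. H j (vs[i := a *\<^sub>R v + b *\<^sub>R w] ! i')) =
      a * bdet k c (\<lambda>i' j. H j (vs[i := v] ! i')) + b * bdet k c (\<lambda>i' j. H j (vs[i := w] ! i'))"
    using *(2) by (simp add: upd detf_row_linear)
next
  fix vs :: "'a list" and i j
  assume "length vs = k" "i < k" "j < k" "i \<noteq> j" "vs ! i = vs ! j"
  then show "bdet k c (\<lambda>i j. H j (vs ! i)) = 0"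
    unfolding bdet_def by (intro detf_identical_rows[of "Suc i" _ "Suc j"]) auto
qed

text \<open>If the border consists of the same linear functions applied to a vector
  \<open>w\<close>, it is merely one more argument. With \<open>w = p - a\<close> this recognises a
  Koszul contraction.\<close>

lemma bdet_Cons:
  "bdet k (\<lambda>j. H j w) (\<lambda>i j. H j (vs ! i)) = detf (Suc k) (\<lambda>i j. H j ((w # vs) ! i))"
  unfolding bdet_def by (rule detf_cong) (auto split: nat.split)

text \<open>The arguments are replaced one after another from the left: the components along the
  \<open>z j\<close> are killed and each replacement gives a factor \<open>s\<close>. It is meant
  for \<open>D\<close> the derivative of the projection and \<open>z j\<close> the radial
  directions.\<close>

lemma alternating_on_replace:
  assumes g: "alternating_on k UNIV g"
    and kill: "\<And>ws i j. length ws = k \<Longrightarrow> i < k \<Longrightarrow> j \<in> J \<Longrightarrow> g (ws[i := z j]) = 0"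
    and J: "finite J" and D: "\<And>v. v = s *\<^sub>R D v + (\<Sum>j\<in>J. c j v *\<^sub>R z j)"
    and vs: "length vs = k"
  shows "g vs = s ^ k * g (map D vs)"
proof -
  have "g vs = s ^ n * g (map D (take n vs) @ drop n vs)" if "n \<le> k" for n
    using that
  proof (induction n)
    case 0
    show ?case
      by simp
  next
    case (Suc n)
    define ws where "ws = map D (take n vs) @ drop n vs"
    have ws: "length ws = k" "n < k"
      using Suc.prems vs by (auto simp: ws_def)
    have "ws ! n = vs ! n"
      using Suc.prems vs by (simp add: ws_def nth_append)
    then have "g ws = g (ws[n := s *\<^sub>R D (vs ! n) + 1 *\<^sub>R (\<Sum>j\<in>J. c j (vs ! n) *\<^sub>R z j)])"
      using D[of "vs ! n"] by (metis list_update_id scaleR_one)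
    also have "\<dots> = s * g (ws[n := D (vs ! n)]) + 1 * g (ws[n := \<Sum>j\<in>J. c j (vs ! n) *\<^sub>R z j])"
      by (rule alternating_on_linear[OF g ws(1) _ ws(2)]) auto
    also have "g (ws[n := \<Sum>j\<in>J. c j (vs ! n) *\<^sub>R z j]) = (\<Sum>j\<in>J. c j (vs ! n) * g (ws[n := z j]))"
      by (rule alternating_on_sum[OF g subspace_UNIV ws(1) _ ws(2) J]) auto
    also have "\<dots> = 0"
      using kill[OF ws] by simp
    also have "ws[n := D (vs ! n)] = map D (take (Suc n) vs) @ drop (Suc n) vs"
      using Suc.prems vs
      by (intro nth_equalityI) (auto simp: ws_def nth_append nth_list_update min_def less_Suc_eq)
    finally show ?case
      using Suc by (simp add: ws_def)
  qed
  from this[of k] show ?thesis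
    using vs by simp
qed

section \<open>Polynomials centred at a point and vanishing to order r\<close>

definition mdeg :: "('n::finite \<Rightarrow> nat) \<Rightarrow> nat" where
  "mdeg \<alpha> = (\<Sum>i\<in>UNIV. \<alpha> i)"

definition monomial_at :: "real^'n \<Rightarrow> ('n \<Rightarrow> nat) \<Rightarrow> real^'n \<Rightarrow> real" where
  "monomial_at p \<alpha> q = (\<Prod>i\<in>UNIV. (q $ i - p $ i) ^ \<alpha> i)"

text \<open>The set \<open>A\<close> of exponents is a parameter so that polynomials of degree at
  most \<open>d\<close> and homogeneous polynomials of degree \<open>d\<close> about
  \<open>p\<close> share one calculus. The equation holds on the whole space, not only on a
  simplex.\<close>

definition poly_at :: "real^'n \<Rightarrow> ('n \<Rightarrow> nat) set \<Rightarrow> (real^'n \<Rightarrow> real) \<Rightarrow> bool" where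
  "poly_at p A u \<longleftrightarrow> (\<exists>c. u = (\<lambda>q. \<Sum>\<alpha>\<in>A. c \<alpha> * monomial_at p \<alpha> q))"

lemma finite_mdeg_le: "finite {\<alpha>::'n::finite \<Rightarrow> nat. mdeg \<alpha> \<le> d}"
proof (rule finite_subset)
  show "{\<alpha>::'n \<Rightarrow> nat. mdeg \<alpha> \<le> d} \<subseteq> (UNIV \<rightarrow>\<^sub>E {..d})"
  proof
    fix \<alpha> :: "'n \<Rightarrow> nat" assume "\<alpha> \<in> {\<alpha>. mdeg \<alpha> \<le> d}"
    then have "\<alpha> i \<le> d" for i
      using member_le_sum[of i UNIV \<alpha>] by (simp add: mdeg_def)
    then show "\<alpha> \<in> UNIV \<rightarrow>\<^sub>E {..d}"
      by auto
  qed
  show "finite ((UNIV::'n set) \<rightarrow>\<^sub>E {..d})"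
    by (intro finite_PiE) auto
qed

lemma finite_mdeg_eq: "finite {\<alpha>::'n::finite \<Rightarrow> nat. mdeg \<alpha> = d}"
  by (rule finite_subset[OF _ finite_mdeg_le[of d]]) auto

lemma mdeg_upd_Suc: "mdeg (\<alpha>(j := Suc (\<alpha> j))) = Suc (mdeg \<alpha>)"
proof -
  have "(\<Sum>i\<in>UNIV. (\<alpha>(j := Suc (\<alpha> j))) i) = (\<Sum>i\<in>UNIV. \<alpha> i + (if i = j then 1 else 0))"
    by (rule sum.cong) auto
  then show ?thesis
    by (simp add: mdeg_def sum.distrib)
qed

lemma mdeg_0 [simp]: "mdeg (\<lambda>_. 0) = 0"
  by (simp add: mdeg_def)

lemma mdeg_eq_0_iff: "mdeg \<alpha> = 0 \<longleftrightarrow> \<alpha> = (\<lambda>_. 0)"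
  by (auto simp: mdeg_def fun_eq_iff)

lemma mdeg_pos_obtain:
  assumes "mdeg \<alpha> = Suc d"
  obtains j \<beta> where "\<alpha> = \<beta>(j := Suc (\<beta> j))" "mdeg \<beta> = d"
proof -
  obtain j where "\<alpha> j \<noteq> 0"
    using assms by (metis mdeg_eq_0_iff nat.distinct(1))
  then have "\<alpha> = (\<alpha>(j := \<alpha> j - 1))(j := Suc ((\<alpha>(j := \<alpha> j - 1)) j))"
    by auto
  moreover from this have "mdeg (\<alpha>(j := \<alpha> j - 1)) = d"
    using assms mdeg_upd_Suc by (metis nat.inject)
  ultimately show thesis
    using that by blast
qed

lemma monomial_at_upd_Suc:
  "monomial_at p (\<alpha>(j := Suc (\<alpha> j))) q = (q $ j - p $ j) * monomial_at p \<alpha> q"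
proof -
  have "(\<Prod>i\<in>UNIV. (q $ i - p $ i) ^ (\<alpha>(j := Suc (\<alpha> j))) i) =
      (\<Prod>i\<in>UNIV. (if i = j then q $ j - p $ j else 1) * (q $ i - p $ i) ^ \<alpha> i)"
    by (rule prod.cong) auto
  then show ?thesis
    by (simp add: monomial_at_def prod.distrib)
qed

lemma monomial_at_0 [simp]: "monomial_at p (\<lambda>_. 0) q = 1"
  by (simp add: monomial_at_def)

lemma monomial_at_centre: "monomial_at p \<alpha> p = (if \<alpha> = (\<lambda>_. 0) then 1 else 0)"
  by (auto simp: monomial_at_def fun_eq_iff)

lemma monomial_at_line:
  "monomial_at p \<alpha> (p + t *\<^sub>R (q - p)) = t ^ mdeg \<alpha> * monomial_at p \<alpha> q"
  by (simp add: monomial_at_def mdeg_def power_mult_distrib prod.distrib power_sum)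

lemma poly_at_monomial: "finite A \<Longrightarrow> \<alpha> \<in> A \<Longrightarrow> poly_at p A (monomial_at p \<alpha>)"
  unfolding poly_at_def
proof (intro exI ext)
  fix q assume "finite A" "\<alpha> \<in> A"
  moreover have "(\<Sum>\<beta>\<in>A. (if \<beta> = \<alpha> then 1 else 0) * monomial_at p \<beta> q) =
      (\<Sum>\<beta>\<in>A. if \<beta> = \<alpha> then monomial_at p \<alpha> q else 0)"
    by (rule sum.cong) auto
  ultimately show "monomial_at p \<alpha> q = (\<Sum>\<beta>\<in>A. (if \<beta> = \<alpha> then 1 else 0) * monomial_at p \<beta> q)"
    by simp
qed

lemma poly_at_0: "poly_at p A (\<lambda>q. 0)"
  unfolding poly_at_def by (rule exI[of _ "\<lambda>\<beta>. 0"]) simp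

lemma poly_at_lincomb:
  assumes "poly_at p A u" "poly_at p A v"
  shows "poly_at p A (\<lambda>q. a * u q + b * v q)"
proof -
  obtain c d where u: "u = (\<lambda>q. \<Sum>\<alpha>\<in>A. c \<alpha> * monomial_at p \<alpha> q)"
    and v: "v = (\<lambda>q. \<Sum>\<alpha>\<in>A. d \<alpha> * monomial_at p \<alpha> q)"
    using assms unfolding poly_at_def by auto
  show ?thesis
    unfolding poly_at_def
  proof (intro exI ext)
    fix q
    show "a * u q + b * v q = (\<Sum>\<alpha>\<in>A. (a * c \<alpha> + b * d \<alpha>) * monomial_at p \<alpha> q)"
      unfolding u v distrib_right sum.distrib sum_distrib_left mult.assoc ..
  qed
qed

lemma poly_at_add: "poly_at p A u \<Longrightarrow> poly_at p A v \<Longrightarrow> poly_at p A (\<lambda>q. u q + v q)"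
  using poly_at_lincomb[of p A u v 1 1] by simp

lemma poly_at_cmult: "poly_at p A u \<Longrightarrow> poly_at p A (\<lambda>q. a * u q)"
  using poly_at_lincomb[of p A u u a 0] by simp

lemma poly_at_sum: "(\<And>i. i \<in> I \<Longrightarrow> poly_at p A (u i)) \<Longrightarrow> poly_at p A (\<lambda>q. \<Sum>i\<in>I. u i q)"
  by (induction I rule: infinite_finite_induct) (auto intro: poly_at_0 poly_at_add)

lemma poly_at_mono:
  assumes "poly_at p A u" "A \<subseteq> B" "finite B"
  shows "poly_at p B u"
  using assms unfolding poly_at_def[of p A]
  by (auto intro!: poly_at_sum poly_at_cmult poly_at_monomial)

lemma poly_at_coord_mult:
  assumes "poly_at p A u" "finite B" "\<And>\<alpha>. \<alpha> \<in> A \<Longrightarrow> \<alpha>(j := Suc (\<alpha> j)) \<in> B"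
  shows "poly_at p B (\<lambda>q. (q $ j - p $ j) * u q)"
proof -
  obtain c where u: "u = (\<lambda>q. \<Sum>\<alpha>\<in>A. c \<alpha> * monomial_at p \<alpha> q)"
    using assms(1) unfolding poly_at_def by blast
  have "(\<lambda>q. (q $ j - p $ j) * u q) = (\<lambda>q. \<Sum>\<alpha>\<in>A. c \<alpha> * monomial_at p (\<alpha>(j := Suc (\<alpha> j))) q)"
    by (simp add: u sum_distrib_left monomial_at_upd_Suc mult_ac)
  then show ?thesis
    using assms by (auto intro!: poly_at_sum poly_at_cmult poly_at_monomial)
qed

lemma poly_at_const: "poly_at p {\<alpha>. mdeg \<alpha> = 0} (\<lambda>q. c)" "poly_at p {\<alpha>. mdeg \<alpha> \<le> d} (\<lambda>q. c)"
  using poly_at_cmult[OF poly_at_monomial[of "{\<alpha>. mdeg \<alpha> = 0}" "\<lambda>_. 0" p], of c]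
    poly_at_cmult[OF poly_at_monomial[of "{\<alpha>. mdeg \<alpha> \<le> d}" "\<lambda>_. 0" p], of c]
  by (auto simp: finite_mdeg_le finite_mdeg_eq)

lemma linear_eq_sum_axis:
  fixes h :: "real^'n \<Rightarrow> real"
  assumes "linear h"
  shows "h v = (\<Sum>j\<in>UNIV. v $ j * h (axis j 1))"
proof -
  have "h v = h (\<Sum>j\<in>UNIV. v $ j *\<^sub>R axis j 1)"
    by (simp add: basis_expansion flip: scalar_mult_eq_scaleR)
  then show ?thesis
    using assms by (simp add: linear_sum linear_scale)
qed

lemma poly_at_linear_mult:
  assumes "linear h" "poly_at p {\<alpha>. mdeg \<alpha> = d} u"
  shows "poly_at p {\<alpha>. mdeg \<alpha> = Suc d} (\<lambda>q. h (q - p) * u q)"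
proof -
  have "(\<lambda>q. h (q - p) * u q) = (\<lambda>q. \<Sum>j\<in>UNIV. h (axis j 1) * ((q $ j - p $ j) * u q))"
    by (subst linear_eq_sum_axis[OF assms(1)]) (simp add: sum_distrib_left sum_distrib_right mult_ac)
  moreover have "poly_at p {\<alpha>. mdeg \<alpha> = Suc d} (\<lambda>q. \<Sum>j\<in>UNIV. h (axis j 1) * ((q $ j - p $ j) * u q))"
    by (intro poly_at_sum poly_at_cmult poly_at_coord_mult[OF assms(2)]) (auto simp: finite_mdeg_eq mdeg_upd_Suc)
  ultimately show ?thesis
    by (simp only:)
qed

lemma poly_at_affine_mult:
  assumes "linear h" "poly_at p {\<alpha>. mdeg \<alpha> \<le> d} u"
  shows "poly_at p {\<alpha>. mdeg \<alpha> \<le> Suc d} (\<lambda>q. (h q + c) * u q)"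
proof -
  have h: "h q = (\<Sum>j\<in>UNIV. h (axis j 1) * (q $ j - p $ j)) + h p" for q
    using linear_eq_sum_axis[OF assms(1), of "q - p"] linear_diff[OF assms(1), of q p] by (simp add: mult_ac)
  have "(\<lambda>q. (h q + c) * u q) =
      (\<lambda>q. (\<Sum>j\<in>UNIV. h (axis j 1) * ((q $ j - p $ j) * u q)) + (h p + c) * u q)"
  proof (rule ext)
    fix q
    have "(h q + c) * u q = (\<Sum>j\<in>UNIV. h (axis j 1) * (q $ j - p $ j)) * u q + (h p + c) * u q"
      unfolding h[of q] by (simp only: distrib_right add.assoc)
    also have "(\<Sum>j\<in>UNIV. h (axis j 1) * (q $ j - p $ j)) * u q = (\<Sum>j\<in>UNIV. h (axis j 1) * ((q $ j - p $ j) * u q))"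
      by (simp only: sum_distrib_right mult.assoc)
    finally show "(h q + c) * u q = (\<Sum>j\<in>UNIV. h (axis j 1) * ((q $ j - p $ j) * u q)) + (h p + c) * u q" .
  qed
  moreover have "poly_at p {\<alpha>. mdeg \<alpha> \<le> Suc d} (\<lambda>q. (\<Sum>j\<in>UNIV. h (axis j 1) * ((q $ j - p $ j) * u q)) + (h p + c) * u q)"
    by (intro poly_at_add poly_at_sum poly_at_cmult poly_at_coord_mult[OF assms(2)] poly_at_mono[OF assms(2)])
       (auto simp: finite_mdeg_le mdeg_upd_Suc)
  ultimately show ?thesis
    by (simp only:)
qed

text \<open>Each factor of a monomial is affine, and multiplication by an affine function raises the
  degree by at most one about any centre.\<close>

lemma poly_at_translate:
  fixes p p' :: "real^'n"
  assumes "poly_at p {\<alpha>. mdeg \<alpha> \<le> d} u"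
  shows "poly_at p' {\<alpha>. mdeg \<alpha> \<le> d} u"
proof -
  have *: "poly_at p' {\<alpha>. mdeg \<alpha> \<le> e} (monomial_at p \<alpha>)" if "mdeg \<alpha> = e" for \<alpha> e
    using that
  proof (induction e arbitrary: \<alpha>)
    case 0
    then have "\<alpha> = (\<lambda>_. 0)"
      by (simp add: mdeg_eq_0_iff)
    then show ?case
      using poly_at_const(2)[of p' 0 1] by (simp add: monomial_at_def)
  next
    case (Suc e)
    from Suc.prems obtain j \<beta> where \<beta>: "\<alpha> = \<beta>(j := Suc (\<beta> j))" "mdeg \<beta> = e"
      by (rule mdeg_pos_obtain)
    have "monomial_at p \<alpha> = (\<lambda>q. (q $ j + (- p $ j)) * monomial_at p \<beta> q)"
      by (simp add: \<beta> monomial_at_upd_Suc fun_eq_iff)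
    moreover have "linear (\<lambda>q::real^'n. q $ j)"
      by (simp add: linear_iff)
    ultimately show ?case
      using poly_at_affine_mult[OF _ Suc.IH[OF \<beta>(2)], of "\<lambda>q. q $ j" "- p $ j"] by simp
  qed
  have "poly_at p' {\<alpha>. mdeg \<alpha> \<le> d} (monomial_at p \<alpha>)" if "mdeg \<alpha> \<le> d" for \<alpha>
    by (rule poly_at_mono[OF *[OF refl]]) (use that in \<open>auto simp: finite_mdeg_le\<close>)
  then show ?thesis
    using assms unfolding poly_at_def[of p] by (auto intro!: poly_at_sum poly_at_cmult)
qed

text \<open>Trades a polynomial function on \<open>S\<close> for a global polynomial
  \<open>U\<close>, which can be recentred. On a lower-dimensional \<open>S\<close> there are many
  such \<open>U\<close>.\<close>

lemma poly_fun_on_iff: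
  "poly_fun_on (int d) S u \<longleftrightarrow> (\<exists>U. poly_at 0 {\<alpha>. mdeg \<alpha> \<le> d} U \<and> (\<forall>q\<in>S. u q = U q))"
proof -
  have "{\<alpha>::'a \<Rightarrow> nat. int (\<Sum>i\<in>UNIV. \<alpha> i) \<le> int d} = {\<alpha>. mdeg \<alpha> \<le> d}"
    by (simp only: mdeg_def of_nat_le_iff)
  then show ?thesis
    by (auto simp: poly_fun_on_def poly_at_def monomial_at_def)
qed

lemma poly_at_line:
  assumes "poly_at p {\<alpha>. mdeg \<alpha> \<le> d} U"
  shows "\<exists>P :: real poly. degree P \<le> d \<and> (\<forall>t. U (p + t *\<^sub>R (q - p)) = poly P t)"
proof -
  obtain c where c: "U = (\<lambda>q. \<Sum>\<alpha> | mdeg \<alpha> \<le> d. c \<alpha> * monomial_at p \<alpha> q)"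
    using assms unfolding poly_at_def by blast
  define P where "P = (\<Sum>\<alpha> | mdeg \<alpha> \<le> d. monom (c \<alpha> * monomial_at p \<alpha> q) (mdeg \<alpha>))"
  have "degree P \<le> d"
    unfolding P_def by (intro degree_sum_le finite_mdeg_le) (auto intro: order_trans[OF degree_monom_le])
  moreover have "U (p + t *\<^sub>R (q - p)) = poly P t" for t
    by (simp add: c P_def poly_sum poly_monom monomial_at_line mult_ac)
  ultimately show ?thesis
    by blast
qed

lemma poly_fun_on_line:
  assumes "poly_fun_on (int d) S u"
  shows "\<exists>P :: real poly. degree P \<le> d \<and> (\<forall>t. p + t *\<^sub>R (q - p) \<in> S \<longrightarrow> u (p + t *\<^sub>R (q - p)) = poly P t)"
proof -
  obtain U where U: "poly_at 0 {\<alpha>. mdeg \<alpha> \<le> d} U" "\<forall>q\<in>S. u q = U q"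
    using assms poly_fun_on_iff by blast
  then show ?thesis
    using poly_at_line[OF poly_at_translate[OF U(1)], of p q] by auto
qed

section \<open>Derivatives within convex sets and Taylor coefficients\<close>

text \<open>The segment from \<open>p\<close> to \<open>y\<close> stays in \<open>S\<close>, and
  along it both derivatives give the one-sided derivative of a function of one variable at the
  endpoint 0 of [0, 1].\<close>

lemma has_derivative_within_convex_unique:
  fixes u :: "'a::real_normed_vector \<Rightarrow> 'b::real_normed_vector"
  assumes "convex S" "p \<in> S" "y \<in> S"
    and "(u has_derivative D) (at p within S)" "(u has_derivative D') (at p within S)"
  shows "D (y - p) = D' (y - p)"
proof -
  define \<gamma> where "\<gamma> = (\<lambda>t::real. p + t *\<^sub>R (y - p))"
  have \<gamma>: "\<gamma> ` {0..1} \<subseteq> S"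
    using assms(1-3) by (auto simp: \<gamma>_def convex_alt algebra_simps)
  have vd: "((u \<circ> \<gamma>) has_vector_derivative D (y - p)) (at 0 within {0..1})"
    if "(u has_derivative D) (at p within S)" for D
  proof -
    have "(\<gamma> has_derivative (\<lambda>t. t *\<^sub>R (y - p))) (at 0 within {0..1})"
      unfolding \<gamma>_def by (auto intro!: derivative_eq_intros)
    moreover have "(u has_derivative D) (at (\<gamma> 0) within \<gamma> ` {0..1})"
      using has_derivative_subset[OF that \<gamma>] by (simp add: \<gamma>_def)
    ultimately have "((u \<circ> \<gamma>) has_derivative (\<lambda>t. D (t *\<^sub>R (y - p)))) (at 0 within {0..1})"
      unfolding o_def by (rule has_derivative_in_compose)
    moreover have "linear D"
      using that has_derivative_linear by blast
    ultimately show ?thesis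
      by (simp add: has_vector_derivative_def linear_scale)
  qed
  show ?thesis
    by (rule vector_derivative_unique_within_closed_interval[of 0 1 0 "u \<circ> \<gamma>"])
       (simp_all add: vd[OF assms(4)] vd[OF assms(5)])
qed

text \<open>Convexity determines a derivative within \<open>S\<close> in the directions
  \<open>y - p\<close>; as these span the space, it is determined altogether, at boundary points
  too.\<close>

definition solid :: "(real^'n) set \<Rightarrow> bool" where
  "solid S \<longleftrightarrow> convex S \<and> (\<forall>p\<in>S. span {y - p | y. y \<in> S} = UNIV)"

lemma partial_eq:
  assumes S: "solid S" "p \<in> S" and U: "(U has_derivative D) (at p)" and u: "\<And>q. q \<in> S \<Longrightarrow> u q = U q"
  shows "partial S i u p = D (axis i 1)"
proof -
  have D: "(u has_derivative D) (at p within S)"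
    using has_derivative_transform[OF S(2) u has_derivative_at_withinI[OF U]] .
  then have fd: "(u has_derivative frechet_derivative u (at p within S)) (at p within S)"
    using differentiableI frechet_derivative_works by blast
  have "frechet_derivative u (at p within S) v = D v" for v
  proof (rule linear_eq_on[where B = "{y - p | y. y \<in> S}"])
    show "linear (frechet_derivative u (at p within S))" "linear D"
      using D fd has_derivative_linear by blast+
    show "v \<in> span {y - p |y. y \<in> S}"
      using S by (simp add: solid_def)
  qed (use has_derivative_within_convex_unique[OF _ S(2) _ fd D] S(1) in \<open>auto simp: solid_def\<close>)
  then show ?thesis
    by (simp add: partial_def)
qed

lemma monomial_at_has_derivative:
  "\<exists>D. (monomial_at p \<alpha> has_derivative D) (at q) \<and>
       D (axis i 1) = real (\<alpha> i) * monomial_at p (\<alpha>(i := \<alpha> i - 1)) q"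
proof (intro exI conjI)
  let ?f = "\<lambda>j q. (q $ j - p $ j) ^ \<alpha> j"
  let ?f' = "\<lambda>j (y::real^'a). real (\<alpha> j) * (y $ j * (q $ j - p $ j) ^ (\<alpha> j - 1))"
  let ?D = "\<lambda>y. \<Sum>j\<in>UNIV. ?f' j y * (\<Prod>l\<in>UNIV - {j}. ?f l q)"
  have "(?f j has_derivative ?f' j) (at q)" for j
  proof -
    have "((\<lambda>q. q $ j - p $ j) has_derivative (\<lambda>y. y $ j)) (at q)"
      by (auto intro!: derivative_eq_intros bounded_linear.has_derivative[OF bounded_linear_vec_nth])
    from has_derivative_power[OF this, of "\<alpha> j"] show ?thesis
      by (simp add: mult_ac)
  qed
  then have "((\<lambda>q. \<Prod>j\<in>UNIV. ?f j q) has_derivative ?D) (at q)"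
    by (intro has_derivative_prod)
  then show "(monomial_at p \<alpha> has_derivative ?D) (at q)"
    by (simp add: monomial_at_def[abs_def])
  have "?D (axis i 1) = (\<Sum>j\<in>UNIV. if j = i then real (\<alpha> i) * ((q $ i - p $ i) ^ (\<alpha> i - 1)) * (\<Prod>l\<in>UNIV - {i}. ?f l q) else 0)"
    by (intro sum.cong) (auto simp: axis_def)
  also have "\<dots> = real (\<alpha> i) * ((q $ i - p $ i) ^ (\<alpha> i - 1) * (\<Prod>l\<in>UNIV - {i}. ?f l q))"
    by simp
  also have "(q $ i - p $ i) ^ (\<alpha> i - 1) * (\<Prod>l\<in>UNIV - {i}. ?f l q) = monomial_at p (\<alpha>(i := \<alpha> i - 1)) q"
    unfolding monomial_at_def by (subst prod.remove[of UNIV i]) auto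
  finally show "?D (axis i 1) = real (\<alpha> i) * monomial_at p (\<alpha>(i := \<alpha> i - 1)) q" .
qed

text \<open>The coefficients are named rather than existentially quantified so that differentiation
  can act on them. Requiring them to vanish above degree \<open>d\<close> lets the differentiated
  coefficients keep the same bound \<open>d\<close>.\<close>

definition coeffs_at :: "(real^'n) set \<Rightarrow> real^'n \<Rightarrow> nat \<Rightarrow> (('n \<Rightarrow> nat) \<Rightarrow> real) \<Rightarrow> (real^'n \<Rightarrow> real) \<Rightarrow> bool" where
  "coeffs_at S p d c u \<longleftrightarrow>
     (\<forall>\<alpha>. d < mdeg \<alpha> \<longrightarrow> c \<alpha> = 0) \<and> (\<forall>q\<in>S. u q = (\<Sum>\<alpha> | mdeg \<alpha> \<le> d. c \<alpha> * monomial_at p \<alpha> q))"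

text \<open>The formal partial derivative in direction \<open>i\<close>, acting on Taylor
  coefficients.\<close>

definition diff_coeffs :: "'n \<Rightarrow> (('n \<Rightarrow> nat) \<Rightarrow> real) \<Rightarrow> ('n \<Rightarrow> nat) \<Rightarrow> real" where
  "diff_coeffs i c = (\<lambda>\<beta>. real (Suc (\<beta> i)) * c (\<beta>(i := Suc (\<beta> i))))"

lemma coeffs_at_partial:
  assumes S: "solid S" and c: "coeffs_at S p d c u"
  shows "coeffs_at S p d (diff_coeffs i c) (partial S i u)"
  unfolding coeffs_at_def
proof (intro conjI allI impI ballI)
  fix \<alpha> :: "'a \<Rightarrow> nat" assume "d < mdeg \<alpha>"
  then show "diff_coeffs i c \<alpha> = 0"
    using c by (simp add: coeffs_at_def diff_coeffs_def mdeg_upd_Suc)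
next
  fix q assume q: "q \<in> S"
  define A where "A = {\<alpha>::'a \<Rightarrow> nat. mdeg \<alpha> \<le> d}"
  have fin: "finite A"
    by (simp add: A_def finite_mdeg_le)
  have u: "u q' = (\<Sum>\<alpha>\<in>A. c \<alpha> * monomial_at p \<alpha> q')" if "q' \<in> S" for q'
    using c that by (simp add: coeffs_at_def A_def)
  obtain D where D: "\<And>\<alpha>. (monomial_at p \<alpha> has_derivative D \<alpha>) (at q)"
    "\<And>\<alpha>. D \<alpha> (axis i 1) = real (\<alpha> i) * monomial_at p (\<alpha>(i := \<alpha> i - 1)) q"
    using monomial_at_has_derivative[of p _ q i] by metis
  have "((\<lambda>q'. \<Sum>\<alpha>\<in>A. c \<alpha> * monomial_at p \<alpha> q') has_derivative (\<lambda>y. \<Sum>\<alpha>\<in>A. c \<alpha> * D \<alpha> y)) (at q)"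
    by (intro has_derivative_sum has_derivative_mult_right D)
  from partial_eq[OF S q this u]
  have "partial S i u q = (\<Sum>\<alpha>\<in>A. c \<alpha> * (real (\<alpha> i) * monomial_at p (\<alpha>(i := \<alpha> i - 1)) q))"
    by (simp add: D)
  also have "\<dots> = (\<Sum>\<alpha>\<in>{\<alpha>\<in>A. \<alpha> i \<noteq> 0}. c \<alpha> * (real (\<alpha> i) * monomial_at p (\<alpha>(i := \<alpha> i - 1)) q))"
    by (rule sum.mono_neutral_right) (use fin in auto)
  \<comment> \<open>Reindexing by the exponent after differentiation; lowering and raising entry
    \<open>i\<close> are inverse to each other on exponents with a positive entry there.\<close>
  also have "\<dots> = (\<Sum>\<beta>\<in>{\<beta>\<in>A. \<beta>(i := Suc (\<beta> i)) \<in> A}. diff_coeffs i c \<beta> * monomial_at p \<beta> q)"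
  proof -
    define up where "up \<beta> = \<beta>(i := Suc (\<beta> i))" for \<beta> :: "'a \<Rightarrow> nat"
    define down where "down \<alpha> = \<alpha>(i := \<alpha> i - 1)" for \<alpha> :: "'a \<Rightarrow> nat"
    have up_down: "up (down \<alpha>) = \<alpha>" "Suc (down \<alpha> i) = \<alpha> i" if "\<alpha> i \<noteq> 0" for \<alpha>
      using that by (auto simp: up_def down_def)
    have down_up: "down (up \<beta>) = \<beta>" "0 < up \<beta> i" for \<beta>
      by (auto simp: up_def down_def)
    have down_A: "down \<alpha> \<in> A" if "\<alpha> \<in> A" "\<alpha> i \<noteq> 0" for \<alpha>
      using that mdeg_upd_Suc[of "down \<alpha>" i, folded up_def] by (simp add: A_def up_down)
    have *: "c \<alpha> * (real (\<alpha> i) * m) = real (Suc (down \<alpha> i)) * c (up (down \<alpha>)) * m"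
      if "\<alpha> i \<noteq> 0" for \<alpha> m
    proof -
      have "up (down \<alpha>) = \<alpha>" "Suc (down \<alpha> i) = \<alpha> i"
        using up_down[of \<alpha>] that by blast+
      then show ?thesis
        by (simp only: mult_ac)
    qed
    show ?thesis
      unfolding diff_coeffs_def up_def[symmetric] down_def[symmetric]
      by (rule sum.reindex_bij_witness[where i = up and j = down])
         (auto simp: up_down down_up down_A *)
  qed
  \<comment> \<open>The added terms are zero: raising entry \<open>i\<close> of their exponent takes
    it beyond degree \<open>d\<close>, where \<open>c\<close> vanishes.\<close>
  also have "\<dots> = (\<Sum>\<beta>\<in>A. diff_coeffs i c \<beta> * monomial_at p \<beta> q)"
  proof (rule sum.mono_neutral_left)
    have "c \<alpha> = 0" if "\<alpha> \<notin> A" for \<alpha>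
      using that c by (simp add: coeffs_at_def A_def)
    then show "\<forall>\<beta>\<in>A - {\<beta> \<in> A. \<beta>(i := Suc (\<beta> i)) \<in> A}. diff_coeffs i c \<beta> * monomial_at p \<beta> q = 0"
      by (simp add: diff_coeffs_def)
  qed (use fin in auto)
  finally show "partial S i u q = (\<Sum>\<alpha> | mdeg \<alpha> \<le> d. diff_coeffs i c \<alpha> * monomial_at p \<alpha> q)"
    by (simp add: A_def)
qed

lemma coeffs_at_multi_partial:
  assumes S: "solid S" and c: "coeffs_at S p d c u"
  shows "coeffs_at S p d (foldr (\<lambda>i. diff_coeffs i ^^ \<alpha> i) is c) (foldr (\<lambda>i. partial S i ^^ \<alpha> i) is u)"
proof (induction "is")
  case Nil
  show ?case
    using c by simp
next
  case (Cons i "is")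
  have "coeffs_at S p d ((diff_coeffs i ^^ m) c') ((partial S i ^^ m) u')" if "coeffs_at S p d c' u'" for m c' u'
    using that by (induction m) (simp_all add: coeffs_at_partial[OF S])
  with Cons show ?case
    by simp
qed

text \<open>\<open>K\<close> is the product of the integers from \<open>\<beta> i + 1\<close> to
  \<open>\<beta> i + m\<close>; only its positivity matters.\<close>

lemma diff_coeffs_iterate:
  "\<exists>K>0. \<forall>c. (diff_coeffs i ^^ m) c \<beta> = K * c (\<beta>(i := \<beta> i + m))"
proof (induction m arbitrary: \<beta>)
  case 0
  show ?case
    by (rule exI[of _ 1]) simp
next
  case (Suc m)
  obtain K where "K > 0" "\<forall>c. (diff_coeffs i ^^ m) c (\<beta>(i := Suc (\<beta> i))) = K * c (\<beta>(i := Suc (\<beta> i) + m))"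
    using Suc[of "\<beta>(i := Suc (\<beta> i))"] unfolding fun_upd_same fun_upd_upd by blast
  then have eq: "(diff_coeffs i ^^ Suc m) c \<beta> = real (Suc (\<beta> i)) * K * c (\<beta>(i := \<beta> i + Suc m))" for c
    by (simp add: diff_coeffs_def[of i "(diff_coeffs i ^^ m) c"])
  show ?case
  proof (intro exI conjI allI)
    show "0 < real (Suc (\<beta> i)) * K"
      using \<open>K > 0\<close> by simp
  qed (rule eq)
qed

lemma diff_coeffs_foldr:
  assumes "distinct is"
  shows "\<exists>K>0. \<forall>c. foldr (\<lambda>i. diff_coeffs i ^^ \<alpha> i) is c \<beta> = K * c (\<lambda>j. \<beta> j + (if j \<in> set is then \<alpha> j else 0))"
  using assms
proof (induction "is" arbitrary: \<beta>)
  case Nil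
  show ?case
    by (rule exI[of _ 1]) simp
next
  case (Cons i "is")
  obtain K where K: "K > 0" "\<And>c. (diff_coeffs i ^^ \<alpha> i) c \<beta> = K * c (\<beta>(i := \<beta> i + \<alpha> i))"
    using diff_coeffs_iterate[where i = i and m = "\<alpha> i" and \<beta> = \<beta>] by blast
  have "distinct is" "i \<notin> set is"
    using Cons.prems by auto
  from Cons.IH[OF this(1), of "\<beta>(i := \<beta> i + \<alpha> i)"]
  obtain K' where K': "K' > 0" "\<And>c. foldr (\<lambda>i. diff_coeffs i ^^ \<alpha> i) is c (\<beta>(i := \<beta> i + \<alpha> i)) =
      K' * c (\<lambda>j. (\<beta>(i := \<beta> i + \<alpha> i)) j + (if j \<in> set is then \<alpha> j else 0))"
    by blast
  have "(\<lambda>j. (\<beta>(i := \<beta> i + \<alpha> i)) j + (if j \<in> set is then \<alpha> j else 0)) =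
      (\<lambda>j. \<beta> j + (if j \<in> set (i # is) then \<alpha> j else 0))"
    using \<open>i \<notin> set is\<close> by auto
  then show ?case
    using K K' by (intro exI[of _ "K * K'"]) simp
qed

lemma coords_props: "distinct (coords :: 'n::finite list)" "set (coords :: 'n list) = UNIV"
proof -
  have "\<exists>is::'n list. distinct is \<and> set is = UNIV"
    using finite_distinct_list[OF finite[of "UNIV::'n set"]] by blast
  from someI_ex[OF this] show "distinct (coords :: 'n list)" "set (coords :: 'n list) = UNIV"
    unfolding coords_def by auto
qed

text \<open>At the centre \<open>p\<close> all nonconstant monomials vanish, so the derivative of
  order \<alpha> there is the constant term of the differentiated expansion, a positive multiple of
  \<open>c \<alpha>\<close>. Vanishing to order \<open>r\<close> thus becomes a condition on
  coefficients.\<close>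

lemma fun_vanishes_iff:
  assumes S: "solid S" and p: "p \<in> S" and c: "coeffs_at S p d c u"
  shows "fun_vanishes S r u p \<longleftrightarrow> (\<forall>\<alpha>. mdeg \<alpha> < r \<longrightarrow> c \<alpha> = 0)"
proof -
  have "multi_partial S \<alpha> u p = 0 \<longleftrightarrow> c \<alpha> = 0" for \<alpha>
  proof -
    let ?c = "foldr (\<lambda>i. diff_coeffs i ^^ \<alpha> i) coords c"
    have "coeffs_at S p d ?c (multi_partial S \<alpha> u)"
      unfolding multi_partial_def by (rule coeffs_at_multi_partial[OF S c])
    then have "multi_partial S \<alpha> u p = (\<Sum>\<beta> | mdeg \<beta> \<le> d. ?c \<beta> * (if \<beta> = (\<lambda>_. 0) then 1 else 0))"
      using p by (simp add: coeffs_at_def monomial_at_centre)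
    also have "\<dots> = (\<Sum>\<beta> | mdeg \<beta> \<le> d. if \<beta> = (\<lambda>_. 0) then ?c \<beta> else 0)"
      by (rule sum.cong) auto
    also have "\<dots> = ?c (\<lambda>_. 0)"
      by (simp add: finite_mdeg_le)
    finally have "multi_partial S \<alpha> u p = ?c (\<lambda>_. 0)" .
    moreover obtain K where "K > 0" "?c (\<lambda>_. 0) = K * c (\<lambda>j. 0 + (if j \<in> set coords then \<alpha> j else 0))"
      using diff_coeffs_foldr[OF coords_props(1), of \<alpha> "\<lambda>_. 0"] by blast
    ultimately show ?thesis
      by (simp add: coords_props)
  qed
  then show ?thesis
    by (simp add: fun_vanishes_def mdeg_def)
qed

lemma poly_at_coeffs:
  assumes "poly_at p A U" "A \<subseteq> {\<alpha>. mdeg \<alpha> \<le> d}" "\<And>q. q \<in> S \<Longrightarrow> u q = U q"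
  obtains c where "coeffs_at S p d c u" "\<And>\<alpha>. \<alpha> \<notin> A \<Longrightarrow> c \<alpha> = 0"
proof -
  obtain c where c: "U = (\<lambda>q. \<Sum>\<alpha>\<in>A. c \<alpha> * monomial_at p \<alpha> q)"
    using assms(1) unfolding poly_at_def by blast
  define c' where "c' \<alpha> = (if \<alpha> \<in> A then c \<alpha> else 0)" for \<alpha>
  have "U q = (\<Sum>\<alpha> | mdeg \<alpha> \<le> d. c' \<alpha> * monomial_at p \<alpha> q)" for q
    unfolding c using assms(2) finite_mdeg_le by (intro sum.mono_neutral_cong_left) (auto simp: c'_def)
  then have "coeffs_at S p d c' u"
    using assms by (auto simp: coeffs_at_def c'_def)
  then show thesis
    using that by (auto simp: c'_def)
qed

lemma fun_vanishes_homogeneous: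
  assumes "solid S" "p \<in> S" "poly_at p {\<alpha>. mdeg \<alpha> = r} U" "\<And>q. q \<in> S \<Longrightarrow> u q = U q"
  shows "fun_vanishes S r u p"
proof -
  obtain c where c: "coeffs_at S p r c u" "\<And>\<alpha>. \<alpha> \<notin> {\<alpha>. mdeg \<alpha> = r} \<Longrightarrow> c \<alpha> = 0"
    by (rule poly_at_coeffs[OF assms(3) _ assms(4), where d = r]) auto
  then show ?thesis
    by (subst fun_vanishes_iff[OF assms(1,2) c(1)]) auto
qed

text \<open>The degree bound removes the terms above \<open>r\<close> and the vanishing those below,
  so only the part homogeneous of degree \<open>r\<close> about \<open>p\<close> remains.\<close>

lemma fun_vanishes_line:
  assumes S: "solid S" "p \<in> S" and u: "poly_fun_on (int r) S u" and "fun_vanishes S r u p"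
    and q: "q \<in> S" "p + t *\<^sub>R (q - p) \<in> S"
  shows "u (p + t *\<^sub>R (q - p)) = t ^ r * u q"
proof -
  obtain U where U: "poly_at 0 {\<alpha>. mdeg \<alpha> \<le> r} U" "\<And>q. q \<in> S \<Longrightarrow> u q = U q"
    using u poly_fun_on_iff by blast
  obtain c where c: "coeffs_at S p r c u"
    by (rule poly_at_coeffs[OF poly_at_translate[OF U(1)] order_refl U(2)])
  then have "c \<alpha> = 0" if "mdeg \<alpha> < r" for \<alpha>
    using assms(4) that fun_vanishes_iff[OF S c] by blast
  then have eq: "c \<alpha> * (t ^ mdeg \<alpha> * m) = t ^ r * (c \<alpha> * m)" if "mdeg \<alpha> \<le> r" for \<alpha> m
    using that by (cases "mdeg \<alpha> = r") auto
  have "(\<Sum>\<alpha> | mdeg \<alpha> \<le> r. c \<alpha> * (t ^ mdeg \<alpha> * monomial_at p \<alpha> q)) =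
      (\<Sum>\<alpha> | mdeg \<alpha> \<le> r. t ^ r * (c \<alpha> * monomial_at p \<alpha> q))"
  proof (rule sum.cong[OF refl])
    fix \<alpha> :: "'a \<Rightarrow> nat" assume "\<alpha> \<in> {\<alpha>. mdeg \<alpha> \<le> r}"
    then show "c \<alpha> * (t ^ mdeg \<alpha> * monomial_at p \<alpha> q) = t ^ r * (c \<alpha> * monomial_at p \<alpha> q)"
      using eq[of \<alpha> "monomial_at p \<alpha> q"] by blast
  qed
  then show ?thesis
    using c q by (simp add: coeffs_at_def monomial_at_line sum_distrib_left)
qed

section \<open>Barycentric coordinates of a simplex and its faces\<close>

locale simplex =
  fixes x :: "nat \<Rightarrow> real^'n" and V :: "nat set"
  assumes V: "V = {0..CARD('n)}"
    and inj_x: "inj_on x V"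
    and indep_x: "\<not> affine_dependent (x ` V)"
begin

lemma finite_V [simp]: "finite V"
  by (simp add: V)

lemma V_nonempty [simp]: "V \<noteq> {}"
  by (simp add: V)

text \<open>Relative to a vertex \<open>x b\<close> with \<open>b \<noteq> i\<close>, the other
  vertices give independent difference vectors. A linear functional equal to 1 on the one belonging
  to \<open>i\<close> and 0 on the rest, shifted to vanish at \<open>x b\<close>, is the
  coordinate.\<close>

lemma ex_barycentric:
  assumes i: "i \<in> V"
  shows "\<exists>hc. linear (fst hc) \<and> (\<forall>j\<in>V. fst hc (x j) + snd hc = (if j = i then 1 else 0 :: real))"
proof -
  \<comment> \<open>Two distinct vertices exist because the dimension is positive.\<close>
  obtain b where b: "b \<in> V" "b \<noteq> i"
  proof (cases "i = 0")
    case True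
    then show thesis
      using that[of 1] zero_less_card_finite[where 'a = 'n] by (simp add: V Suc_le_eq)
  qed (use that[of 0] in \<open>auto simp: V\<close>)
  have "independent ((\<lambda>y. - x b + y) ` (x ` V - {x b}))"
    using indep_x affine_dependent_iff_dependent2[of "x b" "x ` V"] b by auto
  from linear_independent_extend[OF this, of "\<lambda>v. if v = - x b + x i then 1 else 0"]
  obtain g :: "real^'n \<Rightarrow> real" where g: "linear g"
    "\<And>v. v \<in> (\<lambda>y. - x b + y) ` (x ` V - {x b}) \<Longrightarrow> g v = (if v = - x b + x i then 1 else 0)"
    by blast
  have "g (x j) + - g (x b) = (if j = i then 1 else 0)" if j: "j \<in> V" for j
  proof (cases "j = b")
    case False
    then have "x j \<noteq> x b"
      using inj_x j b by (auto dest: inj_onD)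
    then have "g (- x b + x j) = (if - x b + x j = - x b + x i then 1 else 0)"
      using j by (intro g) auto
    then show ?thesis
      using inj_on_eq_iff[OF inj_x j i] by (auto simp: linear_diff[OF g(1)] split: if_splits)
  qed (use b in auto)
  with g(1) show ?thesis
    by (intro exI[of _ "(g, - g (x b))"]) auto
qed

text \<open>Linear part and constant of the coordinate are chosen together: \<open>h i\<close> is
  the differential of \<open>L i\<close>. Both are defined on the whole space, and the same
  \<open>L i\<close> serves every face that contains \<open>x i\<close>.\<close>

definition hc :: "nat \<Rightarrow> (real^'n \<Rightarrow> real) \<times> real" where
  "hc i = (SOME hc. linear (fst hc) \<and> (\<forall>j\<in>V. fst hc (x j) + snd hc = (if j = i then 1 else 0 :: real)))"

definition h :: "nat \<Rightarrow> real^'n \<Rightarrow> real" where "h i = fst (hc i)"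

definition L :: "nat \<Rightarrow> real^'n \<Rightarrow> real" where "L i p = h i p + snd (hc i)"

lemma linear_h: "i \<in> V \<Longrightarrow> linear (h i)"
  and L_vertex: "i \<in> V \<Longrightarrow> j \<in> V \<Longrightarrow> L i (x j) = (if j = i then 1 else 0)"
  using someI_ex[OF ex_barycentric, of i] unfolding h_def L_def hc_def by blast+

lemma L_diff: "i \<in> V \<Longrightarrow> L i p - L i q = h i (p - q)"
  using linear_diff[OF linear_h] by (simp add: L_def)

lemma L_add: "i \<in> V \<Longrightarrow> L i (p + v) = L i p + h i v"
  using linear_add[OF linear_h] by (simp add: L_def)

lemma h_sum: "i \<in> V \<Longrightarrow> h i (\<Sum>j\<in>A. u j *\<^sub>R y j) = (\<Sum>j\<in>A. u j * h i (y j))"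
  by (simp add: linear_sum[OF linear_h] linear_scale[OF linear_h])

lemma L_sum: "i \<in> V \<Longrightarrow> sum u A = 1 \<Longrightarrow> L i (\<Sum>j\<in>A. u j *\<^sub>R y j) = (\<Sum>j\<in>A. u j * L i (y j))"
  by (simp add: L_def h_sum distrib_left sum.distrib flip: sum_distrib_right)

lemma h_vertex_sum:
  assumes "i \<in> V" "A \<subseteq> V" "sum u A = 0"
  shows "h i (\<Sum>j\<in>A. u j *\<^sub>R x j) = (if i \<in> A then u i else 0)"
proof -
  have "finite A"
    using assms(2) finite_subset[OF _ finite_V] by blast
  have "h i (\<Sum>j\<in>A. u j *\<^sub>R x j) = (\<Sum>j\<in>A. u j * L i (x j)) - sum u A * snd (hc i)"
    by (simp add: h_sum[OF assms(1)] L_def distrib_left sum.distrib sum_distrib_right)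
  also have "(\<Sum>j\<in>A. u j * L i (x j)) = (\<Sum>j\<in>A. if j = i then u i else 0)"
    using assms by (intro sum.cong) (auto simp: L_vertex subset_iff)
  finally show ?thesis
    using assms(3) \<open>finite A\<close> by simp
qed

lemma L_vertex_sum:
  assumes "i \<in> V" "A \<subseteq> V" "sum u A = 1"
  shows "L i (\<Sum>j\<in>A. u j *\<^sub>R x j) = (if i \<in> A then u i else 0)"
proof -
  have "finite A"
    using assms(2) finite_subset[OF _ finite_V] by blast
  have "L i (\<Sum>j\<in>A. u j *\<^sub>R x j) = (\<Sum>j\<in>A. if j = i then u i else 0)"
    unfolding L_sum[OF assms(1,3)] using assms by (intro sum.cong) (auto simp: L_vertex subset_iff)
  then show ?thesis
    using \<open>finite A\<close> by simp
qed

text \<open>The n + 1 affinely independent vertices have all of n-space as affine hull, so every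
  point is an affine combination of them, and its weights must be the values
  \<open>L j p\<close>.\<close>

lemma barycentric_sum: "p = (\<Sum>j\<in>V. L j p *\<^sub>R x j)" "(\<Sum>j\<in>V. L j p) = 1"
proof -
  have "card (x ` V) = CARD('n) + 1"
    using inj_x by (simp add: card_image V)
  then have "aff_dim (x ` V) = DIM(real^'n)"
    using aff_dim_affine_independent[OF indep_x] by simp
  then have "p \<in> affine hull (x ` V)"
    using aff_dim_eq_full by blast
  then obtain u where "sum u (x ` V) = 1" "(\<Sum>v\<in>x ` V. u v *\<^sub>R v) = p"
    by (auto simp: affine_hull_finite)
  then have u: "(\<Sum>j\<in>V. u (x j)) = 1" "p = (\<Sum>j\<in>V. u (x j) *\<^sub>R x j)"
    by (simp_all add: sum.reindex[OF inj_x])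
  have "L j p = u (x j)" if "j \<in> V" for j
    using L_vertex_sum[OF that order_refl u(1)] u(2) that by simp
  with u show "p = (\<Sum>j\<in>V. L j p *\<^sub>R x j)" "(\<Sum>j\<in>V. L j p) = 1"
    by simp_all
qed

lemma tangent_sum: "v = (\<Sum>j\<in>V. h j v *\<^sub>R x j)" "(\<Sum>j\<in>V. h j v) = 0"
proof -
  have h: "h j v = L j v - L j 0" if "j \<in> V" for j
    using L_diff[OF that, of v 0] by simp
  then have "(\<Sum>j\<in>V. h j v *\<^sub>R x j) = (\<Sum>j\<in>V. L j v *\<^sub>R x j) - (\<Sum>j\<in>V. L j 0 *\<^sub>R x j)"
    by (simp add: sum_subtractf scaleR_diff_left)
  then show "v = (\<Sum>j\<in>V. h j v *\<^sub>R x j)"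
    using barycentric_sum(1)[of v] barycentric_sum(1)[of 0] by simp
  show "(\<Sum>j\<in>V. h j v) = 0"
    using barycentric_sum(2)[of v] barycentric_sum(2)[of 0] by (simp add: h sum_subtractf)
qed

section \<open>Faces described by their vertex sets\<close>

definition F :: "nat set \<Rightarrow> (real^'n) set" where "F I = convex hull (x ` I)"

lemma barycentric_sum_on:
  assumes "I \<subseteq> V" "\<forall>j\<in>V - I. L j p = 0"
  shows "p = (\<Sum>j\<in>I. L j p *\<^sub>R x j)" "(\<Sum>j\<in>I. L j p) = 1"
  using barycentric_sum[of p] sum.mono_neutral_right[OF _ assms(1), of "\<lambda>j. L j p *\<^sub>R x j"]
    sum.mono_neutral_right[OF _ assms(1), of "\<lambda>j. L j p"] assms(2) by auto

lemma tangent_sum_on: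
  assumes "I \<subseteq> V" "\<forall>j\<in>V - I. h j v = 0"
  shows "v = (\<Sum>j\<in>I. h j v *\<^sub>R x j)" "(\<Sum>j\<in>I. h j v) = 0"
  using tangent_sum[of v] sum.mono_neutral_right[OF _ assms(1), of "\<lambda>j. h j v *\<^sub>R x j"]
    sum.mono_neutral_right[OF _ assms(1), of "\<lambda>j. h j v"] assms(2) by auto

lemma mem_F:
  assumes "I \<subseteq> V"
  shows "p \<in> F I \<longleftrightarrow> (\<forall>i\<in>I. 0 \<le> L i p) \<and> (\<forall>j\<in>V - I. L j p = 0)"
proof
  have fin: "finite (x ` I)"
    using assms finite_subset[OF _ finite_V] by blast
  have inj: "inj_on x I"
    using inj_x assms inj_on_subset by blast
  {
    assume "p \<in> F I"
    then obtain u where "\<forall>v\<in>x ` I. 0 \<le> u v" "sum u (x ` I) = 1" "(\<Sum>v\<in>x ` I. u v *\<^sub>R v) = p"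
      by (auto simp: F_def convex_hull_finite[OF fin])
    then have u: "\<forall>j\<in>I. 0 \<le> u (x j)" "(\<Sum>j\<in>I. u (x j)) = 1" "p = (\<Sum>j\<in>I. u (x j) *\<^sub>R x j)"
      by (simp_all add: sum.reindex[OF inj])
    have "L j p = (if j \<in> I then u (x j) else 0)" if "j \<in> V" for j
      using L_vertex_sum[OF that assms u(2)] u(3) by simp
    then show "(\<forall>i\<in>I. 0 \<le> L i p) \<and> (\<forall>j\<in>V - I. L j p = 0)"
      using u(1) assms by auto
  }
  assume *: "(\<forall>i\<in>I. 0 \<le> L i p) \<and> (\<forall>j\<in>V - I. L j p = 0)"
  then have s: "p = (\<Sum>j\<in>I. L j p *\<^sub>R x j)" "(\<Sum>j\<in>I. L j p) = 1"
    using barycentric_sum_on[OF assms] by blast+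
  have "(\<Sum>j\<in>I. L j p *\<^sub>R x j) \<in> convex hull (x ` I)"
    using * s(2) assms finite_subset[OF assms finite_V]
    by (intro convex_sum convex_convex_hull) (auto intro: hull_inc)
  then show "p \<in> F I"
    using s(1) by (simp add: F_def)
qed

lemma mem_affine_hull_F:
  assumes "I \<subseteq> V"
  shows "p \<in> affine hull (F I) \<longleftrightarrow> (\<forall>j\<in>V - I. L j p = 0)"
proof
  have fin: "finite (x ` I)"
    using assms finite_subset[OF _ finite_V] by blast
  have inj: "inj_on x I"
    using inj_x assms inj_on_subset by blast
  {
    assume "p \<in> affine hull (F I)"
    then obtain u where "sum u (x ` I) = 1" "(\<Sum>v\<in>x ` I. u v *\<^sub>R v) = p"
      by (auto simp: F_def affine_hull_finite[OF fin])
    then have u: "(\<Sum>j\<in>I. u (x j)) = 1" "p = (\<Sum>j\<in>I. u (x j) *\<^sub>R x j)"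
      by (simp_all add: sum.reindex[OF inj])
    show "\<forall>j\<in>V - I. L j p = 0"
      using L_vertex_sum[OF _ assms u(1)] u(2) by simp
  }
  assume *: "\<forall>j\<in>V - I. L j p = 0"
  have "p = (\<Sum>v\<in>x ` I. L (the_inv_into I x v) p *\<^sub>R v)" "(\<Sum>v\<in>x ` I. L (the_inv_into I x v) p) = 1"
    using barycentric_sum_on[OF assms *] by (simp_all add: sum.reindex[OF inj] the_inv_into_f_f[OF inj])
  then show "p \<in> affine hull (F I)"
    by (auto simp: F_def affine_hull_finite[OF fin])
qed

lemma vertex_in_F: "i \<in> I \<Longrightarrow> x i \<in> F I"
  by (simp add: F_def hull_inc)

lemma convex_F: "convex (F I)"
  by (simp add: F_def)

lemma F_mono: "I \<subseteq> J \<Longrightarrow> F I \<subseteq> F J"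
  by (simp add: F_def hull_mono image_mono)

lemma mem_tangent_F:
  assumes "I \<subseteq> V" "I \<noteq> {}"
  shows "v \<in> tangent (F I) \<longleftrightarrow> (\<forall>j\<in>V - I. h j v = 0)"
proof
  assume "v \<in> tangent (F I)"
  then obtain p q where "v = p - q" "p \<in> affine hull (F I)" "q \<in> affine hull (F I)"
    by (auto simp: tangent_def)
  then show "\<forall>j\<in>V - I. h j v = 0"
    using mem_affine_hull_F[OF assms(1)] by (simp flip: L_diff)
next
  assume *: "\<forall>j\<in>V - I. h j v = 0"
  obtain i where "i \<in> I"
    using assms by blast
  then have "x i \<in> affine hull (F I)"
    by (simp add: hull_inc vertex_in_F)
  moreover from this * have "x i + v \<in> affine hull (F I)"
    using mem_affine_hull_F[OF assms(1)] by (simp add: L_add)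
  moreover have "v = (x i + v) - x i"
    by simp
  ultimately show "v \<in> tangent (F I)"
    unfolding tangent_def by blast
qed

lemma tangent_simplex: "tangent (F V) = UNIV"
  using mem_tangent_F[of V] by auto

lemma subspace_tangent_F: "I \<subseteq> V \<Longrightarrow> I \<noteq> {} \<Longrightarrow> subspace (tangent (F I))"
  by (auto simp: subspace_def mem_tangent_F linear_0[OF linear_h] linear_add[OF linear_h] linear_scale[OF linear_h])

lemma tangent_diff: "p \<in> affine hull (F I) \<Longrightarrow> q \<in> affine hull (F I) \<Longrightarrow> p - q \<in> tangent (F I)"
  unfolding tangent_def by blast

lemma tangent_in_span:
  assumes "I \<subseteq> V" "I \<noteq> {}" "v \<in> tangent (F I)"
  shows "v \<in> span {y - p | y. y \<in> F I}"
proof -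
  have "\<forall>j\<in>V - I. h j v = 0"
    using assms mem_tangent_F by blast
  from tangent_sum_on[OF assms(1) this]
  have "v = (\<Sum>j\<in>I. h j v *\<^sub>R x j) - (\<Sum>j\<in>I. h j v) *\<^sub>R p"
    by simp
  also have "\<dots> = (\<Sum>j\<in>I. h j v *\<^sub>R (x j - p))"
    by (simp add: scaleR_diff_right sum_subtractf scaleR_left.sum)
  also have "\<dots> \<in> span {y - p | y. y \<in> F I}"
    by (intro span_sum span_scale span_base) (auto intro: vertex_in_F)
  finally show ?thesis .
qed

lemma solid_simplex: "solid (F V)"
  unfolding solid_def using tangent_in_span[of V] by (auto simp: convex_F tangent_simplex)

lemma vertex_indices_F:
  assumes "I \<subseteq> V"
  shows "vertex_indices x (F I) = I"
proof -
  have "\<not> affine_dependent (x ` I)"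
    using indep_x assms affine_dependent_subset[of "x ` I" "x ` V"] by blast
  then have "vertex_indices x (F I) = {i. i \<in> V \<and> x i \<in> x ` I}"
    by (simp add: V vertex_indices_def F_def extreme_point_of_convex_hull_affine_independent)
  also have "\<dots> = I"
    using assms inj_x by (auto dest: inj_onD)
  finally show ?thesis .
qed

lemma opposite_face_F: "I \<subseteq> V \<Longrightarrow> opposite_face x (F I) = F (V - I)"
  unfolding opposite_face_def by (simp add: vertex_indices_F flip: V F_def)

lemma faceE:
  assumes "f \<in> faces (F V)"
  obtains I where "I \<subseteq> V" "I \<noteq> {}" "f = F I"
proof -
  have f: "f face_of convex hull (x ` V)" "f \<noteq> {}"
    using assms by (auto simp: faces_def F_def)
  then obtain c where c: "c \<subseteq> x ` V" "f = convex hull c"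
    using face_of_convex_hull_affine_independent[OF indep_x] by blast
  then obtain I where "I \<subseteq> V" "c = x ` I"
    by (auto simp: subset_image_iff)
  with c f show thesis
    by (intro that[of I]) (auto simp: F_def)
qed

text \<open>An affine function on a simplex is determined by its values at the vertices, so the
  description in \<open>bary\<close> picks out the restriction of \<open>L i\<close>.\<close>

lemma bary_F:
  assumes I: "I \<subseteq> V" and i: "i \<in> I"
  shows "bary x (F I) i = (\<lambda>p. if p \<in> F I then L i p else 0)"
  unfolding bary_def vertex_indices_F[OF I]
proof (rule the_equality)
  have "i \<in> V"
    using assms by blast
  then have "linear (h i) \<and> (\<forall>p. (if p \<in> F I then L i p else 0) = (if p \<in> F I then h i p + snd (hc i) else 0))"
    by (simp add: linear_h L_def)
  moreover have "\<forall>j\<in>I. (if x j \<in> F I then L i (x j) else 0) = (if i = j then 1 else 0)"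
    using I \<open>i \<in> V\<close> by (auto simp: L_vertex vertex_in_F)
  ultimately show "(\<exists>h' c. linear h' \<and> (\<forall>p. (if p \<in> F I then L i p else 0) = (if p \<in> F I then h' p + c else 0))) \<and>
      (\<forall>j\<in>I. (if x j \<in> F I then L i (x j) else 0) = (if i = j then 1 else 0))"
    by blast
next
  fix l :: "real^'n \<Rightarrow> real"
  assume l: "(\<exists>h' c. linear h' \<and> (\<forall>p. l p = (if p \<in> F I then h' p + c else 0))) \<and>
      (\<forall>j\<in>I. l (x j) = (if i = j then 1 else 0))"
  then obtain h' and c :: real where h': "linear h'" "\<And>p. l p = (if p \<in> F I then h' p + c else 0)"
    by blast
  have "finite I"
    using I finite_subset[OF _ finite_V] by blast
  have "h' p + c = L i p" if "p \<in> F I" for p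
  proof -
    have s: "p = (\<Sum>j\<in>I. L j p *\<^sub>R x j)" "(\<Sum>j\<in>I. L j p) = 1"
      using barycentric_sum_on[OF I] mem_F[OF I] that by blast+
    have "h' p + c = (\<Sum>j\<in>I. L j p * h' (x j)) + (\<Sum>j\<in>I. L j p) * c"
      using s linear_sum[OF h'(1), of "\<lambda>j. L j p *\<^sub>R x j" I] by (simp add: linear_scale[OF h'(1)])
    also have "\<dots> = (\<Sum>j\<in>I. L j p * l (x j))"
      by (simp add: h'(2) vertex_in_F distrib_left sum.distrib sum_distrib_right)
    also have "\<dots> = (\<Sum>j\<in>I. if j = i then L i p else 0)"
      using l by (intro sum.cong) auto
    also have "\<dots> = L i p"
      using i \<open>finite I\<close> by simp
    finally show ?thesis .
  qed
  then show "l = (\<lambda>p. if p \<in> F I then L i p else 0)"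
    by (auto simp: h'(2))
qed

text \<open>A proper face has empty interior, so the chosen derivative within it is arbitrary in
  transversal directions. Tangent directions are spanned by the differences \<open>y - p\<close>
  with \<open>y\<close> in the face, where it is unique.\<close>

lemma diff_fun_bary_F:
  assumes I: "I \<subseteq> V" and i: "i \<in> I" and p: "p \<in> F I" and v: "v \<in> tangent (F I)"
  shows "diff_fun (F I) (bary x (F I) i) p [v] = h i v"
proof -
  let ?u = "bary x (F I) i"
  have lin: "linear (h i)"
    using linear_h I i by blast
  have "(L i has_derivative h i) (at p within F I)"
    using bounded_linear_imp_has_derivative[OF linear_conv_bounded_linear[THEN iffD1, OF lin]]
    unfolding L_def[abs_def] by (auto intro!: derivative_eq_intros)
  then have D: "(?u has_derivative h i) (at p within F I)"
    by (rule has_derivative_transform[OF p, rotated]) (simp add: bary_F[OF I i])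
  then have fd: "(?u has_derivative frechet_derivative ?u (at p within F I)) (at p within F I)"
    using differentiableI frechet_derivative_works by blast
  have "frechet_derivative ?u (at p within F I) v = h i v"
  proof (rule linear_eq_on[where B = "{y - p | y. y \<in> F I}"])
    show "linear (frechet_derivative ?u (at p within F I))" "linear (h i)"
      using D fd has_derivative_linear by blast+
    show "v \<in> span {y - p |y. y \<in> F I}"
      using tangent_in_span[OF I _ v] i by blast
  qed (use has_derivative_within_convex_unique[OF convex_F p _ fd D] in auto)
  then show ?thesis
    using p v by (simp add: diff_fun_def)
qed

lemma filter_neq_upt:
  assumes "i < n"
  shows "filter (\<lambda>j. j \<noteq> i) [0..<n] = map (\<lambda>m. if m < i then m else Suc m) [0..<n - 1]"
proof -
  have "[0..<n] = [0..<i] @ i # [Suc i..<n]"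
    using assms by (metis less_imp_le_nat upt_add_eq_append[of 0 i "n - i"] le0 le_add_diff_inverse upt_conv_Cons)
  moreover have "filter (\<lambda>j. j \<noteq> i) [0..<i] = [0..<i]" "filter (\<lambda>j. j \<noteq> i) [Suc i..<n] = [Suc i..<n]"
    by (auto intro: filter_True)
  moreover have "map (\<lambda>m. if m < i then m else Suc m) [0..<n - 1] = [0..<i] @ [Suc i..<n]"
    using assms by (intro nth_equalityI) (auto simp: nth_append)
  ultimately show ?thesis
    by simp
qed

text \<open>The alternating sum defining a Whitney form is the Laplace expansion along the row of
  coordinates. A transposition intervenes because \<open>wedge\<close> has the 1-forms as rows,
  whereas \<open>bdet\<close> has the vectors.\<close>

lemma whitney_F:
  assumes I: "I \<subseteq> V" and \<sigma>: "\<sigma> ` {0..k} \<subseteq> I"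
  shows "whitney x (F I) k \<sigma> p vs =
    (if p \<in> F I \<and> length vs = k \<and> set vs \<subseteq> tangent (F I)
     then bdet k (\<lambda>j. L (\<sigma> j) p) (\<lambda>i j. h (\<sigma> j) (vs ! i)) else 0)"
proof (cases "p \<in> F I \<and> length vs = k \<and> set vs \<subseteq> tangent (F I)")
  case True
  have \<sigma>I: "\<sigma> j \<in> I" if "j \<le> k" for j
    using \<sigma> that by auto
  have "wedge (F I) (map (\<lambda>j. diff_fun (F I) (bary x (F I) (\<sigma> j))) (filter (\<lambda>j. j \<noteq> i) [0..<Suc k])) p vs =
      detf k (\<lambda>i' j'. h (\<sigma> (if j' < i then j' else Suc j')) (vs ! i'))" if i: "i \<le> k" for i
  proof -
    define del where "del m = (if m < i then m else Suc m)" for m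
    have del: "filter (\<lambda>j. j \<noteq> i) [0..<Suc k] = map del [0..<k]"
      using filter_neq_upt[of i "Suc k"] i by (simp add: del_def[abs_def])
    have "del m \<le> k" if "m < k" for m
      using that by (auto simp: del_def)
    moreover have "vs ! m \<in> tangent (F I)" if "m < k" for m
      using that True by auto
    ultimately have "wedge (F I) (map (\<lambda>j. diff_fun (F I) (bary x (F I) (\<sigma> j))) (map del [0..<k])) p vs =
        (\<Sum>\<pi> | \<pi> permutes {..<k}. of_int (sign \<pi>) * (\<Prod>m<k. h (\<sigma> (del m)) (vs ! \<pi> m)))"
      using True permutes_in_image[of _ "{..<k}"]
      by (auto simp: wedge_def intro!: sum.cong prod.cong diff_fun_bary_F[OF I \<sigma>I])
    also have "\<dots> = detf k (\<lambda>m j. h (\<sigma> (del m)) (vs ! j))"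
      by (simp add: detf_perm_sum)
    also have "\<dots> = detf k (\<lambda>i' j'. h (\<sigma> (del j')) (vs ! i'))"
      by (rule detf_transpose)
    finally show ?thesis
      by (simp only: del del_def)
  qed
  then have "whitney x (F I) k \<sigma> p vs =
      (\<Sum>i = 0..k. (-1) ^ i * L (\<sigma> i) p * detf k (\<lambda>i' j'. h (\<sigma> (if j' < i then j' else Suc j')) (vs ! i')))"
    unfolding whitney_def using True by (intro sum.cong) (auto simp: bary_F[OF I \<sigma>I] simp del: upt_Suc)
  then show ?thesis
    using True by (simp add: bdet_expansion atMost_atLeast0)
next
  case False
  have "length (filter (\<lambda>j. j \<noteq> i) [0..<Suc k]) = k" if "i \<le> k" for i
    using filter_neq_upt[of i "Suc k"] that by simp
  then have "wedge (F I) (map (\<lambda>j. diff_fun (F I) (bary x (F I) (\<sigma> j))) (filter (\<lambda>j. j \<noteq> i) [0..<Suc k])) p vs = 0"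
    if "i \<le> k" for i
    using False that by (auto simp: wedge_def simp del: upt_Suc)
  then have "whitney x (F I) k \<sigma> p vs = 0"
    unfolding whitney_def by (intro sum.neutral) (simp del: upt_Suc)
  then show ?thesis
    by (simp only: False if_False)
qed

lemma bary_power_F:
  assumes "I \<subseteq> V" "p \<in> F I"
  shows "bary_power x (F I) \<alpha> p = (\<Prod>i\<in>I. L i p ^ \<alpha> i)"
  unfolding bary_power_def vertex_indices_F[OF assms(1)]
  by (intro prod.cong refl) (simp add: bary_F[OF assms(1)] assms(2))

end

section \<open>Trimmed forms\<close>

lemma poly_fun_on_lincomb:
  assumes "poly_fun_on (int d) S u" "poly_fun_on (int d) S v"
  shows "poly_fun_on (int d) S (\<lambda>p. a * u p + b * v p)"
proof -
  obtain U W where "poly_at 0 {\<alpha>. mdeg \<alpha> \<le> d} U" "poly_at 0 {\<alpha>. mdeg \<alpha> \<le> d} W"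
    and "\<forall>q\<in>S. u q = U q" "\<forall>q\<in>S. v q = W q"
    using assms unfolding poly_fun_on_iff by blast
  then show ?thesis
    unfolding poly_fun_on_iff by (intro exI[of _ "\<lambda>q. a * U q + b * W q"]) (simp add: poly_at_lincomb)
qed

lemma poly_fun_on_cong:
  "poly_fun_on r S u \<Longrightarrow> (\<And>p. p \<in> S \<Longrightarrow> v p = u p) \<Longrightarrow> poly_fun_on r S v"
  by (auto simp: poly_fun_on_def)

lemma poly_formsI:
  assumes "is_form k S \<omega>"
    and "\<And>vs. length vs = k \<Longrightarrow> set vs \<subseteq> tangent S \<Longrightarrow> poly_fun_on r S (\<lambda>p. \<omega> p vs)"
  shows "\<omega> \<in> poly_forms r k S"
  using assms by (simp add: poly_forms_def)

lemma poly_forms_is_form: "\<omega> \<in> poly_forms r k S \<Longrightarrow> is_form k S \<omega>"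
  by (simp add: poly_forms_def)

lemma is_form_eq_0: "is_form k S \<omega> \<Longrightarrow> \<not> (p \<in> S \<and> length vs = k \<and> set vs \<subseteq> tangent S) \<Longrightarrow> \<omega> p vs = 0"
  unfolding is_form_def by blast

lemma is_form_lincomb:
  assumes "is_form k S \<omega>" "is_form k S \<eta>"
  shows "is_form k S (\<lambda>p vs. a * \<omega> p vs + b * \<eta> p vs)"
  using assms unfolding is_form_alternating_on by (auto intro!: alternating_on_lincomb)

lemma poly_forms_lincomb:
  assumes "\<omega> \<in> poly_forms (int d) k S" "\<eta> \<in> poly_forms (int d) k S"
  shows "(\<lambda>p vs. a * \<omega> p vs + b * \<eta> p vs) \<in> poly_forms (int d) k S"
  using assms by (auto simp: poly_forms_def intro!: is_form_lincomb poly_fun_on_lincomb)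

lemma contract_poly_forms:
  assumes "\<eta> \<in> poly_forms r (Suc k) S" "w \<in> tangent S"
  shows "(\<lambda>p vs. \<eta> p (w # vs)) \<in> poly_forms r k S"
proof (rule poly_formsI)
  have f: "is_form (Suc k) S \<eta>"
    using assms(1) by (rule poly_forms_is_form)
  show "is_form k S (\<lambda>p vs. \<eta> p (w # vs))"
    unfolding is_form_alternating_on
  proof (intro conjI allI impI ballI)
    fix p vs assume "\<not> (p \<in> S \<and> length vs = k \<and> set vs \<subseteq> tangent S)"
    then show "\<eta> p (w # vs) = 0"
      by (intro is_form_eq_0[OF f]) auto
  next
    fix p assume "p \<in> S"
    then show "alternating_on k (tangent S) (\<lambda>vs. \<eta> p (w # vs))"
      using f assms(2) unfolding is_form_alternating_on by (intro alternating_on_Cons) auto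
  qed
qed (use assms in \<open>auto simp: poly_forms_def\<close>)

lemma is_form_koszul:
  assumes f: "is_form (Suc k) S \<eta>" and a: "a \<in> affine hull S"
  shows "is_form k S (koszul a \<eta>)"
  unfolding is_form_alternating_on koszul_def
proof (intro conjI allI impI ballI)
  fix p vs assume "\<not> (p \<in> S \<and> length vs = k \<and> set vs \<subseteq> tangent S)"
  then show "\<eta> p ((p - a) # vs) = 0"
    by (intro is_form_eq_0[OF f]) auto
next
  fix p assume p: "p \<in> S"
  then have "p - a \<in> tangent S"
    unfolding tangent_def using a by (auto intro: hull_inc)
  with p show "alternating_on k (tangent S) (\<lambda>vs. \<eta> p ((p - a) # vs))"
    using f unfolding is_form_alternating_on by (intro alternating_on_Cons) auto
qed

text \<open>Linearity in the first argument: moving the origin adds a contraction with a constant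
  vector, which does not raise the degree.\<close>

lemma koszul_change_origin:
  assumes f: "is_form (Suc k) S \<eta>" and a: "a \<in> affine hull S" "b \<in> affine hull S"
  shows "koszul a \<eta> p vs = koszul b \<eta> p vs + \<eta> p ((b - a) # vs)"
proof (cases "p \<in> S \<and> length vs = k \<and> set vs \<subseteq> tangent S")
  case True
  then have t: "p - b \<in> tangent S" "b - a \<in> tangent S"
    unfolding tangent_def using a by (auto intro: hull_inc)
  have "alternating_on (Suc k) (tangent S) (\<eta> p)"
    using f True unfolding is_form_alternating_on by blast
  from alternating_on_linear[OF this, of "(b - a) # vs" 0 "p - b" "b - a" 1 1] show ?thesis
    using True t by (simp add: koszul_def)
next
  case False
  then have "\<not> (p \<in> S \<and> length (v # vs) = Suc k \<and> set (v # vs) \<subseteq> tangent S)" for v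
    by auto
  then show ?thesis
    using is_form_eq_0[OF f] unfolding koszul_def by (metis add_0)
qed

lemma trimmed_formsE:
  assumes "\<omega> \<in> trimmed_forms (Suc d) k S" "S \<noteq> {}"
  obtains a \<alpha> \<beta> where "a \<in> affine hull S" "\<alpha> \<in> poly_forms (int d) k S" "\<beta> \<in> poly_forms (int d) (Suc k) S"
    "\<omega> = (\<lambda>p vs. \<alpha> p vs + koszul a \<beta> p vs)"
proof -
  have "(SOME a. a \<in> affine hull S) \<in> affine hull S"
    using assms(2) hull_inc[of _ S affine] by (metis ex_in_conv someI)
  then show thesis
    using assms(1) that by (auto simp: trimmed_forms_def Let_def)
qed

text \<open>\<open>trimmed_forms\<close> fixes some origin by choice. Passing to it from
  \<open>a\<close> adds a contraction that is absorbed in the polynomial part, so any origin in the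
  affine hull will do.\<close>

lemma trimmed_formsI:
  assumes "a \<in> affine hull S" "\<alpha> \<in> poly_forms (int d) k S" "\<beta> \<in> poly_forms (int d) (Suc k) S"
    "\<omega> = (\<lambda>p vs. \<alpha> p vs + koszul a \<beta> p vs)"
  shows "\<omega> \<in> trimmed_forms (Suc d) k S"
proof -
  define b where "b = (SOME a. a \<in> affine hull S)"
  have b: "b \<in> affine hull S"
    unfolding b_def by (rule someI[of _ a]) (rule assms(1))
  have f: "is_form (Suc k) S \<beta>"
    using assms(3) by (rule poly_forms_is_form)
  have "b - a \<in> tangent S"
    unfolding tangent_def using b assms(1) by blast
  then have "(\<lambda>p vs. 1 * \<alpha> p vs + 1 * \<beta> p ((b - a) # vs)) \<in> poly_forms (int d) k S"
    by (intro poly_forms_lincomb assms contract_poly_forms[OF assms(3)])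
  moreover have "\<omega> = (\<lambda>p vs. (1 * \<alpha> p vs + 1 * \<beta> p ((b - a) # vs)) + koszul b \<beta> p vs)"
    by (simp add: assms(4) koszul_change_origin[OF f assms(1) b] fun_eq_iff)
  ultimately show ?thesis
    unfolding trimmed_forms_def Let_def b_def[symmetric] using assms(3) by auto
qed

lemma trimmed_forms_lincomb:
  assumes "\<omega> \<in> trimmed_forms (Suc d) k S" "\<eta> \<in> trimmed_forms (Suc d) k S"
  shows "(\<lambda>p vs. a * \<omega> p vs + b * \<eta> p vs) \<in> trimmed_forms (Suc d) k S"
proof -
  define z where "z = (SOME a. a \<in> affine hull S)"
  obtain \<alpha> \<beta> \<alpha>' \<beta>' where *: "\<alpha> \<in> poly_forms (int d) k S" "\<beta> \<in> poly_forms (int d) (Suc k) S"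
    "\<alpha>' \<in> poly_forms (int d) k S" "\<beta>' \<in> poly_forms (int d) (Suc k) S"
    and \<omega>: "\<omega> = (\<lambda>p vs. \<alpha> p vs + koszul z \<beta> p vs)" and \<eta>: "\<eta> = (\<lambda>p vs. \<alpha>' p vs + koszul z \<beta>' p vs)"
    using assms unfolding trimmed_forms_def Let_def z_def by auto
  have "(\<lambda>p vs. a * \<omega> p vs + b * \<eta> p vs) = (\<lambda>p vs. (a * \<alpha> p vs + b * \<alpha>' p vs) +
      koszul z (\<lambda>p vs. a * \<beta> p vs + b * \<beta>' p vs) p vs)"
    by (simp add: \<omega> \<eta> koszul_def algebra_simps)
  then show ?thesis
    unfolding trimmed_forms_def Let_def z_def[symmetric]
    using poly_forms_lincomb[OF *(1,3), of a b] poly_forms_lincomb[OF *(2,4), of a b] by auto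
qed

lemma is_form_trimmed:
  assumes "\<omega> \<in> trimmed_forms (Suc d) k S" "S \<noteq> {}"
  shows "is_form k S \<omega>"
proof -
  obtain a \<alpha> \<beta> where *: "a \<in> affine hull S" "\<alpha> \<in> poly_forms (int d) k S" "\<beta> \<in> poly_forms (int d) (Suc k) S"
    "\<omega> = (\<lambda>p vs. \<alpha> p vs + koszul a \<beta> p vs)"
    using assms by (rule trimmed_formsE)
  have "is_form k S \<alpha>" "is_form k S (koszul a \<beta>)"
    using * by (auto intro: is_form_koszul poly_forms_is_form)
  then show ?thesis
    using is_form_lincomb[of k S \<alpha> "koszul a \<beta>" 1 1] *(4) by simp
qed

lemma zero_trimmed: "S \<noteq> {} \<Longrightarrow> (\<lambda>p vs. 0) \<in> trimmed_forms (Suc d) k S"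
proof -
  assume "S \<noteq> {}"
  then obtain a where "a \<in> affine hull S"
    using hull_inc[of _ S affine] by blast
  moreover have "(\<lambda>p vs. 0) \<in> poly_forms (int d) m S" for m
    unfolding poly_forms_def poly_fun_on_iff by (auto simp: is_form_def intro: poly_at_0)
  ultimately show ?thesis
    by (intro trimmed_formsI[of a S "\<lambda>p vs. 0" d k "\<lambda>p vs. 0"]) (auto simp: koszul_def)
qed

section \<open>Spans of forms and reordering of indices\<close>

text \<open>An inductive definition, so that what survives adding a multiple of a generator extends
  to all trimmed forms by rule induction.\<close>

inductive_set form_span :: "'n form set \<Rightarrow> 'n form set" for G where
  zero: "(\<lambda>p vs. 0) \<in> form_span G"
| step: "g \<in> G \<Longrightarrow> \<mu> \<in> form_span G \<Longrightarrow> (\<lambda>p vs. c * g p vs + \<mu> p vs) \<in> form_span G"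

lemma form_span_base: "g \<in> G \<Longrightarrow> g \<in> form_span G"
  using form_span.step[OF _ form_span.zero, of g G 1] by simp

lemma form_span_add:
  assumes "\<mu> \<in> form_span G" "\<nu> \<in> form_span G"
  shows "(\<lambda>p vs. \<mu> p vs + \<nu> p vs) \<in> form_span G"
  using assms
proof induction
  case (step g \<mu> c)
  then show ?case
    using form_span.step[of g G "\<lambda>p vs. \<mu> p vs + \<nu> p vs" c] by (simp add: add.assoc)
qed simp

lemma form_span_cmult:
  assumes "\<mu> \<in> form_span G"
  shows "(\<lambda>p vs. c * \<mu> p vs) \<in> form_span G"
  using assms
proof induction
  case zero
  show ?case
    using form_span.zero by simp
next
  case (step g \<mu> b)
  then show ?case
    using form_span.step[of g G "\<lambda>p vs. c * \<mu> p vs" "c * b"] by (simp add: algebra_simps)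
qed

lemma form_span_sum:
  "(\<And>i. i \<in> A \<Longrightarrow> \<mu> i \<in> form_span G) \<Longrightarrow> (\<lambda>p vs. \<Sum>i\<in>A. \<mu> i p vs) \<in> form_span G"
  by (induction A rule: infinite_finite_induct) (auto intro: form_span.zero form_span_add)

lemma bdet_permute_columns:
  assumes "p permutes {..<Suc k}"
  shows "bdet k (\<lambda>j. c (p j)) (\<lambda>i j. R i (p j)) = of_int (sign p) * bdet k c R"
  unfolding bdet_def detf_permute_columns[OF assms, symmetric]
  by (rule detf_cong) (auto split: nat.split)

lemma bdet_not_inj:
  assumes "\<not> inj_on \<sigma> {..k}"
  shows "bdet k (\<lambda>j. c (\<sigma> j)) (\<lambda>i j. R i (\<sigma> j)) = 0"
proof -
  obtain j j' where "j \<le> k" "j' \<le> k" "j \<noteq> j'" "\<sigma> j = \<sigma> j'"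
    using assms by (auto simp: inj_on_def)
  then show ?thesis
    unfolding bdet_def by (intro detf_identical_columns[of j _ j']) (auto split: nat.split)
qed

lemma sorting_permutation:
  fixes \<sigma> :: "nat \<Rightarrow> nat"
  assumes "inj_on \<sigma> {..k}"
  obtains \<tau> p where "strict_mono_on {0..k} \<tau>" "\<tau> ` {0..k} = \<sigma> ` {..k}"
    "p permutes {..<Suc k}" "\<And>j. j \<le> k \<Longrightarrow> \<sigma> j = \<tau> (p j)"
proof -
  define A where "A = \<sigma> ` {..k}"
  define \<tau> where "\<tau> = (\<lambda>j. sorted_list_of_set A ! j)"
  have card: "card A = Suc k" "finite A"
    using assms by (simp_all add: A_def card_image)
  have mono: "strict_mono_on {0..k} \<tau>"
    unfolding \<tau>_def strict_mono_on_def using card strict_sorted_list_of_set[of A]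
    by (auto simp: sorted_wrt_iff_nth_less)
  then have inj: "inj_on \<tau> {..<Suc k}"
    using strict_mono_on_imp_inj_on by (metis atLeast0AtMost lessThan_Suc_atMost)
  have img: "\<tau> ` {..<Suc k} = A"
    using card set_sorted_list_of_set[of A] unfolding \<tau>_def set_conv_nth by (auto simp: image_def)
  \<comment> \<open>The permutation is \<tau>^-1 \<sigma>, continued by the identity beyond
    \<open>k\<close>.\<close>
  define p where "p j = (if j \<in> {..<Suc k} then the_inv_into {..<Suc k} \<tau> (\<sigma> j) else j)" for j
  have p: "p j \<in> {..<Suc k}" "\<tau> (p j) = \<sigma> j" if "j \<in> {..<Suc k}" for j
  proof -
    have "\<sigma> j \<in> \<tau> ` {..<Suc k}"
      using that img by (auto simp: A_def)
    then show "p j \<in> {..<Suc k}" "\<tau> (p j) = \<sigma> j"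
      using that the_inv_into_into[OF inj _ order_refl] f_the_inv_into_f[OF inj] by (auto simp: p_def)
  qed
  have "inj_on p {..<Suc k}"
    using p(2) assms by (metis inj_on_def lessThan_Suc_atMost)
  then have "bij_betw p {..<Suc k} {..<Suc k}"
    using p(1) by (intro bij_betw_imageI endo_inj_surj) auto
  then have perm: "p permutes {..<Suc k}"
    by (rule bij_imp_permutes) (simp add: p_def)
  have "\<tau> ` {0..k} = \<sigma> ` {..k}"
    using img by (simp only: A_def atLeast0AtMost lessThan_Suc_atMost)
  moreover have "\<sigma> j = \<tau> (p j)" if "j \<le> k" for j
    using p(2)[of j] that by simp
  ultimately show thesis
    by (rule that[OF mono _ perm])
qed

context simplex
begin

lemma poly_at_L_power:
  assumes "i \<in> V" "poly_at p {\<alpha>. mdeg \<alpha> \<le> e} u"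
  shows "poly_at p {\<alpha>. mdeg \<alpha> \<le> m + e} (\<lambda>q. L i q ^ m * u q)"
proof (induction m)
  case (Suc m)
  then show ?case
    using poly_at_affine_mult[OF linear_h[OF assms(1)] Suc, of "snd (hc i)"] by (simp add: L_def mult.assoc)
qed (use assms in simp)

lemma poly_at_L_prod:
  assumes "finite A" "A \<subseteq> V"
  shows "poly_at p {\<beta>. mdeg \<beta> \<le> sum \<alpha> A} (\<lambda>q. \<Prod>i\<in>A. L i q ^ \<alpha> i)"
  using assms
proof induction
  case empty
  show ?case
    using poly_at_const(2)[of p 0 1] by simp
qed (use poly_at_L_power in auto)

section \<open>Spanning of the trimmed forms by Whitney forms\<close>

text \<open>The form \<lambda>^\<alpha> \<phi>_\<sigma> on the face \<open>F I\<close>. It is meant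
  for arbitrary \<sigma>, not only increasing ones, and ignores \<alpha> outside
  \<open>I\<close>.\<close>

definition whitney_form :: "nat set \<Rightarrow> nat \<Rightarrow> (nat \<Rightarrow> nat) \<Rightarrow> (nat \<Rightarrow> nat) \<Rightarrow> 'n form" where
  "whitney_form I k \<alpha> \<sigma> = (\<lambda>p vs. if p \<in> F I \<and> length vs = k \<and> set vs \<subseteq> tangent (F I)
     then (\<Prod>i\<in>I. L i p ^ \<alpha> i) * bdet k (\<lambda>j. L (\<sigma> j) p) (\<lambda>i j. h (\<sigma> j) (vs ! i)) else 0)"

lemma whitney_form_outside: "p \<notin> F I \<Longrightarrow> whitney_form I k \<alpha> \<sigma> p vs = 0"
  by (simp add: whitney_form_def)

lemma whitney_form_eq:
  assumes "I \<subseteq> V" "\<sigma> ` {0..k} \<subseteq> I"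
  shows "(\<lambda>p vs. bary_power x (F I) \<alpha> p * whitney x (F I) k \<sigma> p vs) = whitney_form I k \<alpha> \<sigma>"
  by (auto simp: fun_eq_iff whitney_form_def whitney_F[OF assms] bary_power_F[OF assms(1)])

lemma product_form_poly:
  assumes I: "I \<subseteq> V" "I \<noteq> {}" and g: "alternating_on m (tangent (F I)) g" and u: "poly_fun_on r (F I) u"
  shows "(\<lambda>p vs. if p \<in> F I \<and> length vs = m \<and> set vs \<subseteq> tangent (F I) then u p * g vs else 0) \<in> poly_forms r m (F I)"
    (is "?\<omega> \<in> _")
proof (rule poly_formsI)
  show "is_form m (F I) ?\<omega>"
    unfolding is_form_alternating_on
  proof (intro conjI allI impI ballI)
    fix p vs assume "\<not> (p \<in> F I \<and> length vs = m \<and> set vs \<subseteq> tangent (F I))"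
    then show "?\<omega> p vs = 0"
      by (simp only: if_False)
  next
    fix p assume p: "p \<in> F I"
    have "alternating_on m (tangent (F I)) (\<lambda>vs. u p * g vs + 0 * g vs)"
      by (rule alternating_on_lincomb[OF g g])
    then show "alternating_on m (tangent (F I)) (?\<omega> p)"
      by (rule alternating_on_cong) (simp_all add: p subspace_tangent_F[OF I])
  qed
next
  fix vs assume "length vs = m" "set vs \<subseteq> tangent (F I)"
  then have eq: "?\<omega> p vs = g vs * u p" if "p \<in> F I" for p
    using that by simp
  obtain c where c: "\<And>p. p \<in> F I \<Longrightarrow> u p = (\<Sum>\<alpha> | int (\<Sum>i\<in>UNIV. \<alpha> i) \<le> r. c \<alpha> * (\<Prod>i\<in>UNIV. (p $ i) ^ \<alpha> i))"
    using u unfolding poly_fun_on_def by blast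
  show "poly_fun_on r (F I) (\<lambda>p. ?\<omega> p vs)"
    unfolding poly_fun_on_def
  proof (intro exI ballI)
    fix p assume p: "p \<in> F I"
    have "g vs * u p = (\<Sum>\<alpha> | int (\<Sum>i\<in>UNIV. \<alpha> i) \<le> r. (g vs * c \<alpha>) * (\<Prod>i\<in>UNIV. (p $ i) ^ \<alpha> i))"
      unfolding c[OF p] sum_distrib_left mult.assoc ..
    with eq[OF p] show "?\<omega> p vs = (\<Sum>\<alpha> | int (\<Sum>i\<in>UNIV. \<alpha> i) \<le> r. (g vs * c \<alpha>) * (\<Prod>i\<in>UNIV. (p $ i) ^ \<alpha> i))"
      by (rule trans)
  qed
qed

text \<open>Splitting \<open>L (\<sigma> j) p = L (\<sigma> j) a + h (\<sigma> j) (p - a)\<close> in the top row of the determinant separates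
  the Koszul part.\<close>

lemma whitney_form_trimmed:
  assumes I: "I \<subseteq> V" "I \<noteq> {}" and \<sigma>: "\<sigma> ` {0..k} \<subseteq> I" and \<alpha>: "sum \<alpha> I = d"
  shows "whitney_form I k \<alpha> \<sigma> \<in> trimmed_forms (Suc d) k (F I)"
proof -
  have \<sigma>V: "\<sigma> j \<in> V" if "j \<le> k" for j
  proof -
    have "\<sigma> j \<in> \<sigma> ` {0..k}"
      using that by auto
    then show ?thesis
      using \<sigma> I(1) by blast
  qed
  obtain i where "i \<in> I"
    using I by blast
  then have a: "x i \<in> affine hull (F I)"
    by (simp add: hull_inc vertex_in_F)
  define a where "a = x i"
  define u where "u = (\<lambda>p. \<Prod>i\<in>I. L i p ^ \<alpha> i)"
  have u: "poly_fun_on (int d) (F I) u"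
    unfolding poly_fun_on_iff u_def
    using poly_at_L_prod[OF finite_subset[OF I(1) finite_V] I(1), of 0 \<alpha>] \<alpha> by blast
  define \<eta> where "\<eta> = (\<lambda>p vs. if p \<in> F I \<and> length vs = k \<and> set vs \<subseteq> tangent (F I)
      then u p * bdet k (\<lambda>j. L (\<sigma> j) a) (\<lambda>i j. h (\<sigma> j) (vs ! i)) else 0)"
  define \<beta> where "\<beta> = (\<lambda>p vs. if p \<in> F I \<and> length vs = Suc k \<and> set vs \<subseteq> tangent (F I)
      then u p * detf (Suc k) (\<lambda>i j. h (\<sigma> j) (vs ! i)) else 0)"
  have "\<eta> \<in> poly_forms (int d) k (F I)"
    unfolding \<eta>_def by (intro product_form_poly I u alternating_on_bdet linear_h \<sigma>V)
  moreover have "\<beta> \<in> poly_forms (int d) (Suc k) (F I)"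
    unfolding \<beta>_def by (intro product_form_poly I u alternating_on_detf linear_h \<sigma>V) simp
  moreover have "whitney_form I k \<alpha> \<sigma> p vs = \<eta> p vs + koszul a \<beta> p vs" for p vs
  proof (cases "p \<in> F I \<and> length vs = k \<and> set vs \<subseteq> tangent (F I)")
    case True
    have "bdet k (\<lambda>j. L (\<sigma> j) p) (\<lambda>i j. h (\<sigma> j) (vs ! i)) =
        bdet k (\<lambda>j. 1 * L (\<sigma> j) a + 1 * h (\<sigma> j) (p - a)) (\<lambda>i j. h (\<sigma> j) (vs ! i))"
      by (intro bdet_cong) (simp_all add: L_diff[OF \<sigma>V, symmetric])
    also have "\<dots> = bdet k (\<lambda>j. L (\<sigma> j) a) (\<lambda>i j. h (\<sigma> j) (vs ! i)) +
        detf (Suc k) (\<lambda>i j. h (\<sigma> j) (((p - a) # vs) ! i))"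
      unfolding bdet_top_linear bdet_Cons[of k "\<lambda>j. h (\<sigma> j)"] by simp
    finally have "whitney_form I k \<alpha> \<sigma> p vs = u p * (bdet k (\<lambda>j. L (\<sigma> j) a) (\<lambda>i j. h (\<sigma> j) (vs ! i)) +
        detf (Suc k) (\<lambda>i j. h (\<sigma> j) (((p - a) # vs) ! i)))"
      using True by (simp add: whitney_form_def u_def)
    moreover have "p - a \<in> tangent (F I)"
      using True a by (intro tangent_diff) (auto simp: a_def intro: hull_inc)
    ultimately show ?thesis
      using True by (simp add: \<eta>_def \<beta>_def koszul_def distrib_left)
  next
    case False
    then show ?thesis
      by (auto simp: whitney_form_def \<eta>_def \<beta>_def koszul_def)
  qed
  ultimately show ?thesis
    using a by (intro trimmed_formsI[of a]) (auto simp: a_def)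
qed

text \<open>The conditions are those under which \<open>is_bary_ext\<close> prescribes values.
  Exponents vanish outside \<open>I\<close> because the same \<alpha> is used on the whole
  simplex.\<close>

definition generators :: "nat set \<Rightarrow> nat \<Rightarrow> nat \<Rightarrow> 'n form set" where
  "generators I d k = {whitney_form I k \<alpha> \<sigma> | \<alpha> \<sigma>. (\<forall>i. i \<notin> I \<longrightarrow> \<alpha> i = 0) \<and> sum \<alpha> I = d \<and>
     strict_mono_on {0..k} \<sigma> \<and> \<sigma> ` {0..k} \<subseteq> I}"

text \<open>A repeated index gives two equal columns and hence zero; otherwise sorting the indices
  costs only a sign.\<close>

lemma whitney_form_in_span:
  assumes \<sigma>: "\<sigma> ` {0..k} \<subseteq> I" and \<alpha>: "sum \<alpha> I = d"
  shows "whitney_form I k \<alpha> \<sigma> \<in> form_span (generators I d k)"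
proof (cases "inj_on \<sigma> {..k}")
  case False
  have "whitney_form I k \<alpha> \<sigma> = (\<lambda>p vs. 0)"
    unfolding whitney_form_def fun_eq_iff
    using bdet_not_inj[OF False, of "\<lambda>i. L i p" "\<lambda>i l. h l (vs ! i)" for p vs] by simp
  then show ?thesis
    by (simp add: form_span.zero)
next
  case True
  then obtain \<tau> p where \<tau>: "strict_mono_on {0..k} \<tau>" "\<tau> ` {0..k} = \<sigma> ` {..k}"
    and p: "p permutes {..<Suc k}" "\<And>j. j \<le> k \<Longrightarrow> \<sigma> j = \<tau> (p j)"
    using sorting_permutation by metis
  define \<alpha>' where "\<alpha>' = (\<lambda>i. if i \<in> I then \<alpha> i else 0)"
  have "bdet k (\<lambda>j. L (\<sigma> j) q) (\<lambda>i j. h (\<sigma> j) (vs ! i)) =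
      of_int (sign p) * bdet k (\<lambda>j. L (\<tau> j) q) (\<lambda>i j. h (\<tau> j) (vs ! i))" for q vs
    unfolding bdet_permute_columns[OF p(1), of "\<lambda>j. L (\<tau> j) q" "\<lambda>i j. h (\<tau> j) (vs ! i)", symmetric]
    by (rule bdet_cong) (simp_all add: p(2))
  then have "whitney_form I k \<alpha> \<sigma> = (\<lambda>q vs. of_int (sign p) * whitney_form I k \<alpha>' \<tau> q vs)"
    by (simp add: whitney_form_def fun_eq_iff \<alpha>'_def)
  moreover have "whitney_form I k \<alpha>' \<tau> \<in> generators I d k"
    unfolding generators_def
    by (intro CollectI exI[of _ \<alpha>'] exI[of _ \<tau>]) (use \<tau> \<sigma> \<alpha> in \<open>auto simp: \<alpha>'_def atLeast0AtMost\<close>)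
  ultimately show ?thesis
    by (simp add: form_span_cmult form_span_base)
qed

lemma whitney_form_upd_Suc:
  assumes "finite I" "i \<in> I"
  shows "whitney_form I k (\<alpha>(i := Suc (\<alpha> i))) \<sigma> p vs = L i p * whitney_form I k \<alpha> \<sigma> p vs"
proof -
  have "(\<Prod>l\<in>I. L l p ^ (\<alpha>(i := Suc (\<alpha> i))) l) = (\<Prod>l\<in>I. (if l = i then L i p else 1) * L l p ^ \<alpha> l)"
    by (rule prod.cong) auto
  also have "\<dots> = L i p * (\<Prod>l\<in>I. L l p ^ \<alpha> l)"
    using assms by (simp add: prod.distrib)
  finally show ?thesis
    by (simp add: whitney_form_def)
qed

text \<open>Coefficients are homogenised to degree exactly \<open>d\<close> in the barycentric coordinates by means of
  \<open>1 = (\<Sum>i\<in>I. L i)\<close> and \<open>q = (\<Sum>i\<in>I. L i q *\<^sub>R x i)\<close>.\<close>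

lemma poly_whitney_in_span:
  assumes I: "I \<subseteq> V" and \<sigma>: "\<sigma> ` {0..k} \<subseteq> I" and u: "poly_fun_on (int d) (F I) u"
  shows "(\<lambda>p vs. u p * whitney_form I k (\<lambda>_. 0) \<sigma> p vs) \<in> form_span (generators I d k)"
proof -
  \<comment> \<open>\<open>Q e u\<close> says that \<open>u\<close> supplies the degree
    \<open>d - e\<close> still missing when the monomial already has degree
    \<open>e\<close>.\<close>
  define Q where "Q e u \<longleftrightarrow> (\<forall>\<alpha>. sum \<alpha> I = e \<longrightarrow>
      (\<lambda>p vs. u p * whitney_form I k \<alpha> \<sigma> p vs) \<in> form_span (generators I d k))" for e u
  have fin: "finite I"
    using I finite_subset[OF _ finite_V] by blast
  have upd: "sum (\<alpha>(i := Suc (\<alpha> i))) I = Suc (sum \<alpha> I)" if "i \<in> I" for \<alpha> i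
  proof -
    have "sum (\<alpha>(i := Suc (\<alpha> i))) I = (\<Sum>l\<in>I. \<alpha> l + (if l = i then 1 else 0))"
      by (rule sum.cong) auto
    then show ?thesis
      using that fin by (simp add: sum.distrib)
  qed
  \<comment> \<open>A factor that is linear homogeneous in the coordinates is absorbed into the
    monomial, each \<open>L i\<close> raising the exponent at \<open>i\<close> by one.\<close>
  have comb: "Q e (\<lambda>p. v p * u p)" if Q: "Q (Suc e) u" and v: "\<And>p. p \<in> F I \<Longrightarrow> v p = (\<Sum>i\<in>I. L i p * c i)" for e u v c
    unfolding Q_def
  proof (intro allI impI)
    fix \<alpha> assume \<alpha>: "sum \<alpha> I = e"
    have "(\<lambda>p vs. v p * u p * whitney_form I k \<alpha> \<sigma> p vs) =
        (\<lambda>p vs. \<Sum>i\<in>I. c i * (u p * whitney_form I k (\<alpha>(i := Suc (\<alpha> i))) \<sigma> p vs))"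
    proof (intro ext)
      fix p vs
      show "v p * u p * whitney_form I k \<alpha> \<sigma> p vs =
          (\<Sum>i\<in>I. c i * (u p * whitney_form I k (\<alpha>(i := Suc (\<alpha> i))) \<sigma> p vs))"
      proof (cases "p \<in> F I")
        case True
        have "(\<Sum>i\<in>I. c i * (u p * whitney_form I k (\<alpha>(i := Suc (\<alpha> i))) \<sigma> p vs)) =
            (\<Sum>i\<in>I. (L i p * c i) * (u p * whitney_form I k \<alpha> \<sigma> p vs))"
          by (intro sum.cong refl) (simp add: whitney_form_upd_Suc[OF fin])
        then show ?thesis
          by (simp only: v[OF True] sum_distrib_right mult.assoc)
      qed (simp add: whitney_form_outside)
    qed
    also have "\<dots> \<in> form_span (generators I d k)"
      using Q upd \<alpha> unfolding Q_def by (intro form_span_sum form_span_cmult) auto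
    finally show "(\<lambda>p vs. v p * u p * whitney_form I k \<alpha> \<sigma> p vs) \<in> form_span (generators I d k)" .
  qed
  have coords: "p = (\<Sum>i\<in>I. L i p *\<^sub>R x i)" "(\<Sum>i\<in>I. L i p) = 1" if "p \<in> F I" for p
    using barycentric_sum_on[OF I] mem_F[OF I] that by blast+
  have mono: "Q e (monomial_at 0 \<beta>)" if "mdeg \<beta> = m" "m + e = d" for \<beta> m e
    using that
  proof (induction m arbitrary: \<beta> e)
    case 0
    then have "\<beta> = (\<lambda>_. 0)"
      by (simp add: mdeg_eq_0_iff)
    then show ?case
      using 0 whitney_form_in_span[OF \<sigma>, where d = d] by (simp add: Q_def)
  next
    case (Suc m)
    obtain j \<beta>' where \<beta>': "\<beta> = \<beta>'(j := Suc (\<beta>' j))" "mdeg \<beta>' = m"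
      using Suc.prems(1) by (rule mdeg_pos_obtain)
    have "p $ j = (\<Sum>i\<in>I. L i p * x i $ j)" if "p \<in> F I" for p
      using arg_cong[OF coords(1)[OF that], of "\<lambda>v. v $ j"] by simp
    then have "Q e (\<lambda>p. p $ j * monomial_at 0 \<beta>' p)"
      using Suc.prems(2) by (intro comb[of e "monomial_at 0 \<beta>'" "\<lambda>p. p $ j"] Suc.IH \<beta>') auto
    moreover have "monomial_at 0 \<beta> = (\<lambda>p. p $ j * monomial_at 0 \<beta>' p)"
      by (rule ext) (simp add: \<beta>' monomial_at_upd_Suc)
    ultimately show ?case
      by simp
  qed
  have pad: "Q 0 u" if "Q e u" for e u
    using that
  proof (induction e)
    case (Suc e)
    have "Q e (\<lambda>p. 1 * u p)"
      by (rule comb[OF Suc.prems, of "\<lambda>p. 1" "\<lambda>i. 1"]) (simp add: coords)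
    then show ?case
      using Suc.IH by simp
  qed
  obtain c where c: "\<And>q. q \<in> F I \<Longrightarrow> u q = (\<Sum>\<beta> | mdeg \<beta> \<le> d. c \<beta> * monomial_at 0 \<beta> q)"
    using u unfolding poly_fun_on_iff poly_at_def by auto
  have "(\<lambda>p vs. u p * whitney_form I k (\<lambda>_. 0) \<sigma> p vs) =
      (\<lambda>p vs. \<Sum>\<beta> | mdeg \<beta> \<le> d. c \<beta> * (monomial_at 0 \<beta> p * whitney_form I k (\<lambda>_. 0) \<sigma> p vs))"
  proof (intro ext)
    fix p vs
    show "u p * whitney_form I k (\<lambda>_. 0) \<sigma> p vs =
        (\<Sum>\<beta> | mdeg \<beta> \<le> d. c \<beta> * (monomial_at 0 \<beta> p * whitney_form I k (\<lambda>_. 0) \<sigma> p vs))"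
    proof (cases "p \<in> F I")
      case True
      show ?thesis
        by (simp only: c[OF True] sum_distrib_right mult.assoc)
    qed (simp add: whitney_form_outside)
  qed
  also have "\<dots> \<in> form_span (generators I d k)"
  proof (intro form_span_sum form_span_cmult)
    fix \<beta> :: "'n \<Rightarrow> nat" assume "\<beta> \<in> {\<beta>. mdeg \<beta> \<le> d}"
    then have "Q 0 (monomial_at 0 \<beta>)"
      by (intro pad[OF mono[OF refl, of _ "d - mdeg \<beta>"]]) simp
    then show "(\<lambda>p vs. monomial_at 0 \<beta> p * whitney_form I k (\<lambda>_. 0) \<sigma> p vs) \<in> form_span (generators I d k)"
      by (simp add: Q_def)
  qed
  finally show ?thesis .
qed

text \<open>In terms of the vectors \<open>x i - a\<close>, the radial vector \<open>p - a\<close>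
  has coefficients \<open>L i p\<close> and a tangent vector \<open>v\<close> has
  \<open>h i v\<close>. The determinants in the expansion of \<beta> at \<open>(p - a) # vs\<close>
  are therefore bordered ones, that is, Whitney forms.\<close>

lemma koszul_in_span:
  assumes I: "I \<subseteq> V" "I \<noteq> {}" and \<beta>: "\<beta> \<in> poly_forms (int d) (Suc k) (F I)" and a: "a \<in> affine hull (F I)"
  shows "koszul a \<beta> \<in> form_span (generators I d k)"
proof -
  have fin: "finite I"
    using I(1) finite_subset[OF _ finite_V] by blast
  have f: "is_form (Suc k) (F I) \<beta>"
    using \<beta> by (rule poly_forms_is_form)
  define y where "y i = x i - a" for i
  have y: "y i \<in> tangent (F I)" if "i \<in> I" for i
    unfolding y_def by (rule tangent_diff[OF _ a]) (simp add: hull_inc vertex_in_F that)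
  \<comment> \<open>The factor comes from \<open>alternating_on_expand_detf\<close>; the zero
    summand gives the shape that \<open>poly_fun_on_lincomb\<close> expects.\<close>
  define c where "c is p = 1 / fact (Suc k) * \<beta> p (map y is) + 0 * \<beta> p (map y is)" for "is" p
  let ?A = "{is. set is \<subseteq> I \<and> length is = Suc k}"
  have "koszul a \<beta> p vs = (\<Sum>is\<in>?A. c is p * whitney_form I k (\<lambda>_. 0) (\<lambda>j. is ! j) p vs)" for p vs
  proof (cases "p \<in> F I \<and> length vs = k \<and> set vs \<subseteq> tangent (F I)")
    case True
    have u: "((p - a) # vs) ! j = (\<Sum>i\<in>I. (case j of 0 \<Rightarrow> L i p | Suc j \<Rightarrow> h i (vs ! j)) *\<^sub>R y i)"
      if "j < Suc k" for j
    proof (cases j)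
      case 0
      have "p = (\<Sum>i\<in>I. L i p *\<^sub>R x i)" "(\<Sum>i\<in>I. L i p) = 1"
        using barycentric_sum_on[OF I(1)] mem_F[OF I(1)] True by blast+
      then show ?thesis
        by (simp add: 0 y_def scaleR_diff_right sum_subtractf flip: scaleR_left.sum)
    next
      case (Suc j')
      then have "vs ! j' \<in> tangent (F I)"
        using True that by auto
      then have "vs ! j' = (\<Sum>i\<in>I. h i (vs ! j') *\<^sub>R x i)" "(\<Sum>i\<in>I. h i (vs ! j')) = 0"
        using tangent_sum_on[OF I(1)] mem_tangent_F[OF I] by blast+
      then show ?thesis
        by (simp add: Suc y_def scaleR_diff_right sum_subtractf flip: scaleR_left.sum)
    qed
    have g: "alternating_on (Suc k) (tangent (F I)) (\<beta> p)"
      using f True unfolding is_form_alternating_on by blast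
    have "fact (Suc k) * \<beta> p ((p - a) # vs) = (\<Sum>is\<in>?A. \<beta> p (map y is) *
        detf (Suc k) (\<lambda>j l. case j of 0 \<Rightarrow> L (is ! l) p | Suc j \<Rightarrow> h (is ! l) (vs ! j)))"
      using True by (intro alternating_on_expand_detf[OF g subspace_tangent_F[OF I] fin y _ u]) auto
    also have "\<dots> = (\<Sum>is\<in>?A. \<beta> p (map y is) * whitney_form I k (\<lambda>_. 0) (\<lambda>j. is ! j) p vs)"
    proof (intro sum.cong refl arg_cong2[where f = "(*)"])
      fix "is"
      have "detf (Suc k) (\<lambda>j l. case j of 0 \<Rightarrow> L (is ! l) p | Suc j \<Rightarrow> h (is ! l) (vs ! j)) =
          bdet k (\<lambda>j. L (is ! j) p) (\<lambda>i j. h (is ! j) (vs ! i))"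
        unfolding bdet_def by (rule detf_cong) (simp split: nat.split)
      then show "detf (Suc k) (\<lambda>j l. case j of 0 \<Rightarrow> L (is ! l) p | Suc j \<Rightarrow> h (is ! l) (vs ! j)) =
          whitney_form I k (\<lambda>_. 0) (\<lambda>j. is ! j) p vs"
        using True by (simp add: whitney_form_def)
    qed
    finally have eq: "fact (Suc k) * koszul a \<beta> p vs =
        (\<Sum>is\<in>?A. \<beta> p (map y is) * whitney_form I k (\<lambda>_. 0) (\<lambda>j. is ! j) p vs)"
      by (simp only: koszul_def)
    have "koszul a \<beta> p vs = 1 / fact (Suc k) * (fact (Suc k) * koszul a \<beta> p vs)"
      by simp
    then show ?thesis
      unfolding eq sum_distrib_left c_def mult_zero_left add_0_right mult.assoc .
  next
    case False
    have "koszul a \<beta> p vs = 0"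
      by (rule is_form_eq_0[OF is_form_koszul[OF f a] False])
    moreover have "whitney_form I k (\<lambda>_. 0) (\<lambda>j. is ! j) p vs = 0" for "is"
      unfolding whitney_form_def using False by (simp only: if_False)
    ultimately show ?thesis
      by simp
  qed
  then have "koszul a \<beta> = (\<lambda>p vs. \<Sum>is\<in>?A. c is p * whitney_form I k (\<lambda>_. 0) (\<lambda>j. is ! j) p vs)"
    by (intro ext)
  also have "\<dots> \<in> form_span (generators I d k)"
  proof (intro form_span_sum poly_whitney_in_span[OF I(1)])
    fix "is" assume "is": "is \<in> ?A"
    then show "(\<lambda>j. is ! j) ` {0..k} \<subseteq> I"
      by (auto simp: subset_iff)
    have "set (map y is) \<subseteq> tangent (F I)"
      using "is" y by auto
    then show "poly_fun_on (int d) (F I) (c is)"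
      using \<beta> "is" unfolding c_def by (intro poly_fun_on_lincomb) (auto simp: poly_forms_def)
  qed
  finally show ?thesis .
qed

text \<open>Bordering by a row and a column, and summing over the vertex \<open>i\<close> of the new column, leaves
  only the cofactor of the corner since \<open>(\<Sum>i\<in>I. L i p) = 1\<close> and \<open>(\<Sum>i\<in>I. h i v) = 0\<close>.\<close>

lemma sum_whitney_form_Cons:
  assumes I: "I \<subseteq> V" "I \<noteq> {}" and p: "p \<in> F I" "length vs = k" "set vs \<subseteq> tangent (F I)"
  shows "(\<Sum>i\<in>I. whitney_form I k (\<lambda>_. 0) (\<lambda>j. (i # is) ! j) p vs) = detf k (\<lambda>j l. h (is ! l) (vs ! j))"
proof -
  define C where "C r i = (case r of 0 \<Rightarrow> L i p | Suc j \<Rightarrow> h i (vs ! j))" for r i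
  define M where "M r = detf k (\<lambda>i' j'. C (if i' < r then i' else Suc i') (is ! j'))" for r
  have "whitney_form I k (\<lambda>_. 0) (\<lambda>j. (i # is) ! j) p vs = (\<Sum>r<Suc k. (-1) ^ r * C r i * M r)" for i
  proof -
    have "whitney_form I k (\<lambda>_. 0) (\<lambda>j. (i # is) ! j) p vs = detf (Suc k) (\<lambda>r l. C r ((i # is) ! l))"
      using p unfolding whitney_form_def bdet_def C_def
      by (simp, intro detf_cong) (auto split: nat.split)
    then show ?thesis
      by (simp add: detf_first_column_expansion M_def)
  qed
  then have "(\<Sum>i\<in>I. whitney_form I k (\<lambda>_. 0) (\<lambda>j. (i # is) ! j) p vs) =
      (\<Sum>r<Suc k. \<Sum>i\<in>I. (-1) ^ r * C r i * M r)"
    by (simp only:) (rule sum.swap)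
  also have "\<dots> = (\<Sum>r<Suc k. (-1) ^ r * (\<Sum>i\<in>I. C r i) * M r)"
    by (simp only: sum_distrib_left sum_distrib_right)
  also have "\<dots> = (\<Sum>r<Suc k. if r = 0 then M 0 else 0)"
  proof (intro sum.cong refl)
    fix r assume r: "r \<in> {..<Suc k}"
    have "(\<Sum>i\<in>I. C r i) = (if r = 0 then 1 else 0)"
    proof (cases r)
      case 0
      then show ?thesis
        using barycentric_sum_on(2)[OF I(1)] mem_F[OF I(1)] p by (simp add: C_def)
    next
      case (Suc j)
      then have "vs ! j \<in> tangent (F I)"
        using p r by auto
      then show ?thesis
        using tangent_sum_on(2)[OF I(1)] mem_tangent_F[OF I] by (simp add: C_def Suc)
    qed
    then show "(-1) ^ r * (\<Sum>i\<in>I. C r i) * M r = (if r = 0 then M 0 else 0)"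
      by simp
  qed
  also have "\<dots> = M 0"
    by simp
  also have "\<dots> = detf k (\<lambda>j l. h (is ! l) (vs ! j))"
    by (simp add: M_def C_def)
  finally show ?thesis .
qed

text \<open>Here the expansion has no radial argument and yields wedge products of differentials.
  Each of these is the sum of the Whitney forms with one further index placed in front.\<close>

lemma poly_form_in_span:
  assumes I: "I \<subseteq> V" "I \<noteq> {}" and \<beta>: "\<beta> \<in> poly_forms (int d) k (F I)"
  shows "\<beta> \<in> form_span (generators I d k)"
proof -
  have fin: "finite I"
    using I(1) finite_subset[OF _ finite_V] by blast
  have f: "is_form k (F I) \<beta>"
    using \<beta> by (rule poly_forms_is_form)
  obtain b where b: "b \<in> I"
    using I by blast
  define y where "y i = x i - x b" for i
  have y: "y i \<in> tangent (F I)" if "i \<in> I" for i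
    unfolding y_def by (rule tangent_diff) (simp_all add: hull_inc vertex_in_F that b)
  define c where "c is p = 1 / fact k * \<beta> p (map y is) + 0 * \<beta> p (map y is)" for "is" p
  let ?A = "{is. set is \<subseteq> I \<and> length is = k}"
  have "\<beta> p vs = (\<Sum>is\<in>?A. \<Sum>i\<in>I. c is p * whitney_form I k (\<lambda>_. 0) (\<lambda>j. (i # is) ! j) p vs)" for p vs
  proof (cases "p \<in> F I \<and> length vs = k \<and> set vs \<subseteq> tangent (F I)")
    case True
    have u: "vs ! j = (\<Sum>i\<in>I. h i (vs ! j) *\<^sub>R y i)" if "j < k" for j
    proof -
      have "vs ! j \<in> tangent (F I)"
        using True that by auto
      then have "vs ! j = (\<Sum>i\<in>I. h i (vs ! j) *\<^sub>R x i)" "(\<Sum>i\<in>I. h i (vs ! j)) = 0"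
        using tangent_sum_on[OF I(1)] mem_tangent_F[OF I] by blast+
      then show ?thesis
        by (simp add: y_def scaleR_diff_right sum_subtractf flip: scaleR_left.sum)
    qed
    have g: "alternating_on k (tangent (F I)) (\<beta> p)"
      using f True unfolding is_form_alternating_on by blast
    have eq: "fact k * \<beta> p vs = (\<Sum>is\<in>?A. \<beta> p (map y is) * detf k (\<lambda>j l. h (is ! l) (vs ! j)))"
      using True by (intro alternating_on_expand_detf[OF g subspace_tangent_F[OF I] fin y _ u]) auto
    have "\<beta> p vs = 1 / fact k * (fact k * \<beta> p vs)"
      by simp
    also have "\<dots> = (\<Sum>is\<in>?A. c is p * detf k (\<lambda>j l. h (is ! l) (vs ! j)))"
      unfolding eq sum_distrib_left c_def mult_zero_left add_0_right mult.assoc ..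
    also have "\<dots> = (\<Sum>is\<in>?A. \<Sum>i\<in>I. c is p * whitney_form I k (\<lambda>_. 0) (\<lambda>j. (i # is) ! j) p vs)"
      using True by (simp only: sum_distrib_left[symmetric] sum_whitney_form_Cons[OF I])
    finally show ?thesis .
  next
    case False
    have "\<beta> p vs = 0"
      by (rule is_form_eq_0[OF f False])
    moreover have "whitney_form I k (\<lambda>_. 0) (\<lambda>j. (i # is) ! j) p vs = 0" for i "is"
      unfolding whitney_form_def using False by (simp only: if_False)
    ultimately show ?thesis
      by simp
  qed
  then have "\<beta> = (\<lambda>p vs. \<Sum>is\<in>?A. \<Sum>i\<in>I. c is p * whitney_form I k (\<lambda>_. 0) (\<lambda>j. (i # is) ! j) p vs)"
    by (intro ext)
  also have "\<dots> \<in> form_span (generators I d k)"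
  proof (intro form_span_sum poly_whitney_in_span[OF I(1)])
    fix "is" i assume "is": "is \<in> ?A" "i \<in> I"
    then have "set (i # is) \<subseteq> I" "length (i # is) = Suc k"
      by auto
    then show "(\<lambda>j. (i # is) ! j) ` {0..k} \<subseteq> I"
      by (metis (no_types, lifting) atLeastAtMost_iff image_subsetI less_Suc_eq_le nth_mem subsetD)
    have "set (map y is) \<subseteq> tangent (F I)"
      using "is" y by auto
    then show "poly_fun_on (int d) (F I) (c is)"
      using \<beta> "is" unfolding c_def by (intro poly_fun_on_lincomb) (auto simp: poly_forms_def)
  qed
  finally show ?thesis .
qed

theorem trimmed_in_span:
  assumes I: "I \<subseteq> V" "I \<noteq> {}" and \<omega>: "\<omega> \<in> trimmed_forms (Suc d) k (F I)"
  shows "\<omega> \<in> form_span (generators I d k)"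
proof -
  have "F I \<noteq> {}"
    using I vertex_in_F by blast
  with \<omega> obtain a \<alpha> \<beta> where "a \<in> affine hull (F I)" "\<alpha> \<in> poly_forms (int d) k (F I)"
    "\<beta> \<in> poly_forms (int d) (Suc k) (F I)" "\<omega> = (\<lambda>p vs. \<alpha> p vs + koszul a \<beta> p vs)"
    by (rule trimmed_formsE)
  then show ?thesis
    by (simp add: form_span_add poly_form_in_span[OF I] koszul_in_span[OF I])
qed

section \<open>The barycentric extension and forms vanishing on the opposite face\<close>

definition weight :: "nat set \<Rightarrow> real^'n \<Rightarrow> real" where
  "weight I q = (\<Sum>i\<in>I. L i q)"

text \<open>The projection from the opposite face. Where the weight is 0 the quotient has the
  default value 0, and the uses below exclude that case.\<close>

definition proj :: "nat set \<Rightarrow> real^'n \<Rightarrow> real^'n" where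
  "proj I q = (\<Sum>i\<in>I. (L i q / weight I q) *\<^sub>R x i)"

text \<open>The derivative of \<open>proj I\<close> at \<open>q\<close>, by the quotient rule.\<close>

definition dproj :: "nat set \<Rightarrow> real^'n \<Rightarrow> real^'n \<Rightarrow> real^'n" where
  "dproj I q v = (\<Sum>i\<in>I. (h i v / weight I q - L i q * (\<Sum>j\<in>I. h j v) / (weight I q)\<^sup>2) *\<^sub>R x i)"

text \<open>A closed formula for the extension operator: the pullback along the projection from the opposite
  face, rescaled to be homogeneous of degree \<open>Suc d + k\<close> in the coordinates belonging to \<open>I\<close>.\<close>

definition ext_form :: "nat set \<Rightarrow> nat \<Rightarrow> nat \<Rightarrow> 'n form \<Rightarrow> 'n form" where
  "ext_form I d k \<mu> = (\<lambda>q vs. if q \<in> F V \<and> length vs = k \<and> weight I q \<noteq> 0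
     then weight I q ^ (Suc d + k) * \<mu> (proj I q) (map (dproj I q) vs) else 0)"

lemma weight_nonneg:
  assumes "I \<subseteq> V" "q \<in> F V"
  shows "0 \<le> weight I q"
  unfolding weight_def using assms mem_F[of V q] by (intro sum_nonneg) auto

lemma weight_eq_0D:
  assumes "I \<subseteq> V" "q \<in> F V" "weight I q = 0" "i \<in> I"
  shows "L i q = 0"
proof -
  have "\<forall>i\<in>I. 0 \<le> L i q"
    using assms(1,2) mem_F[of V q] by auto
  then show ?thesis
    using assms(3,4) finite_subset[OF assms(1) finite_V] by (simp add: weight_def sum_nonneg_eq_0_iff)
qed

lemma L_proj:
  assumes "I \<subseteq> V" "weight I q \<noteq> 0" "j \<in> V"
  shows "L j (proj I q) = (if j \<in> I then L j q / weight I q else 0)"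
  unfolding proj_def using assms(2)
  by (intro L_vertex_sum assms) (simp add: weight_def flip: sum_divide_distrib)

lemma h_dproj:
  assumes "I \<subseteq> V" "weight I q \<noteq> 0" "j \<in> V"
  shows "h j (dproj I q v) = (if j \<in> I then h j v / weight I q - L j q * (\<Sum>j\<in>I. h j v) / (weight I q)\<^sup>2 else 0)"
proof -
  have "(\<Sum>i\<in>I. h i v / weight I q - L i q * (\<Sum>j\<in>I. h j v) / (weight I q)\<^sup>2) =
      (\<Sum>i\<in>I. h i v) / weight I q - weight I q * (\<Sum>j\<in>I. h j v) / (weight I q)\<^sup>2"
    unfolding weight_def by (simp add: sum_subtractf sum_divide_distrib sum_distrib_right)
  also have "\<dots> = 0"
    using assms(2) by (simp add: power2_eq_square)
  finally show ?thesis
    unfolding dproj_def using assms by (intro h_vertex_sum) auto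
qed

lemma proj_in_F:
  assumes "I \<subseteq> V" "q \<in> F V" "weight I q \<noteq> 0"
  shows "proj I q \<in> F I"
  using assms weight_nonneg[OF assms(1,2)] mem_F[of V q] by (auto simp: mem_F L_proj subset_iff)

lemma dproj_in_tangent:
  assumes "I \<subseteq> V" "I \<noteq> {}" "weight I q \<noteq> 0"
  shows "dproj I q v \<in> tangent (F I)"
  using assms by (simp add: mem_tangent_F h_dproj)

text \<open>The powers of 1/s cancel: \<open>d\<close> from the monomial, one from the top row and
  \<open>k\<close> from the lower rows, against \<open>Suc d + k\<close> in
  \<open>ext_form\<close>.\<close>

lemma ext_form_whitney_form:
  assumes I: "I \<subseteq> V" "I \<noteq> {}" and \<sigma>: "\<sigma> ` {0..k} \<subseteq> I"
    and \<alpha>: "\<And>i. i \<notin> I \<Longrightarrow> \<alpha> i = 0" "sum \<alpha> I = d"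
  shows "ext_form I d k (whitney_form I k \<alpha> \<sigma>) = whitney_form V k \<alpha> \<sigma>"
proof (intro ext)
  fix q vs
  have \<sigma>I: "\<sigma> j \<in> I" "\<sigma> j \<in> V" if "j \<le> k" for j
  proof -
    have "\<sigma> j \<in> \<sigma> ` {0..k}"
      using that by auto
    then show "\<sigma> j \<in> I" "\<sigma> j \<in> V"
      using \<sigma> I(1) by blast+
  qed
  have prod: "(\<Prod>i\<in>V. L i q ^ \<alpha> i) = (\<Prod>i\<in>I. L i q ^ \<alpha> i)"
    by (rule prod.mono_neutral_right) (use I \<alpha>(1) in auto)
  show "ext_form I d k (whitney_form I k \<alpha> \<sigma>) q vs = whitney_form V k \<alpha> \<sigma> q vs"
  proof (cases "q \<in> F V \<and> length vs = k")
    case True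
    then have q: "q \<in> F V" and len: "length vs = k"
      by auto
    define s where "s = weight I q"
    define B where "B = bdet k (\<lambda>j. L (\<sigma> j) q) (\<lambda>i j. h (\<sigma> j) (vs ! i))"
    have rhs: "whitney_form V k \<alpha> \<sigma> q vs = (\<Prod>i\<in>I. L i q ^ \<alpha> i) * B"
      using True by (simp add: whitney_form_def tangent_simplex prod B_def)
    show ?thesis
    proof (cases "s = 0")
      case True
      \<comment> \<open>On the opposite face the whole top row vanishes, in agreement with the
        default value of \<open>ext_form\<close>.\<close>
      then have "L (\<sigma> j) q = 0" if "j \<le> k" for j
        using weight_eq_0D[OF I(1) q] \<sigma>I(1)[OF that] by (simp add: s_def)
      then have "B = 0"
        by (simp add: B_def bdet_expansion)
      then show ?thesis
        using True by (simp add: rhs ext_form_def s_def)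
    next
      case False
      then have w: "weight I q \<noteq> 0"
        by (simp add: s_def)
      have "(\<Prod>i\<in>I. L i (proj I q) ^ \<alpha> i) = (\<Prod>i\<in>I. L i q ^ \<alpha> i / s ^ \<alpha> i)"
        using I(1) by (intro prod.cong refl) (auto simp: L_proj[OF I(1) w] s_def power_divide)
      also have "\<dots> = (\<Prod>i\<in>I. L i q ^ \<alpha> i) / s ^ d"
        by (simp add: prod_dividef flip: \<alpha>(2) power_sum)
      finally have prod: "(\<Prod>i\<in>I. L i (proj I q) ^ \<alpha> i) = (\<Prod>i\<in>I. L i q ^ \<alpha> i) / s ^ d" .
      \<comment> \<open>The top row at the projected point, with a zero term so that
        \<open>bdet_top_linear\<close> applies. The second term of the quotient rule is a multiple
        of this row, hence a row operation.\<close>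
      let ?c = "\<lambda>j. 1 / s * L (\<sigma> j) q + 0 * L (\<sigma> j) q"
      have "bdet k (\<lambda>j. L (\<sigma> j) (proj I q)) (\<lambda>i j. h (\<sigma> j) (map (dproj I q) vs ! i)) =
          bdet k ?c (\<lambda>i j. 1 / s * h (\<sigma> j) (vs ! i) + (- (\<Sum>l\<in>I. h l (vs ! i)) / s) * ?c j)"
        using len False
        by (intro bdet_cong)
           (simp_all add: L_proj[OF I(1) w] h_dproj[OF I(1) w] \<sigma>I power2_eq_square mult.commute flip: s_def)
      also have "\<dots> = (1 / s) ^ k * (1 / s * B + 0 * B)"
        unfolding bdet_row_operations bdet_top_linear B_def ..
      finally have bdet: "bdet k (\<lambda>j. L (\<sigma> j) (proj I q)) (\<lambda>i j. h (\<sigma> j) (map (dproj I q) vs ! i)) =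
          B / (s ^ k * s)"
        by (simp add: power_divide)
      have "whitney_form I k \<alpha> \<sigma> (proj I q) (map (dproj I q) vs) =
          (\<Prod>i\<in>I. L i q ^ \<alpha> i) / s ^ d * (B / (s ^ k * s))"
        using proj_in_F[OF I(1) q w] dproj_in_tangent[OF I w] len
        by (simp add: whitney_form_def prod bdet image_subset_iff)
      then have "ext_form I d k (whitney_form I k \<alpha> \<sigma>) q vs =
          s ^ (Suc d + k) * ((\<Prod>i\<in>I. L i q ^ \<alpha> i) / s ^ d * (B / (s ^ k * s)))"
        using q len w by (simp add: ext_form_def s_def)
      also have "\<dots> = (\<Prod>i\<in>I. L i q ^ \<alpha> i) * B"
        using False by (simp add: power_add)
      finally show ?thesis
        by (simp only: rhs)
    qed
  next
    case False
    then show ?thesis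
      by (auto simp: ext_form_def whitney_form_def)
  qed
qed

lemma ext_form_lincomb:
  "ext_form I d k (\<lambda>p vs. a * \<mu> p vs + b * \<nu> p vs) = (\<lambda>p vs. a * ext_form I d k \<mu> p vs + b * ext_form I d k \<nu> p vs)"
  by (simp add: ext_form_def fun_eq_iff distrib_left mult.left_commute)

text \<open>On the face the weight is 1, the projection fixes the point, and its derivative fixes
  the tangent vectors.\<close>

lemma tr_ext_form:
  assumes I: "I \<subseteq> V" "I \<noteq> {}" and \<mu>: "is_form k (F I) \<mu>"
  shows "tr (F I) (ext_form I d k \<mu>) = \<mu>"
proof (intro ext)
  fix p vs
  show "tr (F I) (ext_form I d k \<mu>) p vs = \<mu> p vs"
  proof (cases "p \<in> F I \<and> length vs = k \<and> set vs \<subseteq> tangent (F I)")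
    case True
    then have p: "p = (\<Sum>j\<in>I. L j p *\<^sub>R x j)" "(\<Sum>j\<in>I. L j p) = 1"
      using barycentric_sum_on[OF I(1)] mem_F[OF I(1)] by blast+
    then have w: "weight I p = 1"
      by (simp add: weight_def)
    have "dproj I p v = v" if "v \<in> set vs" for v
    proof -
      have "\<forall>j\<in>V - I. h j v = 0"
        using True that mem_tangent_F[OF I] by blast
      from tangent_sum_on[OF I(1) this] show ?thesis
        by (simp add: dproj_def w)
    qed
    then have "map (dproj I p) vs = vs"
      by (rule map_idI)
    moreover have "proj I p = p"
      using p(1) by (simp add: proj_def w)
    ultimately show ?thesis
      using True F_mono[OF I(1)] w by (auto simp: tr_def ext_form_def)
  next
    case False
    then have "\<mu> p vs = 0"
      by (rule is_form_eq_0[OF \<mu>])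
    with False show ?thesis
      by (auto simp: tr_def ext_form_def)
  qed
qed

section \<open>Homogeneity about the opposite face\<close>

text \<open>A derivative-free condition that implies vanishing to order \<open>r\<close> and is
  evidently closed under linear combinations, hence suited to induction over the span.\<close>

definition homogeneous_on :: "nat \<Rightarrow> nat \<Rightarrow> 'n form \<Rightarrow> (real^'n) set \<Rightarrow> bool" where
  "homogeneous_on r k \<omega> X \<longleftrightarrow> (\<forall>p\<in>X. \<forall>vs. length vs = k \<longrightarrow>
     (\<exists>U. poly_at p {\<alpha>. mdeg \<alpha> = r} U \<and> (\<forall>q\<in>F V. \<omega> q vs = U q)))"

lemma homogeneous_on_lincomb:
  assumes "homogeneous_on r k \<omega> X" "homogeneous_on r k \<eta> X"
  shows "homogeneous_on r k (\<lambda>p vs. a * \<omega> p vs + b * \<eta> p vs) X"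
  unfolding homogeneous_on_def
proof (intro ballI allI impI)
  fix p and vs :: "(real^'n) list" assume *: "p \<in> X" "length vs = k"
  obtain U where "poly_at p {\<alpha>. mdeg \<alpha> = r} U" "\<forall>q\<in>F V. \<omega> q vs = U q"
    using assms(1) * unfolding homogeneous_on_def by blast
  moreover obtain U' where "poly_at p {\<alpha>. mdeg \<alpha> = r} U'" "\<forall>q\<in>F V. \<eta> q vs = U' q"
    using assms(2) * unfolding homogeneous_on_def by blast
  ultimately show "\<exists>U. poly_at p {\<alpha>. mdeg \<alpha> = r} U \<and> (\<forall>q\<in>F V. a * \<omega> q vs + b * \<eta> q vs = U q)"
    by (intro exI[of _ "\<lambda>q. a * U q + b * U' q"]) (simp add: poly_at_lincomb)
qed

lemma homogeneous_on_vanishes: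
  assumes "homogeneous_on r k \<omega> X" "X \<subseteq> F V"
  shows "form_vanishes_on (F V) k r \<omega> X"
  unfolding form_vanishes_on_def
proof (intro ballI allI impI)
  fix p and vs :: "(real^'n) list" assume *: "p \<in> X" "length vs = k"
  then obtain U where "poly_at p {\<alpha>. mdeg \<alpha> = r} U" "\<forall>q\<in>F V. \<omega> q vs = U q"
    using assms(1) unfolding homogeneous_on_def by blast
  then show "fun_vanishes (F V) r (\<lambda>q. \<omega> q vs) p"
    using assms(2) * by (intro fun_vanishes_homogeneous[OF solid_simplex]) auto
qed

lemma poly_at_h_power:
  assumes "i \<in> V" "poly_at p {\<alpha>. mdeg \<alpha> = e} u"
  shows "poly_at p {\<alpha>. mdeg \<alpha> = m + e} (\<lambda>q. h i (q - p) ^ m * u q)"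
proof (induction m)
  case (Suc m)
  then show ?case
    using poly_at_linear_mult[OF linear_h[OF assms(1)] Suc] by (simp add: mult.assoc)
qed (use assms in simp)

lemma poly_at_h_prod:
  assumes "finite A" "A \<subseteq> V"
  shows "poly_at p {\<beta>. mdeg \<beta> = sum \<alpha> A} (\<lambda>q. \<Prod>i\<in>A. h i (q - p) ^ \<alpha> i)"
  using assms
proof induction
  case empty
  show ?case
    using poly_at_const(1)[of p 1] by simp
next
  case (insert i A)
  then show ?case
    using poly_at_h_power[of i p "sum \<alpha> A" "\<lambda>q. \<Prod>i\<in>A. h i (q - p) ^ \<alpha> i" "\<alpha> i"] by simp
qed

text \<open>At a point \<open>p\<close> of the opposite face the coordinates with index in
  \<open>I\<close> are zero, so \<open>L i q = h i (q - p)\<close> for \<open>i \<in> I\<close>. The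
  monomial gives \<open>d\<close> such factors and the top row one more; the lower rows do not
  depend on \<open>q\<close>.\<close>

lemma whitney_form_homogeneous:
  assumes I: "I \<subseteq> V" and \<sigma>: "\<sigma> ` {0..k} \<subseteq> I" and \<alpha>: "\<And>i. i \<notin> I \<Longrightarrow> \<alpha> i = 0" "sum \<alpha> I = d"
  shows "homogeneous_on (Suc d) k (whitney_form V k \<alpha> \<sigma>) (F (V - I))"
  unfolding homogeneous_on_def
proof (intro ballI allI impI)
  fix p and vs :: "(real^'n) list" assume p: "p \<in> F (V - I)" and len: "length vs = k"
  have Lp: "L i q = h i (q - p)" if "i \<in> I" for i q
  proof -
    have "L i p = 0" "i \<in> V"
      using mem_F[of "V - I" p] p that I by auto
    then show ?thesis
      using L_diff[of i q p] by simp
  qed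
  have \<sigma>I: "\<sigma> j \<in> I" if "j \<le> k" for j
    using \<sigma> that by auto
  define C where "C j = (-1) ^ j * detf k (\<lambda>i' j'. h (\<sigma> (if j' < j then j' else Suc j')) (vs ! i'))" for j
  define P where "P = (\<lambda>q. \<Prod>i\<in>I. h i (q - p) ^ \<alpha> i)"
  define U where "U = (\<lambda>q. \<Sum>j\<le>k. C j * (h (\<sigma> j) (q - p) * P q))"
  have P: "poly_at p {\<beta>. mdeg \<beta> = d} P"
    unfolding P_def \<alpha>(2)[symmetric] by (rule poly_at_h_prod[OF finite_subset[OF I finite_V] I])
  have "poly_at p {\<beta>. mdeg \<beta> = Suc d} U"
    unfolding U_def using \<sigma>I I
    by (intro poly_at_sum poly_at_cmult poly_at_linear_mult P linear_h) auto
  moreover have "whitney_form V k \<alpha> \<sigma> q vs = U q" if q: "q \<in> F V" for q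
  proof -
    have "(\<Prod>i\<in>V. L i q ^ \<alpha> i) = (\<Prod>i\<in>I. L i q ^ \<alpha> i)"
      by (rule prod.mono_neutral_right) (use I \<alpha>(1) in auto)
    also have "\<dots> = P q"
      unfolding P_def by (intro prod.cong refl) (simp add: Lp)
    finally have "whitney_form V k \<alpha> \<sigma> q vs = P q * bdet k (\<lambda>j. L (\<sigma> j) q) (\<lambda>i j. h (\<sigma> j) (vs ! i))"
      using q len by (simp add: whitney_form_def tangent_simplex)
    also have "\<dots> = U q"
      unfolding bdet_expansion U_def sum_distrib_left
      by (intro sum.cong refl) (simp add: C_def Lp \<sigma>I)
    finally show ?thesis .
  qed
  ultimately show "\<exists>U. poly_at p {\<alpha>. mdeg \<alpha> = Suc d} U \<and> (\<forall>q\<in>F V. whitney_form V k \<alpha> \<sigma> q vs = U q)"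
    by blast
qed

lemma generatorE:
  assumes "g \<in> generators I d k"
  obtains \<alpha> \<sigma> where "g = whitney_form I k \<alpha> \<sigma>" "\<forall>i. i \<notin> I \<longrightarrow> \<alpha> i = 0" "sum \<alpha> I = d"
    "strict_mono_on {0..k} \<sigma>" "\<sigma> ` {0..k} \<subseteq> I"
  using assms unfolding generators_def by blast

lemma ext_form_trimmed_homogeneous:
  assumes I: "I \<subseteq> V" "I \<noteq> {}" and \<mu>: "\<mu> \<in> trimmed_forms (Suc d) k (F I)"
  shows "ext_form I d k \<mu> \<in> trimmed_forms (Suc d) k (F V) \<and>
    homogeneous_on (Suc d) k (ext_form I d k \<mu>) (F (V - I))"
  using trimmed_in_span[OF I \<mu>]
proof induction
  case zero
  have "F V \<noteq> {}"
    using I vertex_in_F by blast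
  moreover have "ext_form I d k (\<lambda>p vs. 0) = (\<lambda>p vs. 0)"
    by (simp add: ext_form_def fun_eq_iff)
  moreover have "homogeneous_on (Suc d) k (\<lambda>p vs. 0) (F (V - I))"
    unfolding homogeneous_on_def by (intro ballI allI impI exI[of _ "\<lambda>q. 0"]) (simp add: poly_at_0)
  ultimately show ?case
    by (simp add: zero_trimmed)
next
  case (step g \<mu> c)
  obtain \<alpha> \<sigma> where g: "g = whitney_form I k \<alpha> \<sigma>" "\<forall>i. i \<notin> I \<longrightarrow> \<alpha> i = 0" "sum \<alpha> I = d"
    "strict_mono_on {0..k} \<sigma>" "\<sigma> ` {0..k} \<subseteq> I"
    using step(1) by (rule generatorE)
  have eg: "ext_form I d k g = whitney_form V k \<alpha> \<sigma>"
    unfolding g(1) using I g by (intro ext_form_whitney_form) auto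
  have "sum \<alpha> V = d"
    using sum.mono_neutral_right[OF finite_V I(1), of \<alpha>] g by simp
  then have "ext_form I d k g \<in> trimmed_forms (Suc d) k (F V)"
    unfolding eg using g(5) I(1) by (intro whitney_form_trimmed) auto
  moreover have "homogeneous_on (Suc d) k (ext_form I d k g) (F (V - I))"
    unfolding eg using g I(1) by (intro whitney_form_homogeneous) auto
  ultimately show ?case
    using step(3) trimmed_forms_lincomb[of "ext_form I d k g" d k "F V" "ext_form I d k \<mu>" c 1]
      homogeneous_on_lincomb[of "Suc d" k "ext_form I d k g" "F (V - I)" "ext_form I d k \<mu>" c 1]
      ext_form_lincomb[of I d k c g 1 \<mu>] by simp
qed

section \<open>Traces, and forms annihilated by radial vectors\<close>

lemma tr_poly_forms:
  assumes I: "I \<subseteq> V" "I \<noteq> {}" and \<omega>: "\<omega> \<in> poly_forms r k (F V)"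
  shows "tr (F I) \<omega> \<in> poly_forms r k (F I)"
proof (rule poly_formsI)
  have f: "is_form k (F V) \<omega>"
    using \<omega> by (rule poly_forms_is_form)
  show "is_form k (F I) (tr (F I) \<omega>)"
    unfolding is_form_alternating_on
  proof (intro conjI allI impI ballI)
    fix p vs assume "\<not> (p \<in> F I \<and> length vs = k \<and> set vs \<subseteq> tangent (F I))"
    then show "tr (F I) \<omega> p vs = 0"
      using is_form_eq_0[OF f] by (auto simp: tr_def)
  next
    fix p assume p: "p \<in> F I"
    then have "alternating_on k UNIV (\<omega> p)"
      using f F_mono[OF I(1)] unfolding is_form_alternating_on tangent_simplex by blast
    then have "alternating_on k (tangent (F I)) (\<omega> p)"
      by (rule alternating_on_mono) simp
    then show "alternating_on k (tangent (F I)) (tr (F I) \<omega> p)"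
      by (rule alternating_on_cong) (use p subspace_tangent_F[OF I] in \<open>auto simp: tr_def\<close>)
  qed
next
  fix vs assume vs: "length vs = k" "set vs \<subseteq> tangent (F I)"
  then have "poly_fun_on r (F V) (\<lambda>p. \<omega> p vs)"
    using \<omega> by (simp add: poly_forms_def tangent_simplex)
  then have "poly_fun_on r (F I) (\<lambda>p. \<omega> p vs)"
    using F_mono[OF I(1)] unfolding poly_fun_on_def by blast
  then show "poly_fun_on r (F I) (\<lambda>p. tr (F I) \<omega> p vs)"
    by (rule poly_fun_on_cong) (use vs in \<open>simp add: tr_def\<close>)
qed

text \<open>Trace and Koszul operator commute once the origin lies in the face, since only then is
  \<open>p - b\<close> tangent to it. The origin is therefore first moved to a vertex of the
  face.\<close>

lemma tr_trimmed:
  assumes I: "I \<subseteq> V" "I \<noteq> {}" and \<omega>: "\<omega> \<in> trimmed_forms (Suc d) k (F V)"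
  shows "tr (F I) \<omega> \<in> trimmed_forms (Suc d) k (F I)"
proof -
  obtain i where i: "i \<in> I"
    using I by blast
  define b where "b = x i"
  have b: "b \<in> affine hull (F I)" "b \<in> affine hull (F V)"
    using i I(1) by (auto simp: b_def intro!: hull_inc vertex_in_F)
  have "F V \<noteq> {}"
    using i I vertex_in_F by blast
  with \<omega> obtain a \<alpha> \<beta> where a: "a \<in> affine hull (F V)" and \<alpha>: "\<alpha> \<in> poly_forms (int d) k (F V)"
    and \<beta>: "\<beta> \<in> poly_forms (int d) (Suc k) (F V)" and eq: "\<omega> = (\<lambda>p vs. \<alpha> p vs + koszul a \<beta> p vs)"
    by (rule trimmed_formsE)
  define \<gamma> where "\<gamma> = (\<lambda>p vs. 1 * \<alpha> p vs + 1 * \<beta> p ((b - a) # vs))"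
  have "\<gamma> \<in> poly_forms (int d) k (F V)"
    unfolding \<gamma>_def by (intro poly_forms_lincomb \<alpha> contract_poly_forms[OF \<beta>]) (simp add: tangent_simplex)
  moreover have "tr (F I) \<omega> p vs = tr (F I) \<gamma> p vs + koszul b (tr (F I) \<beta>) p vs" for p vs
  proof (cases "p \<in> F I \<and> set vs \<subseteq> tangent (F I)")
    case True
    then have "p - b \<in> tangent (F I)"
      by (intro tangent_diff b) (simp add: hull_inc)
    then show ?thesis
      using True koszul_change_origin[OF poly_forms_is_form[OF \<beta>] a b(2), of p vs]
      by (simp add: tr_def \<gamma>_def eq koszul_def)
  next
    case False
    then show ?thesis
      by (auto simp: tr_def koszul_def)
  qed
  ultimately show ?thesis
    by (intro trimmed_formsI[OF b(1) tr_poly_forms[OF I] tr_poly_forms[OF I \<beta>]]) auto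
qed

text \<open>Expanding \<open>q - a\<close> in the standard basis shows that the Koszul operator
  raises the degree of coefficients by at most one.\<close>

lemma trimmed_poly_fun:
  assumes \<omega>: "\<omega> \<in> trimmed_forms (Suc d) k (F V)" and len: "length vs = k"
  shows "poly_fun_on (int (Suc d)) (F V) (\<lambda>q. \<omega> q vs)"
proof -
  have "F V \<noteq> {}"
    using V_nonempty vertex_in_F by blast
  with \<omega> obtain a \<alpha> \<beta> where \<alpha>: "\<alpha> \<in> poly_forms (int d) k (F V)"
    and \<beta>: "\<beta> \<in> poly_forms (int d) (Suc k) (F V)" and eq: "\<omega> = (\<lambda>p vs. \<alpha> p vs + koszul a \<beta> p vs)"
    by (rule trimmed_formsE)
  obtain A where A: "poly_at 0 {\<alpha>. mdeg \<alpha> \<le> d} A" "\<And>q. q \<in> F V \<Longrightarrow> \<alpha> q vs = A q"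
    using \<alpha> len unfolding poly_forms_def tangent_simplex poly_fun_on_iff by blast
  have "\<exists>B. poly_at 0 {\<alpha>. mdeg \<alpha> \<le> d} B \<and> (\<forall>q\<in>F V. \<beta> q (axis j 1 # vs) = B q)" for j
    using \<beta> len unfolding poly_forms_def tangent_simplex poly_fun_on_iff by auto
  then obtain B where B: "\<And>j. poly_at 0 {\<alpha>. mdeg \<alpha> \<le> d} (B j)"
    "\<And>j q. q \<in> F V \<Longrightarrow> \<beta> q (axis j 1 # vs) = B j q"
    by metis
  have "koszul a \<beta> q vs = (\<Sum>j\<in>UNIV. (q $ j + - a $ j) * B j q)" if q: "q \<in> F V" for q
  proof -
    have g: "alternating_on (Suc k) UNIV (\<beta> q)"
      using poly_forms_is_form[OF \<beta>] q unfolding is_form_alternating_on tangent_simplex by blast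
    have "q - a = (\<Sum>j\<in>UNIV. (q $ j + - a $ j) *\<^sub>R axis j 1)"
      using basis_expansion[of "q - a"] by (simp add: scalar_mult_eq_scaleR)
    then have "koszul a \<beta> q vs = \<beta> q ((0 # vs)[0 := \<Sum>j\<in>UNIV. (q $ j + - a $ j) *\<^sub>R axis j 1])"
      by (simp add: koszul_def)
    also have "\<dots> = (\<Sum>j\<in>UNIV. (q $ j + - a $ j) * \<beta> q ((0 # vs)[0 := axis j 1]))"
      by (rule alternating_on_sum[OF g subspace_UNIV]) (auto simp: len)
    finally show ?thesis
      by (simp add: B(2)[OF q])
  qed
  moreover have "poly_at 0 {\<alpha>. mdeg \<alpha> \<le> Suc d} (\<lambda>q. A q + (\<Sum>j\<in>UNIV. (q $ j + - a $ j) * B j q))"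
    by (intro poly_at_add poly_at_sum poly_at_affine_mult B poly_at_mono[OF A(1)])
       (auto simp: finite_mdeg_le linear_iff)
  ultimately show ?thesis
    unfolding poly_fun_on_iff eq using A(2) by force
qed

text \<open>Along a line through \<open>p\<close>, the left-hand side has degree \<open>Suc d\<close> by homogeneity, but degree at most
  \<open>d\<close> since the Koszul part vanishes on vectors parallel to the line.\<close>

lemma trimmed_radial_eq_0:
  assumes \<omega>: "\<omega> \<in> trimmed_forms (Suc d) k (F V)" and p: "p \<in> F V" and q: "q \<in> F V"
    and hom: "\<And>t vs. 0 \<le> t \<Longrightarrow> t \<le> 1 \<Longrightarrow> length vs = k \<Longrightarrow> \<omega> (p + t *\<^sub>R (q - p)) vs = t ^ Suc d * \<omega> q vs"
    and ws: "length ws = k" "i < k"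
  shows "\<omega> q (ws[i := q - p]) = 0"
proof -
  have "F V \<noteq> {}"
    using p by blast
  with \<omega> obtain a \<alpha> \<beta> where a: "a \<in> affine hull (F V)" and \<alpha>: "\<alpha> \<in> poly_forms (int d) k (F V)"
    and \<beta>: "\<beta> \<in> poly_forms (int d) (Suc k) (F V)" and eq: "\<omega> = (\<lambda>p vs. \<alpha> p vs + koszul a \<beta> p vs)"
    by (rule trimmed_formsE)
  define us where "us = ws[i := q - p]"
  have us: "length us = k" "us ! i = q - p"
    using ws by (simp_all add: us_def)
  \<comment> \<open>What is left of \<omega> on arguments containing \<open>q - p\<close>: on the
    line, \<open>c - a\<close> is the constant \<open>p - a\<close> plus a multiple of
    \<open>q - p\<close>. Its degree is at most \<open>d\<close>.\<close>
  define \<gamma> where "\<gamma> = (\<lambda>p' vs. 1 * \<alpha> p' vs + 1 * \<beta> p' ((p - a) # vs))"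
  have "\<gamma> \<in> poly_forms (int d) k (F V)"
    unfolding \<gamma>_def by (intro poly_forms_lincomb \<alpha> contract_poly_forms[OF \<beta>]) (simp add: tangent_simplex)
  then have "poly_fun_on (int d) (F V) (\<lambda>c. \<gamma> c us)"
    using us by (simp add: poly_forms_def tangent_simplex)
  from poly_fun_on_line[OF this, of p q] obtain P :: "real poly" where P: "degree P \<le> d"
    "\<And>t. p + t *\<^sub>R (q - p) \<in> F V \<Longrightarrow> \<gamma> (p + t *\<^sub>R (q - p)) us = poly P t"
    by blast
  have "poly P t = t ^ Suc d * \<omega> q us" if t: "0 \<le> t" "t \<le> 1" for t
  proof -
    define c where "c = p + t *\<^sub>R (q - p)"
    have "c = (1 - t) *\<^sub>R p + t *\<^sub>R q"
      by (simp add: c_def algebra_simps)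
    then have c: "c \<in> F V"
      using convexD_alt[OF convex_F p q t] by simp
    then have g: "alternating_on (Suc k) UNIV (\<beta> c)"
      using poly_forms_is_form[OF \<beta>] unfolding is_form_alternating_on tangent_simplex by blast
    have ca: "c - a = 1 *\<^sub>R (p - a) + t *\<^sub>R (q - p)"
      by (simp add: c_def)
    have "koszul a \<beta> c us = \<beta> c ((0 # us)[0 := 1 *\<^sub>R (p - a) + t *\<^sub>R (q - p)])"
      unfolding koszul_def ca by simp
    also have "\<dots> = 1 * \<beta> c ((0 # us)[0 := p - a]) + t * \<beta> c ((0 # us)[0 := q - p])"
      by (rule alternating_on_linear[OF g]) (auto simp: us)
    also have "\<beta> c ((0 # us)[0 := q - p]) = 0"
      by (rule alternating_on_eq_0[OF g, of _ 0 "Suc i"]) (auto simp: us ws)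
    finally have "\<omega> c us = \<gamma> c us"
      by (simp add: eq \<gamma>_def)
    then show ?thesis
      using P(2)[of t] hom[OF t us(1)] c by (simp add: c_def)
  qed
  \<comment> \<open>Agreement on a whole interval forces equality of polynomials, after which the
    coefficients at \<open>Suc d\<close> are compared.\<close>
  then have "{0..1} \<subseteq> {t. poly (P - monom (\<omega> q us) (Suc d)) t = 0}"
    by (auto simp: poly_monom)
  then have "infinite {t. poly (P - monom (\<omega> q us) (Suc d)) t = 0}"
    by (rule infinite_super) (simp add: infinite_Icc)
  then have "P - monom (\<omega> q us) (Suc d) = 0"
    using poly_roots_finite by blast
  then have "P = monom (\<omega> q us) (Suc d)"
    by simp
  then have "coeff P (Suc d) = \<omega> q us"
    by simp
  moreover have "coeff P (Suc d) = 0"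
    using P(1) by (intro coeff_eq_0) simp
  ultimately show ?thesis
    by (simp add: us_def)
qed

text \<open>Two replacements are made: homogeneity moves the base point from \<open>q\<close> to its
  projection \<open>m\<close> at the price of \<open>s ^ Suc d\<close>, and radial annihilation then
  replaces each vector by its image under \<open>dproj\<close> at the price of
  \<open>s ^ k\<close>.\<close>

theorem vanishing_eq_ext_form:
  assumes I: "I \<subseteq> V" "I \<noteq> {}" and \<omega>: "\<omega> \<in> trimmed_forms (Suc d) k (F V)"
    and van: "form_vanishes_on (F V) k (Suc d) \<omega> (F (V - I))"
  shows "\<omega> = ext_form I d k (tr (F I) \<omega>)"
proof (intro ext)
  fix q vs
  have ne: "F V \<noteq> {}"
    using V_nonempty vertex_in_F by blast
  have f: "is_form k (F V) \<omega>"
    by (rule is_form_trimmed[OF \<omega> ne])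
  have sub: "F (V - I) \<subseteq> F V"
    by (rule F_mono) auto
  have hom: "\<omega> (p + t *\<^sub>R (c - p)) us = t ^ Suc d * \<omega> c us"
    if "p \<in> F (V - I)" "c \<in> F V" "0 \<le> t" "t \<le> 1" "length us = k" for p c t us
  proof (rule fun_vanishes_line[OF solid_simplex])
    show "p \<in> F V"
      using that(1) sub by blast
    have "p + t *\<^sub>R (c - p) = (1 - t) *\<^sub>R p + t *\<^sub>R c"
      by (simp add: algebra_simps)
    then show "p + t *\<^sub>R (c - p) \<in> F V"
      using convexD_alt[OF convex_F \<open>p \<in> F V\<close> that(2-4)] by simp
    show "fun_vanishes (F V) (Suc d) (\<lambda>q. \<omega> q us) p"
      using van that unfolding form_vanishes_on_def by blast
  qed (use that trimmed_poly_fun[OF \<omega>] in auto)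
  show "\<omega> q vs = ext_form I d k (tr (F I) \<omega>) q vs"
  proof (cases "q \<in> F V \<and> length vs = k")
    case False
    then have "\<omega> q vs = 0"
      by (intro is_form_eq_0[OF f]) auto
    with False show ?thesis
      by (auto simp: ext_form_def)
  next
    case True
    then have q: "q \<in> F V" and len: "length vs = k"
      by auto
    have Lq: "0 \<le> L i q" if "i \<in> V" for i
      using that q mem_F[of V q] by auto
    define s where "s = weight I q"
    have sV: "s + (\<Sum>j\<in>V - I. L j q) = 1"
      using barycentric_sum(2)[of q] sum.subset_diff[OF I(1) finite_V, of "\<lambda>j. L j q"]
      by (simp add: s_def weight_def)
    show ?thesis
    proof (cases "s = 0")
      case True
      then have "L i q = 0" if "i \<in> I" for i
        using weight_eq_0D[OF I(1) q _ that] by (simp add: s_def)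
      then have "q \<in> F (V - I)"
        using mem_F[of "V - I" q] Lq by auto
      \<comment> \<open>Homogeneity with \<open>t = 0\<close> about \<open>q\<close> itself gives
        the value 0, as the exponent \<open>Suc d\<close> is positive.\<close>
      from hom[OF this q, of 0 vs] show ?thesis
        using True len by (simp add: ext_form_def s_def)
    next
      case False
      then have w: "weight I q \<noteq> 0"
        by (simp add: s_def)
      define m where "m = proj I q"
      have mI: "m \<in> F I"
        unfolding m_def by (rule proj_in_F[OF I(1) q w])
      then have mV: "m \<in> F V"
        using F_mono[OF I(1)] by blast
      have sm: "s *\<^sub>R m = (\<Sum>i\<in>I. L i q *\<^sub>R x i)"
        using False by (simp add: m_def proj_def scaleR_sum_right s_def)
      have "\<omega> q vs = s ^ Suc d * \<omega> m vs"
      \<comment> \<open>For \<open>s = 1\<close> the point lies in the face already and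
        \<open>1 - s\<close> cannot be divided by. This includes the case of an empty opposite
        face.\<close>
      proof (cases "s = 1")
        case True
        then have "(\<Sum>j\<in>V - I. L j q) = 0"
          using sV by simp
        then have "\<forall>j\<in>V - I. L j q = 0"
          using Lq by (subst (asm) sum_nonneg_eq_0_iff) auto
        then have "q = m"
          using barycentric_sum_on(1)[OF I(1)] sm True by simp
        then show ?thesis
          using True by simp
      next
        case ns: False
        have "0 \<le> (\<Sum>j\<in>V - I. L j q)"
          using Lq by (intro sum_nonneg) auto
        then have s1: "0 \<le> s" "s < 1"
          using sV ns weight_nonneg[OF I(1) q] by (auto simp: s_def)
        define p where "p = (\<Sum>j\<in>V - I. (L j q / (1 - s)) *\<^sub>R x j)"
        have one: "(\<Sum>j\<in>V - I. L j q / (1 - s)) = 1"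
          using sV s1 by (simp flip: sum_divide_distrib)
        have "L i p = (if i \<in> V - I then L i q / (1 - s) else 0)" if "i \<in> V" for i
          unfolding p_def by (rule L_vertex_sum[OF that _ one]) auto
        then have "p \<in> F (V - I)"
          using mem_F[of "V - I" p] Lq s1 by auto
        moreover have "(1 - s) *\<^sub>R p = (\<Sum>j\<in>V - I. L j q *\<^sub>R x j)"
          using s1 by (simp add: p_def scaleR_sum_right)
        then have "(1 - s) *\<^sub>R p + s *\<^sub>R m = q"
          using barycentric_sum(1)[of q] sum.subset_diff[OF I(1) finite_V, of "\<lambda>j. L j q *\<^sub>R x j"] sm by simp
        then have "q = p + s *\<^sub>R (m - p)"
          by (simp add: algebra_simps)
        ultimately show ?thesis
          using hom[of p m s vs] mV s1 len by simp
      qed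
      \<comment> \<open>The killed directions are \<open>m - x j\<close> with \<open>j\<close>
        outside \<open>I\<close>; they are radial at \<open>m\<close> because such an
        \<open>x j\<close> is a point of the opposite face.\<close>
      also have "\<omega> m vs = s ^ k * \<omega> m (map (dproj I q) vs)"
      proof (rule alternating_on_replace)
        show g: "alternating_on k UNIV (\<omega> m)"
          using f mV unfolding is_form_alternating_on tangent_simplex by blast
        show "finite (V - I)"
          by simp
        show "\<omega> m (ws[i := m - x j]) = 0" if "length ws = k" "i < k" "j \<in> V - I" for ws i j
        proof (rule trimmed_radial_eq_0[OF \<omega> _ mV])
          show "x j \<in> F V"
            using that by (auto intro: vertex_in_F)
          show "\<omega> (x j + t *\<^sub>R (m - x j)) us = t ^ Suc d * \<omega> m us"
            if "0 \<le> t" "t \<le> 1" "length us = k" for t us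
            using \<open>j \<in> V - I\<close> that by (intro hom mV vertex_in_F)
        qed (use that in auto)
        fix v
        \<comment> \<open>\<open>t\<close> is the derivative of the weight along \<open>v\<close>.
          The coordinates of \<open>v\<close> outside \<open>I\<close> sum to \<open>- t\<close>, so
          the multiples of \<open>m\<close> in the two parts cancel.\<close>
        define t where "t = (\<Sum>i\<in>I. h i v)"
        have "s *\<^sub>R dproj I q v = (\<Sum>i\<in>I. h i v *\<^sub>R x i - (t / s) *\<^sub>R (L i q *\<^sub>R x i))"
          unfolding dproj_def scaleR_sum_right
        proof (intro sum.cong refl)
          fix i
          have eq: "s * (h i v / s - L i q * t / s\<^sup>2) = h i v - (t / s) * L i q"
            using False by (simp add: field_simps power2_eq_square)
          show "s *\<^sub>R (h i v / weight I q - L i q * (\<Sum>j\<in>I. h j v) / (weight I q)\<^sup>2) *\<^sub>R x i =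
              h i v *\<^sub>R x i - (t / s) *\<^sub>R L i q *\<^sub>R x i"
            unfolding s_def[symmetric] t_def[symmetric] scaleR_scaleR eq by (rule scaleR_diff_left)
        qed
        also have "\<dots> = (\<Sum>i\<in>I. h i v *\<^sub>R x i) - (t / s) *\<^sub>R s *\<^sub>R m"
          unfolding sm by (simp add: sum_subtractf scaleR_sum_right)
        also have "(t / s) *\<^sub>R s *\<^sub>R m = t *\<^sub>R m"
          using False by simp
        finally have D: "s *\<^sub>R dproj I q v = (\<Sum>i\<in>I. h i v *\<^sub>R x i) - t *\<^sub>R m" .
        have v: "v = (\<Sum>j\<in>V - I. h j v *\<^sub>R x j) + (\<Sum>i\<in>I. h i v *\<^sub>R x i)"
          using tangent_sum(1)[of v] sum.subset_diff[OF I(1) finite_V, of "\<lambda>j. h j v *\<^sub>R x j"] by simp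
        have "(\<Sum>j\<in>V - I. h j v) = - t"
          using tangent_sum(2)[of v] sum.subset_diff[OF I(1) finite_V, of "\<lambda>j. h j v"] by (simp add: t_def)
        then have K: "(\<Sum>j\<in>V - I. (- h j v) *\<^sub>R (m - x j)) = (\<Sum>j\<in>V - I. h j v *\<^sub>R x j) + t *\<^sub>R m"
          by (simp add: scaleR_diff_right sum_subtractf sum_negf flip: scaleR_left.sum)
        have "s *\<^sub>R dproj I q v + (\<Sum>j\<in>V - I. (- h j v) *\<^sub>R (m - x j)) =
            (\<Sum>j\<in>V - I. h j v *\<^sub>R x j) + (\<Sum>i\<in>I. h i v *\<^sub>R x i)"
          unfolding D K by simp
        with v show "v = s *\<^sub>R dproj I q v + (\<Sum>j\<in>V - I. (- h j v) *\<^sub>R (m - x j))"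
          by (rule trans[OF _ sym])
      qed (rule len)
      also have "s ^ Suc d * (s ^ k * \<omega> m (map (dproj I q) vs)) = s ^ (Suc d + k) * \<omega> m (map (dproj I q) vs)"
        by (simp only: power_add mult.assoc)
      also have "\<omega> m (map (dproj I q) vs) = tr (F I) \<omega> m (map (dproj I q) vs)"
        using mI dproj_in_tangent[OF I w] by (auto simp: tr_def)
      finally show ?thesis
        using q len w by (simp add: ext_form_def s_def m_def)
    qed
  qed
qed

section \<open>Identification of the extension operator\<close>

text \<open>\<open>ext_form\<close> is linear and has the prescribed values on the generators, which
  gives existence. Uniqueness follows by induction over their span, and off the trimmed forms both
  operators are zero by convention.\<close>

lemma bary_ext_eq:
  assumes I: "I \<subseteq> V" "I \<noteq> {}"
  shows "bary_ext x (F V) (F I) k (Suc d) =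
    (\<lambda>\<mu>. if \<mu> \<in> trimmed_forms (Suc d) k (F I) then ext_form I d k \<mu> else (\<lambda>p vs. 0))" (is "_ = ?E")
  unfolding bary_ext_def
proof (rule the_equality)
  have eq: "(\<lambda>p vs. bary_power x (F J) \<alpha> p * whitney x (F J) k \<sigma> p vs) = whitney_form J k \<alpha> \<sigma>"
    if "I \<subseteq> J" "J \<subseteq> V" "\<sigma> ` {0..k} \<subseteq> I" for J \<alpha> \<sigma>
    using that by (intro whitney_form_eq) auto
  have gen: "?E (whitney_form I k \<alpha> \<sigma>) = whitney_form V k \<alpha> \<sigma>"
    if "\<forall>i. i \<notin> I \<longrightarrow> \<alpha> i = 0" "sum \<alpha> I + 1 = Suc d" "\<sigma> ` {0..k} \<subseteq> I" for \<alpha> \<sigma>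
    using whitney_form_trimmed[OF I that(3), of \<alpha> d] ext_form_whitney_form[OF I that(3), of \<alpha> d] that by simp
  show "is_bary_ext x (F V) (F I) k (Suc d) ?E"
    unfolding is_bary_ext_def vertex_indices_F[OF I(1)]
  proof (intro conjI ballI allI impI)
    fix \<mu> \<nu> a b assume "\<mu> \<in> trimmed_forms (Suc d) k (F I)" "\<nu> \<in> trimmed_forms (Suc d) k (F I)"
    then show "?E (\<lambda>p vs. a * \<mu> p vs + b * \<nu> p vs) = (\<lambda>p vs. a * ?E \<mu> p vs + b * ?E \<nu> p vs)"
      by (simp add: trimmed_forms_lincomb ext_form_lincomb)
  next
    fix \<alpha> \<sigma> assume *: "(\<forall>i. i \<notin> I \<longrightarrow> \<alpha> i = 0) \<and> sum \<alpha> I + 1 = Suc d \<and>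
        strict_mono_on {0..k} \<sigma> \<and> \<sigma> ` {0..k} \<subseteq> I"
    then have \<sigma>: "\<sigma> ` {0..k} \<subseteq> I"
      by blast
    show "?E (\<lambda>p vs. bary_power x (F I) \<alpha> p * whitney x (F I) k \<sigma> p vs) =
        (\<lambda>p vs. bary_power x (F V) \<alpha> p * whitney x (F V) k \<sigma> p vs)"
      unfolding eq[OF order_refl I(1) \<sigma>] eq[OF I(1) order_refl \<sigma>] using * by (intro gen) auto
  qed (use ext_form_trimmed_homogeneous[OF I] in auto)
  fix E assume E: "is_bary_ext x (F V) (F I) k (Suc d) E"
  have lin: "E (\<lambda>p vs. a * \<mu> p vs + b * \<nu> p vs) = (\<lambda>p vs. a * E \<mu> p vs + b * E \<nu> p vs)"
    if "\<mu> \<in> trimmed_forms (Suc d) k (F I)" "\<nu> \<in> trimmed_forms (Suc d) k (F I)" for \<mu> \<nu> a b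
    using E that unfolding is_bary_ext_def by blast
  have ne: "F I \<noteq> {}"
    using I vertex_in_F by blast
  have "\<mu> \<in> trimmed_forms (Suc d) k (F I) \<and> E \<mu> = ext_form I d k \<mu>" if "\<mu> \<in> form_span (generators I d k)" for \<mu>
    using that
  proof induction
    case zero
    have z: "(\<lambda>p vs. 0) \<in> trimmed_forms (Suc d) k (F I)"
      by (rule zero_trimmed[OF ne])
    then show ?case
      using lin[OF z z, of 0 0] by (simp add: ext_form_def fun_eq_iff)
  next
    case (step g \<mu> c)
    obtain \<alpha> \<sigma> where g: "g = whitney_form I k \<alpha> \<sigma>" "\<forall>i. i \<notin> I \<longrightarrow> \<alpha> i = 0" "sum \<alpha> I = d"
      "strict_mono_on {0..k} \<sigma>" "\<sigma> ` {0..k} \<subseteq> I"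
      using step(1) by (rule generatorE)
    have gt: "g \<in> trimmed_forms (Suc d) k (F I)"
      unfolding g(1) by (rule whitney_form_trimmed[OF I g(5,3)])
    have "E (\<lambda>p vs. bary_power x (F I) \<alpha> p * whitney x (F I) k \<sigma> p vs) =
        (\<lambda>p vs. bary_power x (F V) \<alpha> p * whitney x (F V) k \<sigma> p vs)"
      using E g unfolding is_bary_ext_def vertex_indices_F[OF I(1)] by simp
    then have "E g = whitney_form V k \<alpha> \<sigma>"
      unfolding eq[OF order_refl I(1) g(5)] eq[OF I(1) order_refl g(5)] g(1) .
    also have "\<dots> = ext_form I d k g"
      unfolding g(1) using ext_form_whitney_form[OF I g(5) _ g(3)] g(2) by simp
    finally have "E g = ext_form I d k g" .
    then show ?case
      using step(3) gt lin[OF gt, of \<mu> c 1] trimmed_forms_lincomb[OF gt, of \<mu> c 1]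
        ext_form_lincomb[of I d k c g 1 \<mu>] by simp
  qed
  then show "E = ?E"
    using trimmed_in_span[OF I] E unfolding is_bary_ext_def by (intro ext) auto
qed

lemma vanishing_forms_F:
  assumes I: "I \<subseteq> V" "I \<noteq> {}"
  shows "vanishing_forms x (F V) (F I) k (Suc d) =
    {\<omega> \<in> trimmed_forms (Suc d) k (F V). form_vanishes_on (F V) k (Suc d) \<omega> (F (V - I))}"
  by (simp add: vanishing_forms_def opposite_face_F I)

end

theorem theorem7p4:
  fixes x :: "nat \<Rightarrow> real^'n" and T f :: "(real^'n) set" and r k :: nat
  assumes "inj_on x {0..CARD('n)}"
    and "\<not> affine_dependent (x ` {0..CARD('n)})"
    and "T = convex hull (x ` {0..CARD('n)})"
    and "f \<in> faces T"
    and "1 \<le> r"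
    and "k \<le> CARD('n)"
  shows "vanishing_forms x T f k r = bary_ext x T f k r ` trimmed_forms r k f \<and>
    (\<forall>\<mu>\<in>trimmed_forms r k f.
       bary_ext x T f k r \<mu> \<in> vanishing_forms x T f k r \<and>
       tr f (bary_ext x T f k r \<mu>) = \<mu> \<and>
       (\<forall>\<omega>\<in>vanishing_forms x T f k r. tr f \<omega> = \<mu> \<longrightarrow> \<omega> = bary_ext x T f k r \<mu>))"
proof -
  interpret simplex x "{0..CARD('n)}"
    by unfold_locales (use assms in auto)
  let ?V = "{0..CARD('n)}"
  have T: "T = F ?V"
    by (simp add: F_def assms(3))
  obtain I where I: "I \<subseteq> ?V" "I \<noteq> {}" and f: "f = F I"
    using assms(4) unfolding T by (rule faceE)
  obtain d where r: "r = Suc d"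
    using assms(5) by (cases r) auto
  let ?E = "bary_ext x T f k r"
  have E: "?E \<mu> = ext_form I d k \<mu>" if "\<mu> \<in> trimmed_forms r k f" for \<mu>
    using that bary_ext_eq[OF I] by (simp add: T f r)
  have van: "vanishing_forms x T f k r =
      {\<omega> \<in> trimmed_forms (Suc d) k (F ?V). form_vanishes_on (F ?V) k (Suc d) \<omega> (F (?V - I))}"
    unfolding T f r by (rule vanishing_forms_F[OF I])
  have "F I \<noteq> {}"
    using I vertex_in_F by blast
  then have tr: "tr f (?E \<mu>) = \<mu>" if "\<mu> \<in> trimmed_forms r k f" for \<mu>
    using tr_ext_form[OF I is_form_trimmed] that E by (simp add: f r)
  have into: "?E \<mu> \<in> vanishing_forms x T f k r" if "\<mu> \<in> trimmed_forms r k f" for \<mu>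
    using ext_form_trimmed_homogeneous[OF I, of \<mu> d k] that homogeneous_on_vanishes[OF _ F_mono]
    unfolding van E[OF that] by (auto simp: f r)
  \<comment> \<open>A form in the vanishing space is recovered from its trace. This gives both
    surjectivity onto that space and uniqueness of the extension.\<close>
  have ext: "tr f \<omega> \<in> trimmed_forms r k f \<and> \<omega> = ?E (tr f \<omega>)" if "\<omega> \<in> vanishing_forms x T f k r" for \<omega>
  proof -
    have \<omega>: "\<omega> \<in> trimmed_forms (Suc d) k (F ?V)" "form_vanishes_on (F ?V) k (Suc d) \<omega> (F (?V - I))"
      using that van by auto
    then have "tr f \<omega> \<in> trimmed_forms r k f"
      unfolding f r by (intro tr_trimmed[OF I])
    with vanishing_eq_ext_form[OF I \<omega>] E show ?thesis
      by (simp add: f)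
  qed
  show ?thesis
    using tr into ext by (auto intro!: image_eqI)
qed

end
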